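(* For any polynomial $f(t,x)$ in $t$ and $x$, as $N\to\infty$, $$\langle\mu_t^{(N)},f\rangle\to\langle\mu_t,f\rangle$$ in probability in $C([0,T])$. Moreover, $$\partial_t\langle\mu_t,f\rangle=c\iint\frac{xf'(t,x)-yf'(t,y)}{x-y}\,d\mu_t(x)\,d\mu_t(y)+\langle\mu_t,\alpha f'+xf''+\partial_tf\rangle .$$
   Context: Fix $\alpha>1/2$, $c\in(0,\infty)$ and $T>0$. For each $N\ge1$ set $\beta=2c/N$ and let $(\lambda_1(t),\dots,\lambda_N(t))_{t\ge0}$ (depending on $N$) be the beta Laguerre process started from $0$: it satisfies $$d\lambda_i(t)=\sqrt{2\lambda_i(t)}\,db_i(t)+\alpha\,dt+\frac\beta2\sum_{j:j\ne i}\frac{2\lambda_i(t)}{\lambda_i(t)-\lambda_j(t)}\,dt,\qquad\lambda_i(0)=0,\qquad i=1,\dots,N,$$ with $0\le\lambda_1(t)\le\dots\le\lambda_N(t)$ for all $t>0$, where $b_1,\dots,b_N$ are independent standard Brownian motions. (For $0<\beta<1$ it is defined through the square of a type B radial Dunkl process: $\lambda_i=x_i^2/2$ where $dx_i=db_i+\frac{\alpha-1/2}{x_i}dt+\frac\beta2\sum_{j\ne i}\big(\frac1{x_i-x_j}+\frac1{x_i+x_j}\big)dt$, $x_i(0)=0$, $0\le x_1\le\dots\le x_N$. Almost surely the set of times with $\lambda_i(t)=\lambda_j(t)$ for some $i\neq j$ has Lebesgue measure zero. For $t>0$, $(\lambda_i(t)/t)_i$ has joint density proportional to $\prod_{i<j}|\lambda_j-\lambda_i|^\beta\prod_l\lambda_l^{\alpha-1}e^{-\lambda_l}$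 on $\{0\le\lambda_1\le\dots\le\lambda_N\}$.) $\mu_t^{(N)}=\frac1N\sum_{i=1}^N\delta_{\lambda_i(t)}$. $\nu_{\alpha,c}$ is the unique probability measure with moments $\int x^n\,d\nu_{\alpha,c}=u_n$, where $u_0=1$ and $u_n=(\alpha+n-1)u_{n-1}+c\sum_{i=0}^{n-1}u_iu_{n-i-1}$ for $n\ge1$; it has a density $\nu_{\alpha,c}(x)$ on $[0,\infty)$. Set $\mu_0=\delta_0$ and $\mu_t(dx)=\frac1t\nu_{\alpha,c}(x/t)\,dx$ for $t>0$. $\langle\mu,f\rangle=\int f\,d\mu$; for $f(t,x)$, $\langle\mu_t,f\rangle=\int f(t,x)\,d\mu_t(x)$; $f'=\partial f/\partial x$, $f''=\partial^2f/\partial x^2$, $\partial_tf=\partial f/\partial t$; $\partial_t\langle\mu_t,f\rangle$ is the derivative of $t\mapsto\langle\mu_t,f\rangle$. The quotient $\frac{xf'(t,x)-yf'(t,y)}{x-y}$ is a polynomial (extended by continuity to $x=y$). $C([0,T])$ is the space of continuous real functions on $[0,T]$ with the supremum norm; $X^{(N)}\to x$ in probability in $C([0,T])$ means $\mathbb P(\|X^{(N)}-x\|_\infty\ge\varepsilon)\to0$ for every $\varepsilon>0$. *)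

theory Defs
  imports "HOL-Probability.Probability"
begin

section \<open>Convergence in probability\<close>

text \<open>The spaces may vary along the sequence. Measurability is part of the definition because
  \<^const>\<open>measure\<close> is 0 on non-measurable sets.\<close>

definition null_in_prob :: "(nat \<Rightarrow> 'a measure) \<Rightarrow> (nat \<Rightarrow> 'a \<Rightarrow> real) \<Rightarrow> bool" where
  "null_in_prob M X \<longleftrightarrow>
     (\<forall>\<^sub>F n in sequentially. X n \<in> borel_measurable (M n)) \<and>
     (\<forall>\<epsilon>>0. (\<lambda>n. measure (M n) {\<omega> \<in> space (M n). \<bar>X n \<omega>\<bar> \<ge> \<epsilon>}) \<longlonglongrightarrow> 0)"

text \<open>Convergence in probability in \<open>C([0,T])\<close> to a deterministic limit. All functions involved are
  continuous on \<open>[0,T]\<close>, so that the supremum is the norm.\<close>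

definition tendsto_prob_C ::
  "(nat \<Rightarrow> 'a measure) \<Rightarrow> real \<Rightarrow> (nat \<Rightarrow> real \<Rightarrow> 'a \<Rightarrow> real) \<Rightarrow> (real \<Rightarrow> real) \<Rightarrow> bool" where
  "tendsto_prob_C M T X x \<longleftrightarrow>
     continuous_on {0..T} x \<and>
     (\<forall>\<^sub>F n in sequentially. \<forall>\<omega>\<in>space (M n). continuous_on {0..T} (\<lambda>t. X n t \<omega>)) \<and>
     null_in_prob M (\<lambda>n \<omega>. SUP t\<in>{0..T}. \<bar>X n t \<omega> - x t\<bar>)"


section \<open>Brownian motion and the Ito integral\<close>

text \<open>Filtrations are indexed by all reals in order to use the library's locale; only times
  \<open>t \<ge> 0\<close> matter. Coordinates carry the indices \<open>1, \<dots>, N\<close>, and index 0 of the independent family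
  below is the past \<open>F s\<close>.\<close>

definition indep_brownian_motions ::
  "'a measure \<Rightarrow> (real \<Rightarrow> 'a measure) \<Rightarrow> nat \<Rightarrow> (nat \<Rightarrow> real \<Rightarrow> 'a \<Rightarrow> real) \<Rightarrow> bool" where
  "indep_brownian_motions M F N b \<longleftrightarrow>
     prob_space M \<and> filtration (space M) F \<and> (\<forall>t. subalgebra M (F t)) \<and>
     (\<forall>i\<in>{1..N}. \<forall>t\<ge>0. b i t \<in> borel_measurable (F t)) \<and>
     (\<forall>i\<in>{1..N}. \<forall>\<omega>\<in>space M. b i 0 \<omega> = 0 \<and> continuous_on {0..} (\<lambda>t. b i t \<omega>)) \<and>
     (\<forall>s t. 0 \<le> s \<and> s < t \<longrightarrow>
        (\<forall>i\<in>{1..N}. distributed M lborel (\<lambda>\<omega>. b i t \<omega> - b i s \<omega>)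
                       (\<lambda>x. ennreal (normal_density 0 (sqrt (t - s)) x))) \<and>
        prob_space.indep_sets M
          (\<lambda>k. if k = 0 then sets (F s)
               else {(\<lambda>\<omega>. b k t \<omega> - b k s \<omega>) -` A \<inter> space M | A. A \<in> sets borel})
          {0..N})"

text \<open>Elementary processes \<open>\<Sum>k<m. \<xi> k 1\<^bsub>(\<tau> k, \<tau> (k+1)]\<^esub>\<close> with bounded \<open>F (\<tau> k)\<close>-measurable \<open>\<xi> k\<close>.\<close>

definition elementary ::
  "(real \<Rightarrow> 'a measure) \<Rightarrow> nat \<Rightarrow> (nat \<Rightarrow> real) \<Rightarrow> (nat \<Rightarrow> 'a \<Rightarrow> real) \<Rightarrow> bool" where
  "elementary F m \<tau> \<xi> \<longleftrightarrow>
     0 \<le> \<tau> 0 \<and> (\<forall>k<m. \<tau> k \<le> \<tau> (Suc k)) \<and>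
     (\<forall>k<m. \<xi> k \<in> borel_measurable (F (\<tau> k)) \<and> (\<exists>C. \<forall>\<omega>\<in>space (F (\<tau> k)). \<bar>\<xi> k \<omega>\<bar> \<le> C))"

definition elementary_process ::
  "nat \<Rightarrow> (nat \<Rightarrow> real) \<Rightarrow> (nat \<Rightarrow> 'a \<Rightarrow> real) \<Rightarrow> real \<Rightarrow> 'a \<Rightarrow> real" where
  "elementary_process m \<tau> \<xi> s \<omega> = (\<Sum>k<m. \<xi> k \<omega> * indicator {\<tau> k<..\<tau> (Suc k)} s)"

definition elementary_integral ::
  "nat \<Rightarrow> (nat \<Rightarrow> real) \<Rightarrow> (nat \<Rightarrow> 'a \<Rightarrow> real) \<Rightarrow> (real \<Rightarrow> 'a \<Rightarrow> real) \<Rightarrow> real \<Rightarrow> 'a \<Rightarrow> real" where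
  "elementary_integral m \<tau> \<xi> B t \<omega> =
     (\<Sum>k<m. \<xi> k \<omega> * (B (min (\<tau> (Suc k)) t) \<omega> - B (min (\<tau> k) t) \<omega>))"

text \<open>\<open>I t\<close> is a version of \<open>\<integral>\<^sub>0\<^sup>t H dB\<close>, for integrands with \<open>\<integral>\<^sub>0\<^sup>t H\<^sup>2 ds < \<infinity>\<close> almost surely: the limit
  in probability of \<open>\<integral>\<^sub>0\<^sup>t H\<^sub>n dB\<close> for elementary \<open>H\<^sub>n\<close> with \<open>\<integral>\<^sub>0\<^sup>t (H\<^sub>n - H)\<^sup>2 ds \<rightarrow> 0\<close> in probability.\<close>

definition is_ito_integral ::
  "'a measure \<Rightarrow> (real \<Rightarrow> 'a measure) \<Rightarrow> (real \<Rightarrow> 'a \<Rightarrow> real) \<Rightarrow> (real \<Rightarrow> 'a \<Rightarrow> real) \<Rightarrow>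
   (real \<Rightarrow> 'a \<Rightarrow> real) \<Rightarrow> bool" where
  "is_ito_integral M F B H I \<longleftrightarrow>
     (\<forall>t\<ge>0.
        (AE \<omega> in M. set_integrable lborel {0..t} (\<lambda>s. (H s \<omega>)\<^sup>2)) \<and>
        (\<exists>m \<tau> \<xi>.
           (\<forall>n. elementary F (m n) (\<tau> n) (\<xi> n)) \<and>
           null_in_prob (\<lambda>_. M)
             (\<lambda>n \<omega>. LINT s:{0..t}|lborel. (elementary_process (m n) (\<tau> n) (\<xi> n) s \<omega> - H s \<omega>)\<^sup>2) \<and>
           null_in_prob (\<lambda>_. M)
             (\<lambda>n \<omega>. elementary_integral (m n) (\<tau> n) (\<xi> n) B t \<omega> - I t \<omega>)))"


section \<open>The beta Laguerre process\<close>

definition ordered_process ::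
  "'a measure \<Rightarrow> (real \<Rightarrow> 'a measure) \<Rightarrow> nat \<Rightarrow> (nat \<Rightarrow> real \<Rightarrow> 'a \<Rightarrow> real) \<Rightarrow> bool" where
  "ordered_process M F N y \<longleftrightarrow>
     (\<forall>i\<in>{1..N}. \<forall>t\<ge>0. y i t \<in> borel_measurable (F t)) \<and>
     (\<forall>\<omega>\<in>space M.
        (\<forall>i\<in>{1..N}. y i 0 \<omega> = 0 \<and> continuous_on {0..} (\<lambda>t. y i t \<omega>)) \<and>
        (\<forall>t\<ge>0. (\<forall>i\<in>{1..N}. 0 \<le> y i t \<omega>) \<and> mono_on {1..N} (\<lambda>i. y i t \<omega>)))"

definition laguerre_drift :: "real \<Rightarrow> real \<Rightarrow> nat \<Rightarrow> nat \<Rightarrow> (nat \<Rightarrow> real) \<Rightarrow> real" where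
  "laguerre_drift \<alpha> \<beta> N i y =
     \<alpha> + \<beta> / 2 * (\<Sum>j\<in>{1..N} - {i}. 2 * y i / (y i - y j))"

definition dunkl_drift :: "real \<Rightarrow> real \<Rightarrow> nat \<Rightarrow> nat \<Rightarrow> (nat \<Rightarrow> real) \<Rightarrow> real" where
  "dunkl_drift \<alpha> \<beta> N i y =
     (\<alpha> - 1/2) / y i + \<beta> / 2 * (\<Sum>j\<in>{1..N} - {i}. 1 / (y i - y j) + 1 / (y i + y j))"

text \<open>Both equations are read as integral equations with an integrable drift. Since \<open>1/0 = 0\<close> in HOL,
  it has to be stated that the singular set of the drift is visited only on a null set of times.\<close>

definition laguerre_sde ::
  "'a measure \<Rightarrow> (real \<Rightarrow> 'a measure) \<Rightarrow> real \<Rightarrow> real \<Rightarrow> nat \<Rightarrow> (nat \<Rightarrow> real \<Rightarrow> 'a \<Rightarrow> real) \<Rightarrow>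
   (nat \<Rightarrow> real \<Rightarrow> 'a \<Rightarrow> real) \<Rightarrow> bool" where
  "laguerre_sde M F \<alpha> \<beta> N b lam \<longleftrightarrow>
     ordered_process M F N lam \<and>
     (AE \<omega> in M. AE t in lborel. 0 \<le> t \<longrightarrow> inj_on (\<lambda>i. lam i t \<omega>) {1..N}) \<and>
     (\<forall>i\<in>{1..N}.
        (AE \<omega> in M. \<forall>t\<ge>0.
           set_integrable lborel {0..t} (\<lambda>s. laguerre_drift \<alpha> \<beta> N i (\<lambda>j. lam j s \<omega>))) \<and>
        is_ito_integral M F (b i) (\<lambda>t \<omega>. sqrt (2 * lam i t \<omega>))
          (\<lambda>t \<omega>. lam i t \<omega>
                 - (LINT s:{0..t}|lborel. laguerre_drift \<alpha> \<beta> N i (\<lambda>j. lam j s \<omega>))))"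

text \<open>The noise is additive here, so the equation is solved path by path.\<close>

definition radial_dunkl ::
  "'a measure \<Rightarrow> (real \<Rightarrow> 'a measure) \<Rightarrow> real \<Rightarrow> real \<Rightarrow> nat \<Rightarrow> (nat \<Rightarrow> real \<Rightarrow> 'a \<Rightarrow> real) \<Rightarrow>
   (nat \<Rightarrow> real \<Rightarrow> 'a \<Rightarrow> real) \<Rightarrow> bool" where
  "radial_dunkl M F \<alpha> \<beta> N b x \<longleftrightarrow>
     ordered_process M F N x \<and>
     (AE \<omega> in M. AE t in lborel. 0 \<le> t \<longrightarrow>
        inj_on (\<lambda>i. x i t \<omega>) {1..N} \<and> (\<forall>i\<in>{1..N}. x i t \<omega> \<noteq> 0)) \<and>
     (AE \<omega> in M. \<forall>i\<in>{1..N}. \<forall>t\<ge>0.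
        set_integrable lborel {0..t} (\<lambda>s. dunkl_drift \<alpha> \<beta> N i (\<lambda>j. x j s \<omega>)) \<and>
        x i t \<omega> = b i t \<omega> + (LINT s:{0..t}|lborel. dunkl_drift \<alpha> \<beta> N i (\<lambda>j. x j s \<omega>)))"

definition beta_laguerre_process ::
  "'a measure \<Rightarrow> (real \<Rightarrow> 'a measure) \<Rightarrow> real \<Rightarrow> real \<Rightarrow> nat \<Rightarrow> (nat \<Rightarrow> real \<Rightarrow> 'a \<Rightarrow> real) \<Rightarrow>
   (nat \<Rightarrow> real \<Rightarrow> 'a \<Rightarrow> real) \<Rightarrow> bool" where
  "beta_laguerre_process M F \<alpha> \<beta> N b lam \<longleftrightarrow>
     indep_brownian_motions M F N b \<and>
     laguerre_sde M F \<alpha> \<beta> N b lam \<and>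
     (\<beta> < 1 \<longrightarrow>
        (\<exists>x. radial_dunkl M F \<alpha> \<beta> N b x \<and>
             (\<forall>i\<in>{1..N}. \<forall>t\<ge>0. \<forall>\<omega>\<in>space M. lam i t \<omega> = (x i t \<omega>)\<^sup>2 / 2)))"

text \<open>\<open>(1/N) \<Sum>i=1..N. \<delta>\<^bsub>y i\<^esub>\<close>\<close>

definition empirical_measure :: "nat \<Rightarrow> (nat \<Rightarrow> real) \<Rightarrow> real measure" where
  "empirical_measure N y = distr (uniform_count_measure {1..N}) borel y"


section \<open>The limiting measures\<close>

fun nu_moment :: "real \<Rightarrow> real \<Rightarrow> nat \<Rightarrow> real" where
  "nu_moment \<alpha> c 0 = 1"
| "nu_moment \<alpha> c (Suc n) = (\<alpha> + real n) * nu_moment \<alpha> c n + c * (\<Sum>i\<le>n. nu_moment \<alpha> c i * nu_moment \<alpha> c (n - i))"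

text \<open>\<open>g\<close> is a density of the probability measure \<open>\<nu>\<^bsub>\<alpha>,c\<^esub>\<close>, which is determined by its moments.\<close>

definition is_nu_density :: "real \<Rightarrow> real \<Rightarrow> (real \<Rightarrow> real) \<Rightarrow> bool" where
  "is_nu_density \<alpha> c g \<longleftrightarrow>
     g \<in> borel_measurable borel \<and> (\<forall>x. 0 \<le> g x) \<and> (\<forall>x<0. g x = 0) \<and>
     prob_space (density lborel (\<lambda>x. ennreal (g x))) \<and>
     (\<forall>n. integrable (density lborel (\<lambda>x. ennreal (g x))) (\<lambda>x. x ^ n) \<and>
          (\<integral>x. x ^ n \<partial>(density lborel (\<lambda>x. ennreal (g x)))) = nu_moment \<alpha> c n)"

definition mu :: "(real \<Rightarrow> real) \<Rightarrow> real \<Rightarrow> real measure" where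
  "mu g t = (if t = 0 then return borel 0 else density lborel (\<lambda>x. ennreal (1 / t * g (x / t))))"

text \<open>The quotient \<open>(h x - h y) / (x - y)\<close>, extended continuously to the diagonal for
  differentiable \<open>h\<close>.\<close>

definition diff_quot :: "(real \<Rightarrow> real) \<Rightarrow> real \<Rightarrow> real \<Rightarrow> real" where
  "diff_quot h x y = (if x = y then deriv h x else (h x - h y) / (x - y))"

end

theory Submission
  imports Defs "HOL-Computational_Algebra.Polynomial"
begin

text \<open>
  Write $S_k(t)$ for the $k$-th moment $\langle\mu^{(N)}_t, x^k\rangle$ and $u_k$ for the moments of
  $\nu_{\alpha,c}$. Since a polynomial is a combination of the functions $t^j x^k$, everything reduces
  to $S_k(t) \to u_k t^k$, uniformly on $[0,T]$ and in probability, for each $k$.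

  For $N > 2c$ one has $\beta < 1$, hence $\lambda_i = x_i^2/2$ where $x_i$ is a Brownian motion plus an
  absolutely continuous drift. The noise is additive, so that Ito's formula for $\sum_i \phi(x_i)$ is a
  Taylor expansion along each path plus a discrete martingale. With $\phi(x) = (x^2/2)^{n+1}$,
  exchanging $i$ and $j$ in the repulsion turns the singular drift into a polynomial in the moments:
  \[ S_{n+1}(t) = \int_0^t (n+1)\Big((\alpha+n) S_n + c \sum_{k\le n} S_k S_{n-k}
     - \frac{c(n+1)}{N} S_n\Big) ds + M(t), \]
  with $M$ a martingale of bracket $\frac{2(n+1)^2}{N}\int_0^t S_{2n+1}\,ds$
  (\<open>dunkl_generator_power\<close>, \<open>ito_maximal_estimate\<close>).

  The drift involves lower moments only, which invites induction on $n$; the bracket involves a higher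
  one. As long as $S_{n+1} \le K$, however, every $\lambda_i$ is at most $(NK)^{1/(n+1)}$, and the
  bracket is $O(N^{-1/(n+1)})$. So $M$ is uniformly small up to the first time when $S_{n+1}$ exceeds
  $K$ (\<open>laguerre_moment_estimate\<close>). By induction the drift converges, and the
  recursion for $u_{n+1}$ says that its limit integrates to $u_{n+1} t^{n+1}$. If $K$ is taken above
  the values of this limit on $[0,T]$, then $S_{n+1}$ stays close to the limit until it exceeds $K$, and by
  continuity it never does (\<open>bootstrap_bound\<close>, \<open>laguerre_moment_step\<close>).

  The differential equation for $\langle\mu_t,f\rangle$ is linear in $f$, and for $f = x^k$ it is again the
  recursion for $u_k$ (\<open>mu_generator_polynomial\<close>).
\<close>

section \<open>A maximal inequality for martingale transforms\<close>

text \<open>Joint independence of $G, Y_1, \dots, Y_N$; index 0 of the family is the past, as in the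
  definition of the driving Brownian motions.\<close>
definition indep_noise :: "'a measure \<Rightarrow> 'a measure \<Rightarrow> nat \<Rightarrow> (nat \<Rightarrow> 'a \<Rightarrow> real) \<Rightarrow> bool" where
  "indep_noise M G N Y \<longleftrightarrow>
     prob_space.indep_sets M
       (\<lambda>k. if k = 0 then sets G else {Y k -` A \<inter> space M | A. A \<in> sets borel}) {0..N}"

lemma (in prob_space) indep_noise_compose:
  assumes "indep_noise M G N Y" and "g \<in> borel_measurable borel"
  shows "indep_noise M G N (\<lambda>i \<omega>. g (Y i \<omega>))"
  unfolding indep_noise_def
proof (rule indep_sets_mono_sets[OF assms(1)[unfolded indep_noise_def]])
  fix k
  have "\<exists>B. (\<lambda>\<omega>. g (Y k \<omega>)) -` A \<inter> space M = Y k -` B \<inter> space M \<and> B \<in> sets borel"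
    if "A \<in> sets borel" for A
    using measurable_sets[OF assms(2) that] by (intro exI[of _ "g -` A"]) auto
  then show "(if k = 0 then sets G
        else {(\<lambda>\<omega>. g (Y k \<omega>)) -` A \<inter> space M |A. A \<in> sets borel})
       \<subseteq> (if k = 0 then sets G else {Y k -` A \<inter> space M |A. A \<in> sets borel})"
    by auto
qed

lemma (in prob_space) indep_noise_expectation:
  assumes noise: "indep_noise M G N Y" and sub: "subalgebra M G"
    and J: "J \<subseteq> {1..N}"
    and Z: "Z \<in> borel_measurable G" "integrable M Z"
    and Y: "\<And>i. i \<in> J \<Longrightarrow> integrable M (Y i)"
  shows "integrable M (\<lambda>\<omega>. Z \<omega> * (\<Prod>i\<in>J. Y i \<omega>))"
    and "expectation (\<lambda>\<omega>. Z \<omega> * (\<Prod>i\<in>J. Y i \<omega>)) = expectation Z * (\<Prod>i\<in>J. expectation (Y i))"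
proof -
  define X where "X k = (if k = 0 then Z else Y k)" for k
  have 0: "0 \<notin> J" and fin: "finite J" using J finite_subset by auto
  have ind: "indep_vars (\<lambda>_. borel) X (insert 0 J)"
    unfolding indep_vars_def2
  proof (intro conjI ballI)
    fix i assume "i \<in> insert 0 J"
    then show "random_variable borel (X i)"
      using 0 Y Z(2) by (auto simp: X_def)
  next
    show "indep_sets (\<lambda>i. {X i -` A \<inter> space M |A. A \<in> sets borel}) (insert 0 J)"
    proof (rule indep_sets_mono[OF noise[unfolded indep_noise_def]])
      show "insert 0 J \<subseteq> {0..N}" using J by auto
      have "Z -` A \<inter> space M \<in> sets G" if "A \<in> sets borel" for A
        using measurable_sets[OF Z(1) that] sub by (simp add: subalgebra_def)
      then show "{X i -` A \<inter> space M |A. A \<in> sets borel}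
          \<subseteq> (if i = 0 then sets G else {Y i -` A \<inter> space M |A. A \<in> sets borel})" for i
        by (auto simp: X_def)
    qed
  qed
  have int: "integrable M (X i)" if "i \<in> insert 0 J" for i
    using that Y Z(2) by (auto simp: X_def)
  have X_J: "(\<Prod>i\<in>J. h (X i)) = (\<Prod>i\<in>J. h (Y i))" for h :: "('a \<Rightarrow> real) \<Rightarrow> real"
    using 0 by (intro prod.cong) (auto simp: X_def)
  have eq: "(\<Prod>i\<in>insert 0 J. X i \<omega>) = Z \<omega> * (\<Prod>i\<in>J. Y i \<omega>)" for \<omega>
    using 0 fin X_J[of "\<lambda>f. f \<omega>"] by (simp add: X_def)
  show "integrable M (\<lambda>\<omega>. Z \<omega> * (\<Prod>i\<in>J. Y i \<omega>))"
    using indep_vars_integrable[OF _ ind int] fin by (simp add: eq)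
  have "expectation (\<lambda>\<omega>. \<Prod>i\<in>insert 0 J. X i \<omega>) = (\<Prod>i\<in>insert 0 J. expectation (X i))"
    by (rule indep_vars_lebesgue_integral[OF _ ind int]) (use fin in auto)
  then show "expectation (\<lambda>\<omega>. Z \<omega> * (\<Prod>i\<in>J. Y i \<omega>)) = expectation Z * (\<Prod>i\<in>J. expectation (Y i))"
    using 0 fin X_J[of "expectation"] by (simp add: eq) (simp add: X_def)
qed

text \<open>$N$ families of square integrable innovations with common variance \<open>v\<close>,
  each step jointly independent of its past and across the coordinates. Both the increments of
  Brownian motions on a grid and their centred squares are of this form.\<close>
locale martingale_differences = prob_space M for M :: "'a measure" +
  fixes G :: "nat \<Rightarrow> 'a measure" and N :: nat and Y :: "nat \<Rightarrow> nat \<Rightarrow> 'a \<Rightarrow> real" and v :: real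
  assumes sub: "\<And>l. subalgebra M (G l)"
    and mono: "\<And>l. sets (G l) \<subseteq> sets (G (Suc l))"
    and adapted: "\<And>i l. i \<in> {1..N} \<Longrightarrow> Y i l \<in> borel_measurable (G (Suc l))"
    and v: "0 \<le> v"
    and noise: "\<And>l. indep_noise M (G l) N (\<lambda>i. Y i l)"
    and square_int: "\<And>i l. i \<in> {1..N} \<Longrightarrow> integrable M (\<lambda>\<omega>. (Y i l \<omega>)\<^sup>2)"
    and centred: "\<And>i l. i \<in> {1..N} \<Longrightarrow> expectation (Y i l) = 0"
    and variance: "\<And>i l. i \<in> {1..N} \<Longrightarrow> expectation (\<lambda>\<omega>. (Y i l \<omega>)\<^sup>2) = v"
begin

definition transform :: "(nat \<Rightarrow> nat \<Rightarrow> 'a \<Rightarrow> real) \<Rightarrow> nat \<Rightarrow> 'a \<Rightarrow> real" where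
  "transform h n \<omega> = (\<Sum>l<n. \<Sum>i\<in>{1..N}. h i l \<omega> * Y i l \<omega>)"

lemma G_mono: "k \<le> l \<Longrightarrow> sets (G k) \<subseteq> sets (G l)"
proof (induction rule: dec_induct)
  case (step n)
  from step.IH mono[of n] show ?case by (rule order_trans)
qed simp

lemma measurable_G_mono: "X \<in> borel_measurable (G k) \<Longrightarrow> k \<le> l \<Longrightarrow> X \<in> borel_measurable (G l)"
  for X :: "'a \<Rightarrow> real"
  using G_mono[of k l] sub[of k] sub[of l]
  by (intro measurable_from_subalg[of "G l" "G k"]) (auto simp: subalgebra_def)

lemma measurable_G_M: "X \<in> borel_measurable (G k) \<Longrightarrow> X \<in> borel_measurable M"
  for X :: "'a \<Rightarrow> real"
  using sub[of k] by (rule measurable_from_subalg)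

lemma Y_measurable: "i \<in> {1..N} \<Longrightarrow> Y i l \<in> borel_measurable M"
  using adapted measurable_G_M by blast

lemma Y_integrable: "i \<in> {1..N} \<Longrightarrow> integrable M (Y i l)"
  by (rule square_integrable_imp_integrable[OF Y_measurable square_int])

lemma transform_measurable:
  assumes "\<And>i l. i \<in> {1..N} \<Longrightarrow> l < n \<Longrightarrow> h i l \<in> borel_measurable (G l)"
  shows "transform h n \<in> borel_measurable (G n)"
  unfolding transform_def
proof (intro borel_measurable_sum borel_measurable_times)
  fix l i assume *: "l \<in> {..<n}" "i \<in> {1..N}"
  show "h i l \<in> borel_measurable (G n)"
    by (rule measurable_G_mono[OF assms]) (use * in auto)
  show "Y i l \<in> borel_measurable (G n)"
    by (rule measurable_G_mono[OF adapted]) (use * in auto)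
qed

text \<open>The mixed terms vanish because two different coordinates are independent given the past. This
  is where averaging over $N$ particles gains a factor $1/N$: only $\sum_i h_i^2$ enters.\<close>
lemma step_second_moment:
  assumes h: "\<And>i. i \<in> {1..N} \<Longrightarrow> h i \<in> borel_measurable (G l)"
    and bd: "\<And>\<omega>. \<omega> \<in> space M \<Longrightarrow> (\<Sum>i\<in>{1..N}. (h i \<omega>)\<^sup>2) \<le> C"
  shows "integrable M (\<lambda>\<omega>. (\<Sum>i\<in>{1..N}. h i \<omega> * Y i l \<omega>)\<^sup>2)"
    and "expectation (\<lambda>\<omega>. (\<Sum>i\<in>{1..N}. h i \<omega> * Y i l \<omega>)\<^sup>2) \<le> v * C"
proof -
  have h_abs: "\<bar>h i \<omega> * h j \<omega>\<bar> \<le> C" if "i \<in> {1..N}" "j \<in> {1..N}" "\<omega> \<in> space M" for i j \<omega>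
  proof -
    have "(h i \<omega>)\<^sup>2 \<le> C" "(h j \<omega>)\<^sup>2 \<le> C"
      using bd[OF that(3)] member_le_sum[of _ "{1..N}" "\<lambda>i. (h i \<omega>)\<^sup>2"] that by fastforce+
    moreover have "2 * \<bar>h i \<omega> * h j \<omega>\<bar> \<le> (h i \<omega>)\<^sup>2 + (h j \<omega>)\<^sup>2"
      using sum_squares_bound[of "\<bar>h i \<omega>\<bar>" "\<bar>h j \<omega>\<bar>"] by (simp add: abs_mult)
    ultimately show ?thesis by simp
  qed
  have hh_meas: "(\<lambda>\<omega>. h i \<omega> * h j \<omega>) \<in> borel_measurable (G l)" if "i \<in> {1..N}" "j \<in> {1..N}" for i j
    using h[OF that(1)] h[OF that(2)] by measurable
  have hh_int: "integrable M (\<lambda>\<omega>. h i \<omega> * h j \<omega>)" if "i \<in> {1..N}" "j \<in> {1..N}" for i j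
    by (rule integrable_const_bound[of _ C])
      (use h_abs that measurable_G_M[OF hh_meas[OF that]] in auto)
  define e where "e i j \<omega> = h i \<omega> * h j \<omega> * (Y i l \<omega> * Y j l \<omega>)" for i j \<omega>
  have e: "integrable M (e i j) \<and>
      expectation (e i j) = (if i = j then v * expectation (\<lambda>\<omega>. (h i \<omega>)\<^sup>2) else 0)"
    if ij: "i \<in> {1..N}" "j \<in> {1..N}" for i j
  proof (cases "i = j")
    case True
    have *: "indep_noise M (G l) N (\<lambda>i \<omega>. (Y i l \<omega>)\<^sup>2)"
      by (rule indep_noise_compose[OF noise]) simp
    note exp = indep_noise_expectation[OF * sub, of "{i}" "\<lambda>\<omega>. h i \<omega> * h i \<omega>"]
    show ?thesis
      using exp ij square_int[OF ij(1)] variance[OF ij(1)] hh_meas[of i i] hh_int[of i i] True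
      by (simp add: e_def[abs_def] power2_eq_square mult_ac)
  next
    case False
    note exp = indep_noise_expectation[OF noise sub, of "{i, j}" "\<lambda>\<omega>. h i \<omega> * h j \<omega>"]
    show ?thesis
      using exp ij Y_integrable centred hh_meas[of i j] hh_int[of i j] False
      by (auto simp: e_def[abs_def])
  qed
  have sq: "(\<Sum>i\<in>{1..N}. h i \<omega> * Y i l \<omega>)\<^sup>2 = (\<Sum>i\<in>{1..N}. \<Sum>j\<in>{1..N}. e i j \<omega>)" for \<omega>
    by (simp add: power2_eq_square sum_product e_def mult_ac)
  show "integrable M (\<lambda>\<omega>. (\<Sum>i\<in>{1..N}. h i \<omega> * Y i l \<omega>)\<^sup>2)"
    unfolding sq using e by (intro Bochner_Integration.integrable_sum) auto
  have "expectation (\<lambda>\<omega>. (\<Sum>i\<in>{1..N}. h i \<omega> * Y i l \<omega>)\<^sup>2)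
      = (\<Sum>i\<in>{1..N}. \<Sum>j\<in>{1..N}. expectation (e i j))"
  proof -
    have "integrable M (\<lambda>\<omega>. \<Sum>j\<in>{1..N}. e i j \<omega>)" if "i \<in> {1..N}" for i
      using e that by (intro Bochner_Integration.integrable_sum) blast
    moreover have "expectation (\<lambda>\<omega>. \<Sum>j\<in>{1..N}. e i j \<omega>) = (\<Sum>j\<in>{1..N}. expectation (e i j))"
      if "i \<in> {1..N}" for i
      using e that by (intro Bochner_Integration.integral_sum) blast
    ultimately show ?thesis
      unfolding sq by (subst Bochner_Integration.integral_sum) (auto intro!: sum.cong)
  qed
  also have "\<dots> = (\<Sum>i\<in>{1..N}. v * expectation (\<lambda>\<omega>. (h i \<omega>)\<^sup>2))"
  proof (rule sum.cong[OF refl])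
    fix i assume i: "i \<in> {1..N}"
    have "(\<Sum>j\<in>{1..N}. expectation (e i j))
        = (\<Sum>j\<in>{1..N}. if i = j then v * expectation (\<lambda>\<omega>. (h i \<omega>)\<^sup>2) else 0)"
      by (rule sum.cong[OF refl]) (use e i in blast)
    then show "(\<Sum>j\<in>{1..N}. expectation (e i j)) = v * expectation (\<lambda>\<omega>. (h i \<omega>)\<^sup>2)"
      using i by simp
  qed
  also have "\<dots> = v * expectation (\<lambda>\<omega>. \<Sum>i\<in>{1..N}. (h i \<omega>)\<^sup>2)"
    using hh_int by (subst Bochner_Integration.integral_sum)
      (auto simp: power2_eq_square sum_distrib_left)
  also have "\<dots> \<le> v * C"
  proof -
    have "expectation (\<lambda>\<omega>. \<Sum>i\<in>{1..N}. (h i \<omega>)\<^sup>2) \<le> C"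
      using bd hh_int by (intro integral_le_const Bochner_Integration.integrable_sum)
        (auto simp: power2_eq_square)
    then show ?thesis using v by (rule mult_left_mono)
  qed
  finally show "expectation (\<lambda>\<omega>. (\<Sum>i\<in>{1..N}. h i \<omega> * Y i l \<omega>)\<^sup>2) \<le> v * C" .
qed

text \<open>Orthogonality in time: the past $W$ of the sum, multiplied by the coefficient of the next step,
  is measurable with respect to the past, and the innovation is centred.\<close>
lemma transform_second_moment:
  assumes h: "\<And>i l. i \<in> {1..N} \<Longrightarrow> h i l \<in> borel_measurable (G l)"
    and bd: "\<And>l \<omega>. \<omega> \<in> space M \<Longrightarrow> (\<Sum>i\<in>{1..N}. (h i l \<omega>)\<^sup>2) \<le> C"
  shows "integrable M (\<lambda>\<omega>. (transform h n \<omega>)\<^sup>2) \<and>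
         expectation (\<lambda>\<omega>. (transform h n \<omega>)\<^sup>2) \<le> real n * v * C"
proof (induction n)
  case 0
  then show ?case by (simp add: transform_def)
next
  case (Suc n)
  define W where "W = transform h n"
  define \<zeta> where "\<zeta> \<omega> = (\<Sum>i\<in>{1..N}. h i n \<omega> * Y i n \<omega>)" for \<omega>
  have W_G: "W \<in> borel_measurable (G n)"
    unfolding W_def by (rule transform_measurable) (rule h)
  have W_M: "W \<in> borel_measurable M" by (rule measurable_G_M[OF W_G])
  have W_int: "integrable M W"
    by (rule square_integrable_imp_integrable[OF W_M]) (use Suc in \<open>simp add: W_def\<close>)
  have \<zeta>: "integrable M (\<lambda>\<omega>. (\<zeta> \<omega>)\<^sup>2)" "expectation (\<lambda>\<omega>. (\<zeta> \<omega>)\<^sup>2) \<le> v * C"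
    unfolding \<zeta>_def by (rule step_second_moment; use h bd in auto)+
  have cross: "integrable M (\<lambda>\<omega>. W \<omega> * h i n \<omega> * Y i n \<omega>) \<and>
      expectation (\<lambda>\<omega>. W \<omega> * h i n \<omega> * Y i n \<omega>) = 0" if i: "i \<in> {1..N}" for i
  proof -
    have Wh_G: "(\<lambda>\<omega>. W \<omega> * h i n \<omega>) \<in> borel_measurable (G n)"
      using W_G h[OF i, of n] by measurable
    have h_le: "\<bar>h i n \<omega>\<bar> \<le> 1 + C" if "\<omega> \<in> space M" for \<omega>
    proof -
      have "(h i n \<omega>)\<^sup>2 \<le> C"
        using bd[OF that, of n] member_le_sum[of i "{1..N}" "\<lambda>i. (h i n \<omega>)\<^sup>2"] i by fastforce
      moreover have "2 * \<bar>h i n \<omega>\<bar> * 1 \<le> \<bar>h i n \<omega>\<bar>\<^sup>2 + 1\<^sup>2"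
        by (rule sum_squares_bound)
      moreover have "0 \<le> \<bar>h i n \<omega>\<bar>" by simp
      ultimately show ?thesis unfolding power2_abs by simp
    qed
    have "integrable M (\<lambda>\<omega>. (1 + C) * W \<omega>)" using W_int by simp
    then have Wh_int: "integrable M (\<lambda>\<omega>. W \<omega> * h i n \<omega>)"
    proof (rule Bochner_Integration.integrable_bound[OF _ measurable_G_M[OF Wh_G]])
      show "AE \<omega> in M. norm (W \<omega> * h i n \<omega>) \<le> norm ((1 + C) * W \<omega>)"
      proof (rule AE_I2)
        fix \<omega> assume "\<omega> \<in> space M"
        from h_le[OF this] show "norm (W \<omega> * h i n \<omega>) \<le> norm ((1 + C) * W \<omega>)"
          by (simp add: abs_mult mult.commute mult_left_mono)
      qed
    qed
    show ?thesis
      using indep_noise_expectation[OF noise sub, of "{i}" _ n, OF _ Wh_G Wh_int Y_integrable] i centred[OF i]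
      by simp
  qed
  have W\<zeta>: "(\<lambda>\<omega>. W \<omega> * \<zeta> \<omega>) = (\<lambda>\<omega>. \<Sum>i\<in>{1..N}. W \<omega> * h i n \<omega> * Y i n \<omega>)"
    by (simp add: \<zeta>_def sum_distrib_left mult.assoc)
  have W\<zeta>_int: "integrable M (\<lambda>\<omega>. W \<omega> * \<zeta> \<omega>)"
    unfolding W\<zeta> by (rule Bochner_Integration.integrable_sum) (use cross in blast)
  have W\<zeta>_0: "expectation (\<lambda>\<omega>. W \<omega> * \<zeta> \<omega>) = 0"
    unfolding W\<zeta> by (subst Bochner_Integration.integral_sum) (use cross in auto)
  have eq: "(\<lambda>\<omega>. (transform h (Suc n) \<omega>)\<^sup>2) = (\<lambda>\<omega>. (W \<omega>)\<^sup>2 + 2 * (W \<omega> * \<zeta> \<omega>) + (\<zeta> \<omega>)\<^sup>2)"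
    by (simp add: transform_def W_def \<zeta>_def power2_sum algebra_simps fun_eq_iff)
  have W2: "integrable M (\<lambda>\<omega>. (W \<omega>)\<^sup>2)" "expectation (\<lambda>\<omega>. (W \<omega>)\<^sup>2) \<le> real n * v * C"
    using Suc by (auto simp: W_def)
  show ?case
    unfolding eq
  proof
    show "integrable M (\<lambda>\<omega>. (W \<omega>)\<^sup>2 + 2 * (W \<omega> * \<zeta> \<omega>) + (\<zeta> \<omega>)\<^sup>2)"
      using W2 W\<zeta>_int \<zeta> by simp
    have "expectation (\<lambda>\<omega>. (W \<omega>)\<^sup>2 + 2 * (W \<omega> * \<zeta> \<omega>) + (\<zeta> \<omega>)\<^sup>2)
        = expectation (\<lambda>\<omega>. (W \<omega>)\<^sup>2) + expectation (\<lambda>\<omega>. (\<zeta> \<omega>)\<^sup>2)"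
      using W2 W\<zeta>_int W\<zeta>_0 \<zeta> by simp
    then show "expectation (\<lambda>\<omega>. (W \<omega>)\<^sup>2 + 2 * (W \<omega> * \<zeta> \<omega>) + (\<zeta> \<omega>)\<^sup>2) \<le> real (Suc n) * v * C"
      using W2 \<zeta> by (simp add: algebra_simps)
  qed
qed

text \<open>The event says that the transform becomes large before \<open>q\<close> exceeds the
  level \<open>K\<close>. Replacing the coefficients by $0$ once \<open>q\<close> has exceeded
  \<open>K\<close> or the transform has reached $\varepsilon$ gives a transform which on this
  event is frozen at a value of size at least $\varepsilon$, so that Chebyshev's inequality at the
  final time suffices.\<close>
lemma maximal_inequality:
  fixes n :: nat and q :: "nat \<Rightarrow> 'a \<Rightarrow> real" and K C \<epsilon> :: real
  assumes h: "\<And>i l. i \<in> {1..N} \<Longrightarrow> h i l \<in> borel_measurable (G l)"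
    and q: "\<And>l. q l \<in> borel_measurable (G l)"
    and bd: "\<And>l \<omega>. \<omega> \<in> space M \<Longrightarrow> q l \<omega> \<le> K \<Longrightarrow> (\<Sum>i\<in>{1..N}. (h i l \<omega>)\<^sup>2) \<le> C"
    and "0 \<le> C" and \<epsilon>: "0 < \<epsilon>"
  defines "E \<equiv> {\<omega> \<in> space M. \<exists>k\<le>n. (\<forall>l<k. q l \<omega> \<le> K) \<and> \<epsilon> \<le> \<bar>transform h k \<omega>\<bar>}"
  shows "E \<in> events" and "prob E \<le> real n * v * C / \<epsilon>\<^sup>2"
proof -
  have [measurable]: "q l \<in> borel_measurable M" "transform h l \<in> borel_measurable M" for l
    by (rule measurable_G_M[OF q], rule measurable_G_M[OF transform_measurable[OF h]])
  show E: "E \<in> events" unfolding E_def by measurable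
  define R where "R l = {\<omega> \<in> space M. \<forall>j\<le>l. q j \<omega> \<le> K \<and> \<bar>transform h j \<omega>\<bar> < \<epsilon>}" for l
  define h' where "h' i l \<omega> = indicator (R l) \<omega> * h i l \<omega>" for i l \<omega>
  have R_G: "R l \<in> sets (G l)" for l
  proof -
    have "{\<omega> \<in> space (G l). \<forall>j\<in>{..l}. q j \<omega> \<le> K \<and> \<bar>transform h j \<omega>\<bar> < \<epsilon>} \<in> sets (G l)"
    proof (rule sets.sets_Collect_finite_All)
      fix j assume "j \<in> {..l}"
      then have "j \<le> l" by simp
      have [measurable]: "q j \<in> borel_measurable (G l)"
        by (rule measurable_G_mono[OF q \<open>j \<le> l\<close>])
      have [measurable]: "transform h j \<in> borel_measurable (G l)"
        by (rule measurable_G_mono[OF transform_measurable[OF h] \<open>j \<le> l\<close>])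
      show "{\<omega> \<in> space (G l). q j \<omega> \<le> K \<and> \<bar>transform h j \<omega>\<bar> < \<epsilon>} \<in> sets (G l)"
        by measurable
    qed simp
    moreover have "R l = {\<omega> \<in> space (G l). \<forall>j\<in>{..l}. q j \<omega> \<le> K \<and> \<bar>transform h j \<omega>\<bar> < \<epsilon>}"
      using sub[of l] unfolding R_def subalgebra_def by auto
    ultimately show ?thesis by metis
  qed
  have h': "h' i l \<in> borel_measurable (G l)" if "i \<in> {1..N}" for i l
    unfolding h'_def[abs_def] using h[OF that, of l] R_G[of l] by measurable
  have bd': "(\<Sum>i\<in>{1..N}. (h' i l \<omega>)\<^sup>2) \<le> C" if "\<omega> \<in> space M" for l \<omega>
  proof (cases "\<omega> \<in> R l")
    case True
    then have "q l \<omega> \<le> K" by (simp add: R_def)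
    from bd[OF that this] show ?thesis using True by (simp add: h'_def)
  qed (simp add: h'_def \<open>0 \<le> C\<close>)
  have stopped: "\<epsilon> \<le> \<bar>transform h' n \<omega>\<bar>" if "\<omega> \<in> E" for \<omega>
  proof -
    define P where "P k \<longleftrightarrow> \<epsilon> \<le> \<bar>transform h k \<omega>\<bar>" for k
    obtain k where k: "k \<le> n" "\<forall>l<k. q l \<omega> \<le> K" "P k" and \<omega>: "\<omega> \<in> space M"
      using \<open>\<omega> \<in> E\<close> by (auto simp: E_def P_def)
    define m where "m = (LEAST k. P k)"
    have m: "P m" "m \<le> k" "\<And>j. j < m \<Longrightarrow> \<not> P j"
      unfolding m_def using k(3) by (auto intro: LeastI Least_le dest: not_less_Least)
    have "\<omega> \<in> R l \<longleftrightarrow> l < m" for l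
    proof
      assume "\<omega> \<in> R l"
      then have "\<forall>j\<le>l. \<not> P j" by (auto simp: R_def P_def)
      with m(1) show "l < m" by (meson not_le)
    next
      assume "l < m"
      with m k \<omega> show "\<omega> \<in> R l" by (auto simp: R_def P_def not_le)
    qed
    then have h'_eq: "h' i l \<omega> = (if l < m then h i l \<omega> else 0)" for i l
      by (simp add: h'_def indicator_def)
    have "transform h' n \<omega> = (\<Sum>l<n. if l < m then \<Sum>i\<in>{1..N}. h i l \<omega> * Y i l \<omega> else 0)"
      by (auto simp: transform_def h'_eq intro!: sum.cong)
    also have "\<dots> = (\<Sum>l\<in>{..<n} \<inter> {l. l < m}. \<Sum>i\<in>{1..N}. h i l \<omega> * Y i l \<omega>)"
      by (subst sum.inter_restrict) auto
    also have "{..<n} \<inter> {l. l < m} = {..<m}" using m(2) k(1) by auto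
    finally have "transform h' n \<omega> = transform h m \<omega>" by (simp add: transform_def)
    with m(1) show ?thesis by (simp add: P_def)
  qed
  have mom: "integrable M (\<lambda>\<omega>. (transform h' n \<omega>)\<^sup>2)"
       "expectation (\<lambda>\<omega>. (transform h' n \<omega>)\<^sup>2) \<le> real n * v * C"
    using transform_second_moment[OF h' bd'] by auto
  have "prob E \<le> prob {\<omega> \<in> space M. \<epsilon>\<^sup>2 \<le> (transform h' n \<omega>)\<^sup>2}"
  proof (rule finite_measure_mono)
    show "E \<subseteq> {\<omega> \<in> space M. \<epsilon>\<^sup>2 \<le> (transform h' n \<omega>)\<^sup>2}"
      using stopped \<epsilon> abs_le_square_iff[of \<epsilon>] by (auto simp: E_def)
    have [measurable]: "transform h' n \<in> borel_measurable M"
      by (rule measurable_G_M[OF transform_measurable[OF h']])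
    show "{\<omega> \<in> space M. \<epsilon>\<^sup>2 \<le> (transform h' n \<omega>)\<^sup>2} \<in> events" by measurable
  qed
  also have "\<dots> \<le> expectation (\<lambda>\<omega>. (transform h' n \<omega>)\<^sup>2) / \<epsilon>\<^sup>2"
    by (rule integral_Markov_inequality_measure[OF mom(1), of "{}"]) (use \<epsilon> in auto)
  also have "\<dots> \<le> real n * v * C / \<epsilon>\<^sup>2"
    using mom(2) by (intro divide_right_mono) auto
  finally show "prob E \<le> real n * v * C / \<epsilon>\<^sup>2" .
qed

end

section \<open>The Ito formula along a single path\<close>

text \<open>Here \<open>\<phi>1\<close> and \<open>\<phi>2\<close> stand for the first two
  derivatives of $\phi$. If $x_t = b_t + \int_0^t a\,ds$ with a Brownian motion $b$, this is the
  value that Ito's formula gives to the stochastic integral $\int_0^t \phi'(x)\,db$, expressed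
  without stochastic integration.\<close>
definition ito_remainder ::
  "(real \<Rightarrow> real) \<Rightarrow> (real \<Rightarrow> real) \<Rightarrow> (real \<Rightarrow> real) \<Rightarrow> (real \<Rightarrow> real) \<Rightarrow> (real \<Rightarrow> real) \<Rightarrow> real \<Rightarrow> real" where
  "ito_remainder \<phi> \<phi>1 \<phi>2 x a t =
     \<phi> (x t) - \<phi> (x 0) - integral {0..t} (\<lambda>s. \<phi>1 (x s) * a s + \<phi>2 (x s) / 2)"

definition grid_increment :: "(real \<Rightarrow> real) \<Rightarrow> real \<Rightarrow> nat \<Rightarrow> real" where
  "grid_increment b \<delta> l = b (real (Suc l) * \<delta>) - b (real l * \<delta>)"

lemma lipschitz_of_deriv_bound:
  fixes f f' :: "real \<Rightarrow> real"
  assumes "\<And>z. (f has_real_derivative f' z) (at z)" and "\<And>z. \<bar>z\<bar> \<le> R \<Longrightarrow> \<bar>f' z\<bar> \<le> C"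
    and "\<bar>u\<bar> \<le> R" "\<bar>v\<bar> \<le> R"
  shows "\<bar>f u - f v\<bar> \<le> C * \<bar>u - v\<bar>"
proof -
  have "norm (f u - f v) \<le> C * norm (u - v)"
    by (rule field_differentiable_bound[of "{-R..R}" f f' C])
       (use assms in \<open>auto simp: abs_le_iff intro: DERIV_subset\<close>)
  then show ?thesis by simp
qed

lemma continuous_mult_absolutely_integrable:
  fixes f a :: "real \<Rightarrow> real"
  assumes "continuous_on {s..r} f" and "a absolutely_integrable_on {s..r}"
  shows "(\<lambda>p. f p * a p) absolutely_integrable_on {s..r}"
proof (rule absolutely_integrable_bounded_measurable_product_real)
  show "f \<in> borel_measurable (lebesgue_on {s..r})"
    by (intro continuous_imp_measurable_on_sets_lebesgue assms) auto
  show "bounded (f ` {s..r})"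
    by (intro compact_imp_bounded compact_continuous_image assms) auto
qed (use assms in auto)

lemma continuous_on_compose_differentiable:
  fixes f f' x :: "real \<Rightarrow> real"
  assumes "\<And>z. (f has_real_derivative f' z) (at z)" and "continuous_on S x"
  shows "continuous_on S (\<lambda>p. f (x p))"
  by (rule continuous_on_compose2[OF DERIV_continuous_on[of UNIV] assms(2)])
    (use assms in \<open>auto intro: has_field_derivative_at_within\<close>)

lemma ito_integrand_integrable:
  fixes \<phi>1 \<phi>2 \<phi>3 x a :: "real \<Rightarrow> real"
  assumes d2: "\<And>z. (\<phi>1 has_real_derivative \<phi>2 z) (at z)"
    and d3: "\<And>z. (\<phi>2 has_real_derivative \<phi>3 z) (at z)"
    and x: "continuous_on {s..r} x" and a: "a absolutely_integrable_on {s..r}"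
  shows "(\<lambda>p. \<phi>1 (x p) * a p) integrable_on {s..r}"
    and "(\<lambda>p. \<phi>2 (x p) / 2) integrable_on {s..r}"
    and "(\<lambda>p. \<phi>1 (x p) * a p + \<phi>2 (x p) / 2) integrable_on {s..r}"
proof -
  show 1: "(\<lambda>p. \<phi>1 (x p) * a p) integrable_on {s..r}"
    by (intro set_lebesgue_integral_eq_integral(1) continuous_mult_absolutely_integrable
        continuous_on_compose_differentiable[OF d2 x] a)
  show 2: "(\<lambda>p. \<phi>2 (x p) / 2) integrable_on {s..r}"
    by (intro integrable_continuous_real continuous_intros
        continuous_on_compose_differentiable[OF d3 x]) auto
  show "(\<lambda>p. \<phi>1 (x p) * a p + \<phi>2 (x p) / 2) integrable_on {s..r}"
    by (rule integrable_add[OF 1 2])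
qed

text \<open>One grid step is split at $y = x_s + (b_r - b_s)$. From $y$ to $x_r$ only the drift
  acts, and the mean value theorem applies; from $x_s$ to $y$ only the noise acts, and Taylor's
  formula of order two leaves a cubic error. Here \<open>w\<close> bounds the oscillation of $x$
  and the increment of $b$ on the step.\<close>
lemma ito_step:
  fixes \<phi> \<phi>1 \<phi>2 \<phi>3 x b a :: "real \<Rightarrow> real"
  assumes d1: "\<And>z. (\<phi> has_real_derivative \<phi>1 z) (at z)"
    and d2: "\<And>z. (\<phi>1 has_real_derivative \<phi>2 z) (at z)"
    and d3: "\<And>z. (\<phi>2 has_real_derivative \<phi>3 z) (at z)"
    and C2: "\<And>z. \<bar>z\<bar> \<le> R \<Longrightarrow> \<bar>\<phi>2 z\<bar> \<le> C2" and C3: "\<And>z. \<bar>z\<bar> \<le> R \<Longrightarrow> \<bar>\<phi>3 z\<bar> \<le> C3"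
    and sr: "s \<le> r"
    and cont: "continuous_on {s..r} x" and a: "a absolutely_integrable_on {s..r}"
    and x_r: "x r = x s + (b r - b s) + integral {s..r} a"
    and x_R: "\<And>p. p \<in> {s..r} \<Longrightarrow> \<bar>x p\<bar> \<le> R" and y_R: "\<bar>x s + (b r - b s)\<bar> \<le> R"
    and x_w: "\<And>p q. p \<in> {s..r} \<Longrightarrow> q \<in> {s..r} \<Longrightarrow> \<bar>x p - x q\<bar> \<le> w"
    and b_w: "\<bar>b r - b s\<bar> \<le> w"
  shows "\<bar>\<phi> (x r) - \<phi> (x s) - integral {s..r} (\<lambda>p. \<phi>1 (x p) * a p + \<phi>2 (x p) / 2)
           - (\<phi>1 (x s) * (b r - b s) + \<phi>2 (x s) / 2 * ((b r - b s)\<^sup>2 - (r - s)))\<bar>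
         \<le> 2 * C2 * w * integral {s..r} (\<lambda>p. \<bar>a p\<bar>) + C3 * \<bar>b r - b s\<bar> ^ 3 + C3 * w * (r - s)"
proof -
  define \<Delta> where "\<Delta> = b r - b s"
  define y where "y = x s + \<Delta>"
  have "C2 \<ge> 0" "C3 \<ge> 0" using C2[of y] C3[of y] y_R by (auto simp: y_def \<Delta>_def)
  note a_int = set_lebesgue_integral_eq_integral(1)[OF a]
  have abs_int: "(\<lambda>p. \<bar>a p\<bar>) integrable_on {s..r}"
    using a absolutely_integrable_on_def by (auto simp: absolutely_integrable_on_def)
  note \<phi>1_int = ito_integrand_integrable(1)[OF d2 d3 cont a]
  note \<phi>2_int = ito_integrand_integrable(2)[OF d2 d3 cont a]
  \<comment> \<open>the drift part\<close>
  have drift: "\<bar>\<phi> (x r) - \<phi> y - integral {s..r} (\<lambda>p. \<phi>1 (x p) * a p)\<bar>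
      \<le> 2 * C2 * w * integral {s..r} (\<lambda>p. \<bar>a p\<bar>)"
  proof -
    have "\<exists>\<xi>. \<phi> (x r) - \<phi> y = \<phi>1 \<xi> * (x r - y) \<and> \<xi> \<in> closed_segment y (x r)"
    proof (cases "x r = y")
      case True
      then show ?thesis by (intro exI[of _ y]) auto
    next
      case False
      then consider "x r < y" | "y < x r" by linarith
      then show ?thesis
      proof cases
        case 1
        obtain \<xi> where "x r < \<xi>" "\<xi> < y" "\<phi> y - \<phi> (x r) = (y - x r) * \<phi>1 \<xi>"
          using MVT2[OF 1, of \<phi> \<phi>1] d1 by blast
        then show ?thesis
          by (intro exI[of _ \<xi>]) (auto simp: closed_segment_eq_real_ivl algebra_simps)
      next
        case 2
        obtain \<xi> where "y < \<xi>" "\<xi> < x r" "\<phi> (x r) - \<phi> y = (x r - y) * \<phi>1 \<xi>"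
          using MVT2[OF 2, of \<phi> \<phi>1] d1 by blast
        then show ?thesis
          by (intro exI[of _ \<xi>]) (auto simp: closed_segment_eq_real_ivl algebra_simps)
      qed
    qed
    then obtain \<xi> where \<xi>: "\<phi> (x r) - \<phi> y = \<phi>1 \<xi> * (x r - y)" "\<xi> \<in> closed_segment y (x r)"
      by blast
    have "\<bar>y\<bar> \<le> R" "\<bar>x r\<bar> \<le> R" using y_R x_R[of r] sr by (auto simp: y_def \<Delta>_def)
    then have \<xi>_R: "\<bar>\<xi>\<bar> \<le> R" using \<xi>(2) by (auto simp: closed_segment_eq_real_ivl split: if_splits)
    have \<xi>_w: "\<bar>\<phi>1 \<xi> - \<phi>1 (x p)\<bar> \<le> 2 * C2 * w" if p: "p \<in> {s..r}" for p
    proof -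
      have "\<bar>y - x p\<bar> \<le> 2 * w" "\<bar>x r - x p\<bar> \<le> w"
        using x_w[of s p] x_w[of r p] b_w p sr by (auto simp: y_def \<Delta>_def)
      then have "\<bar>\<xi> - x p\<bar> \<le> 2 * w"
        using \<xi>(2) by (auto simp: closed_segment_eq_real_ivl split: if_splits)
      moreover have "\<bar>\<phi>1 \<xi> - \<phi>1 (x p)\<bar> \<le> C2 * \<bar>\<xi> - x p\<bar>"
        by (rule lipschitz_of_deriv_bound[OF d2 C2 \<xi>_R x_R[OF p]])
      ultimately show ?thesis
        using mult_left_mono[of "\<bar>\<xi> - x p\<bar>" "2 * w" C2] \<open>C2 \<ge> 0\<close> by simp
    qed
    have "\<phi> (x r) - \<phi> y = integral {s..r} (\<lambda>p. \<phi>1 \<xi> * a p)"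
      using \<xi>(1) x_r by (simp add: y_def \<Delta>_def)
    then have "\<phi> (x r) - \<phi> y - integral {s..r} (\<lambda>p. \<phi>1 (x p) * a p)
        = integral {s..r} (\<lambda>p. \<phi>1 \<xi> * a p - \<phi>1 (x p) * a p)"
      by (subst Henstock_Kurzweil_Integration.integral_diff)
        (use a_int \<phi>1_int in \<open>auto intro: integrable_on_mult_right\<close>)
    also have "\<bar>\<dots>\<bar> \<le> integral {s..r} (\<lambda>p. 2 * C2 * w * \<bar>a p\<bar>)"
    proof (rule integral_norm_bound_integral[where 'a = real, unfolded real_norm_def])
      show "(\<lambda>p. \<phi>1 \<xi> * a p - \<phi>1 (x p) * a p) integrable_on {s..r}"
        using a_int \<phi>1_int by (intro integrable_diff integrable_on_mult_right)
      show "(\<lambda>p. 2 * C2 * w * \<bar>a p\<bar>) integrable_on {s..r}"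
        using abs_int by (rule integrable_on_mult_right)
      show "\<bar>\<phi>1 \<xi> * a p - \<phi>1 (x p) * a p\<bar> \<le> 2 * C2 * w * \<bar>a p\<bar>" if "p \<in> {s..r}" for p
        using mult_right_mono[OF \<xi>_w[OF that], of "\<bar>a p\<bar>"]
        by (simp add: abs_mult[symmetric] left_diff_distrib)
    qed
    finally show ?thesis by simp
  qed
  \<comment> \<open>the noise part\<close>
  have noise: "\<bar>\<phi> y - \<phi> (x s) - \<phi>1 (x s) * \<Delta> - \<phi>2 (x s) / 2 * \<Delta>\<^sup>2\<bar> \<le> C3 * \<bar>\<Delta>\<bar> ^ 3"
  proof (cases "\<Delta> = 0")
    case False
    define diff where "diff m = (if m = 0 then \<phi> else if m = 1 then \<phi>1 else if m = 2 then \<phi>2 else \<phi>3)"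
      for m :: nat
    have R: "\<bar>x s\<bar> \<le> R" "\<bar>y\<bar> \<le> R" using x_R[of s] y_R sr by (auto simp: y_def \<Delta>_def)
    have "\<exists>t. (if y < x s then y < t \<and> t < x s else x s < t \<and> t < y) \<and>
        \<phi> y = (\<Sum>m<3. (diff m (x s) / fact m) * (y - x s) ^ m) + (diff 3 t / fact 3) * (y - x s) ^ 3"
    proof (rule Taylor[where a = "-R" and b = R])
      show "\<forall>m t. m < 3 \<and> - R \<le> t \<and> t \<le> R \<longrightarrow> (diff m has_real_derivative diff (Suc m) t) (at t)"
      proof (intro allI impI)
        fix m :: nat and t :: real
        assume "m < 3 \<and> - R \<le> t \<and> t \<le> R"
        then have "m = 0 \<or> m = 1 \<or> m = 2" by auto
        then show "(diff m has_real_derivative diff (Suc m) t) (at t)"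
          using d1 d2 d3 by (auto simp: diff_def)
      qed
      show "y \<noteq> x s" using False by (simp add: y_def)
    qed (use R in \<open>auto simp: diff_def\<close>)
    then obtain t where t: "if y < x s then y < t \<and> t < x s else x s < t \<and> t < y"
      and eq: "\<phi> y = (\<Sum>m<3. (diff m (x s) / fact m) * (y - x s) ^ m) + (diff 3 t / fact 3) * (y - x s) ^ 3"
      by blast
    have "\<bar>t\<bar> \<le> R" using t R by (auto split: if_splits)
    have "\<phi> y - \<phi> (x s) - \<phi>1 (x s) * \<Delta> - \<phi>2 (x s) / 2 * \<Delta>\<^sup>2 = \<phi>3 t / 6 * \<Delta> ^ 3"
      unfolding eq by (simp add: diff_def y_def numeral_3_eq_3 fact_numeral power2_eq_square)
    also have "\<bar>\<dots>\<bar> = \<bar>\<phi>3 t\<bar> / 6 * \<bar>\<Delta>\<bar> ^ 3" by (simp add: abs_mult power_abs)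
    also have "\<dots> \<le> C3 * \<bar>\<Delta>\<bar> ^ 3"
      using C3[OF \<open>\<bar>t\<bar> \<le> R\<close>] by (intro mult_right_mono) auto
    finally show ?thesis .
  qed (simp add: y_def)
  \<comment> \<open>the quadratic variation part\<close>
  have var: "\<bar>\<phi>2 (x s) / 2 * (r - s) - integral {s..r} (\<lambda>p. \<phi>2 (x p) / 2)\<bar> \<le> C3 * w * (r - s)"
  proof -
    have "\<phi>2 (x s) / 2 * (r - s) - integral {s..r} (\<lambda>p. \<phi>2 (x p) / 2)
        = integral {s..r} (\<lambda>p. \<phi>2 (x s) / 2 - \<phi>2 (x p) / 2)"
      by (subst Henstock_Kurzweil_Integration.integral_diff) (use \<phi>2_int sr in auto)
    also have "\<bar>\<dots>\<bar> \<le> integral {s..r} (\<lambda>p. C3 * w)"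
    proof (rule integral_norm_bound_integral[where 'a = real, unfolded real_norm_def])
      show "(\<lambda>p. \<phi>2 (x s) / 2 - \<phi>2 (x p) / 2) integrable_on {s..r}"
        using \<phi>2_int by (intro integrable_diff) auto
      show "\<bar>\<phi>2 (x s) / 2 - \<phi>2 (x p) / 2\<bar> \<le> C3 * w" if p: "p \<in> {s..r}" for p
      proof -
        have "\<bar>\<phi>2 (x s) - \<phi>2 (x p)\<bar> \<le> C3 * \<bar>x s - x p\<bar>"
          by (rule lipschitz_of_deriv_bound[OF d3 C3]) (use x_R p sr in auto)
        also have "\<dots> \<le> C3 * w" using x_w[of s p] p sr \<open>C3 \<ge> 0\<close> by (intro mult_left_mono) auto
        finally show ?thesis by simp
      qed
    qed auto
    finally show ?thesis using sr by (simp add: mult_ac)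
  qed
  have split: "integral {s..r} (\<lambda>p. \<phi>1 (x p) * a p + \<phi>2 (x p) / 2)
      = integral {s..r} (\<lambda>p. \<phi>1 (x p) * a p) + integral {s..r} (\<lambda>p. \<phi>2 (x p) / 2)"
    by (rule Henstock_Kurzweil_Integration.integral_add[OF \<phi>1_int \<phi>2_int])
  have regroup: "\<phi> (x r) - \<phi> (x s) - (I + J) - (\<phi>1 (x s) * \<Delta> + \<phi>2 (x s) / 2 * (\<Delta>\<^sup>2 - (r - s)))
      = (\<phi> (x r) - \<phi> y - I) + (\<phi> y - \<phi> (x s) - \<phi>1 (x s) * \<Delta> - \<phi>2 (x s) / 2 * \<Delta>\<^sup>2)
        + (\<phi>2 (x s) / 2 * (r - s) - J)" for I J
    by (simp add: field_simps)
  show ?thesis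
    unfolding split \<Delta>_def[symmetric] regroup using drift noise var by linarith
qed

text \<open>The sum of the step errors is at most a multiple of the oscillation of $x$ and $b$ at
  mesh size, which tends to zero by uniform continuity, plus a multiple of the cubic variation of
  $b$ along the grids. The compensator of the squared increments is kept explicit, so that what
  remains to be estimated is a martingale.\<close>
lemma pathwise_ito:
  fixes \<phi> \<phi>1 \<phi>2 \<phi>3 x b a :: "real \<Rightarrow> real" and r :: "nat \<Rightarrow> nat"
  assumes d1: "\<And>z. (\<phi> has_real_derivative \<phi>1 z) (at z)"
    and d2: "\<And>z. (\<phi>1 has_real_derivative \<phi>2 z) (at z)"
    and d3: "\<And>z. (\<phi>2 has_real_derivative \<phi>3 z) (at z)"
    and \<phi>3: "continuous_on UNIV \<phi>3"
    and T: "0 < T"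
    and x: "continuous_on {0..T} x" and b: "continuous_on {0..T} b"
    and a: "a absolutely_integrable_on {0..T}"
    and eq: "\<And>t. t \<in> {0..T} \<Longrightarrow> x t = b t + integral {0..t} a"
    and r: "filterlim r at_top sequentially"
    and cubes: "(\<lambda>j. \<Sum>l<r j. \<bar>grid_increment b (T / real (r j)) l\<bar> ^ 3) \<longlonglongrightarrow> 0"
    and \<eta>: "0 < \<eta>"
  shows "\<forall>\<^sub>F j in sequentially. \<forall>k\<le>r j.
     \<bar>ito_remainder \<phi> \<phi>1 \<phi>2 x a (real k * (T / real (r j)))
       - (\<Sum>l<k. \<phi>1 (x (real l * (T / real (r j)))) * grid_increment b (T / real (r j)) l
               + \<phi>2 (x (real l * (T / real (r j)))) / 2
                 * ((grid_increment b (T / real (r j)) l)\<^sup>2 - T / real (r j)))\<bar> \<le> \<eta>"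
proof -
  have "bounded (x ` {0..T} \<union> b ` {0..T})"
    using x b by (simp add: compact_imp_bounded compact_continuous_image)
  then obtain R where R: "\<And>p. p \<in> {0..T} \<Longrightarrow> \<bar>x p\<bar> \<le> R \<and> \<bar>b p\<bar> \<le> R"
    unfolding bounded_iff real_norm_def by (metis UnI1 UnI2 imageI)
  have R0: "0 \<le> R" using R[of 0] T by auto
  \<comment> \<open>The point reached by the noise alone, \<open>x\<close> plus an increment of \<open>b\<close>, lies within \<open>3 * R\<close>.\<close>
  have bd: "\<exists>C>0. \<forall>z. \<bar>z\<bar> \<le> 3 * R \<longrightarrow> \<bar>f z\<bar> \<le> C" if "continuous_on UNIV f" for f :: "real \<Rightarrow> real"
  proof -
    have "bounded (f ` {-(3*R)..3*R})"
      by (intro compact_imp_bounded compact_continuous_image continuous_on_subset[OF that]) auto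
    then obtain C where "C > 0" "\<And>z. z \<in> {-(3*R)..3*R} \<Longrightarrow> \<bar>f z\<bar> \<le> C"
      unfolding bounded_pos by auto
    then show ?thesis by (intro exI[of _ C]) (auto simp: abs_le_iff)
  qed
  obtain C2 where C2: "C2 > 0" "\<And>z. \<bar>z\<bar> \<le> 3 * R \<Longrightarrow> \<bar>\<phi>2 z\<bar> \<le> C2"
    using bd[OF DERIV_continuous_on[of UNIV \<phi>2 \<phi>3]] d3 by (auto intro: has_field_derivative_at_within)
  obtain C3 where C3: "C3 > 0" "\<And>z. \<bar>z\<bar> \<le> 3 * R \<Longrightarrow> \<bar>\<phi>3 z\<bar> \<le> C3"
    using bd[OF \<phi>3] by auto
  define V where "V = integral {0..T} (\<lambda>p. \<bar>a p\<bar>)"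
  have a_sub: "a absolutely_integrable_on {s..t}" if "0 \<le> s" "t \<le> T" for s t
    by (rule set_integrable_subset[OF a]) (use that in auto)
  have abs_int: "(\<lambda>p. \<bar>a p\<bar>) integrable_on {s..t}" if "0 \<le> s" "t \<le> T" for s t
    using a_sub[OF that] by (auto simp: absolutely_integrable_on_def)
  have V0: "V \<ge> 0" unfolding V_def by (rule integral_nonneg) (use abs_int[of 0 T] in auto)
  define D where "D = 2 * C2 * V + C3 * T"
  have D: "D > 0" using C2 C3 T V0 by (simp add: D_def add_nonneg_pos)
  \<comment> \<open>This oscillation makes all errors except the cubic one add up to at most half of \<open>\<eta>\<close>.\<close>
  define w where "w = \<eta> / (2 * D)"
  have w: "w > 0" using D \<eta> by (simp add: w_def)
  have "uniformly_continuous_on {0..T} x" "uniformly_continuous_on {0..T} b"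
    using x b by (auto intro: compact_uniformly_continuous)
  then obtain d1' d2' where d': "d1' > 0" "d2' > 0"
    "\<And>p q. p \<in> {0..T} \<Longrightarrow> q \<in> {0..T} \<Longrightarrow> \<bar>q - p\<bar> < d1' \<Longrightarrow> \<bar>x q - x p\<bar> < w"
    "\<And>p q. p \<in> {0..T} \<Longrightarrow> q \<in> {0..T} \<Longrightarrow> \<bar>q - p\<bar> < d2' \<Longrightarrow> \<bar>b q - b p\<bar> < w"
    using w unfolding uniformly_continuous_on_def dist_real_def by metis
  define d where "d = min d1' d2'"
  have d: "d > 0" using d' by (simp add: d_def)
  have "(\<lambda>j. T / real (r j)) \<longlonglongrightarrow> 0"
    by (intro real_tendsto_divide_at_top[OF tendsto_const]
        filterlim_compose[OF filterlim_real_sequentially r])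
  then have mesh: "\<forall>\<^sub>F j in sequentially. T / real (r j) < d"
    using d by (rule order_tendstoD(2))
  have pos: "\<forall>\<^sub>F j in sequentially. 0 < r j"
    using r[unfolded filterlim_at_top, rule_format, of 1] by (auto elim: eventually_mono)
  have cub: "\<forall>\<^sub>F j in sequentially. (\<Sum>l<r j. \<bar>grid_increment b (T / real (r j)) l\<bar> ^ 3) < \<eta> / (2 * C3)"
    using cubes C3(1) \<eta> by (intro order_tendstoD(2)) auto
  show ?thesis
    using mesh pos cub
  proof eventually_elim
    case (elim j)
    define n where "n = r j"
    define \<delta> where "\<delta> = T / real n"
    have n: "n > 0" and \<delta>: "\<delta> > 0" "\<delta> < d" and n\<delta>: "real n * \<delta> = T"
      using elim T by (auto simp: n_def \<delta>_def)
    define \<tau> where "\<tau> l = real l * \<delta>" for l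
    have \<tau>: "\<tau> l \<le> \<tau> (Suc l)" "0 \<le> \<tau> l" "\<tau> (Suc l) - \<tau> l = \<delta>" for l
      using \<delta> by (auto simp: \<tau>_def algebra_simps)
    have \<tau>T: "\<tau> l \<le> T" if "l \<le> n" for l
      using that \<delta> unfolding n\<delta>[symmetric] by (simp add: \<tau>_def)
    define g where "g p = \<phi>1 (x p) * a p + \<phi>2 (x p) / 2" for p
    define S where "S l = \<phi>1 (x (\<tau> l)) * grid_increment b \<delta> l
               + \<phi>2 (x (\<tau> l)) / 2 * ((grid_increment b \<delta> l)\<^sup>2 - \<delta>)" for l
    define e where "e l = 2 * C2 * w * integral {\<tau> l..\<tau> (Suc l)} (\<lambda>p. \<bar>a p\<bar>)
        + C3 * \<bar>grid_increment b \<delta> l\<bar> ^ 3 + C3 * w * \<delta>" for l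
    have g_int: "g integrable_on {0..T}"
      unfolding g_def by (rule ito_integrand_integrable(3)[OF d2 d3 x a])
    have step: "\<bar>\<phi> (x (\<tau> (Suc l))) - \<phi> (x (\<tau> l)) - integral {\<tau> l..\<tau> (Suc l)} g - S l\<bar> \<le> e l"
      if l: "l < n" for l
    proof -
      have sub: "{\<tau> l..\<tau> (Suc l)} \<subseteq> {0..T}"
        using \<tau>(2)[of l] \<tau>T[of "Suc l"] l by auto
      then have in_T: "p \<in> {0..T}" if "p \<in> {\<tau> l..\<tau> (Suc l)}" for p using that by blast
      have ends: "\<tau> l \<in> {0..T}" "\<tau> (Suc l) \<in> {0..T}" using in_T \<tau>(1) by auto
      have b_inc: "grid_increment b \<delta> l = b (\<tau> (Suc l)) - b (\<tau> l)"
        by (simp add: grid_increment_def \<tau>_def)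
      have close: "\<bar>p - q\<bar> < d" if "p \<in> {\<tau> l..\<tau> (Suc l)}" "q \<in> {\<tau> l..\<tau> (Suc l)}" for p q
        using that \<tau>(3)[of l] \<delta> by auto
      have "a integrable_on {0..\<tau> (Suc l)}"
        using set_lebesgue_integral_eq_integral(1)[OF a_sub[of 0 "\<tau> (Suc l)"]] ends by auto
      from Henstock_Kurzweil_Integration.integral_combine[OF _ _ this, of "\<tau> l"]
      have comb: "x (\<tau> (Suc l)) = x (\<tau> l) + (b (\<tau> (Suc l)) - b (\<tau> l)) + integral {\<tau> l..\<tau> (Suc l)} a"
        using eq[OF ends(1)] eq[OF ends(2)] \<tau>(1,2)[of l] by simp
      have bR: "\<bar>x (\<tau> l) + (b (\<tau> (Suc l)) - b (\<tau> l))\<bar> \<le> 3 * R"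
        using R[OF ends(1)] R[OF ends(2)] by linarith
      show ?thesis
        unfolding S_def e_def g_def b_inc
        unfolding \<tau>(3)[of l, symmetric]
      proof (rule ito_step[OF d1 d2 d3 C2(2) C3(2) \<tau>(1) _ _ comb _ bR])
        show "continuous_on {\<tau> l..\<tau> (Suc l)} x" by (rule continuous_on_subset[OF x sub])
        show "a absolutely_integrable_on {\<tau> l..\<tau> (Suc l)}" using a_sub ends by auto
        show "\<bar>x p\<bar> \<le> 3 * R" if "p \<in> {\<tau> l..\<tau> (Suc l)}" for p
          using R[OF in_T[OF that]] R0 by linarith
        show "\<bar>x p - x q\<bar> \<le> w" if "p \<in> {\<tau> l..\<tau> (Suc l)}" "q \<in> {\<tau> l..\<tau> (Suc l)}" for p q
          using d'(3)[OF in_T[OF that(2)] in_T[OF that(1)]] close[OF that] by (auto simp: d_def)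
        show "\<bar>b (\<tau> (Suc l)) - b (\<tau> l)\<bar> \<le> w"
          using d'(4)[OF ends] \<delta> \<tau>(3)[of l] by (auto simp: d_def)
      qed
    qed
    have acc: "k \<le> n \<Longrightarrow> \<bar>ito_remainder \<phi> \<phi>1 \<phi>2 x a (\<tau> k) - (\<Sum>l<k. S l)\<bar> \<le> (\<Sum>l<k. e l)" for k
    proof (induction k)
      case 0
      then show ?case by (simp add: ito_remainder_def \<tau>_def)
    next
      case (Suc k)
      have "integral {0..\<tau> k} g + integral {\<tau> k..\<tau> (Suc k)} g = integral {0..\<tau> (Suc k)} g"
        using \<tau> \<tau>T[OF Suc.prems]
        by (intro Henstock_Kurzweil_Integration.integral_combine integrable_on_subinterval[OF g_int]) auto
      then have "ito_remainder \<phi> \<phi>1 \<phi>2 x a (\<tau> (Suc k)) - (\<Sum>l<Suc k. S l)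
          = (ito_remainder \<phi> \<phi>1 \<phi>2 x a (\<tau> k) - (\<Sum>l<k. S l))
            + (\<phi> (x (\<tau> (Suc k))) - \<phi> (x (\<tau> k)) - integral {\<tau> k..\<tau> (Suc k)} g - S k)"
        by (simp add: ito_remainder_def g_def[symmetric] flip: g_def)
      then show ?case using Suc.IH Suc.prems step[of k] by simp
    qed
    have V_split: "k \<le> n \<Longrightarrow> (\<Sum>l<k. integral {\<tau> l..\<tau> (Suc l)} (\<lambda>p. \<bar>a p\<bar>)) = integral {0..\<tau> k} (\<lambda>p. \<bar>a p\<bar>)" for k
    proof (induction k)
      case 0
      then show ?case by (simp add: \<tau>_def)
    next
      case (Suc k)
      then show ?case
        using \<tau> \<tau>T[OF Suc.prems] abs_int[of 0 "\<tau> (Suc k)"]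
        by (simp add: Henstock_Kurzweil_Integration.integral_combine)
    qed
    have e0: "0 \<le> e l" if "l < n" for l
      using C2(1) C3(1) w \<delta> \<tau>(2)[of l] \<tau>T[of "Suc l"] that
      unfolding e_def
      by (intro add_nonneg_nonneg mult_nonneg_nonneg integral_nonneg abs_int) auto
    have "(\<Sum>l<n. e l) = 2 * C2 * w * V + C3 * (\<Sum>l<n. \<bar>grid_increment b \<delta> l\<bar> ^ 3) + C3 * w * T"
      using V_split[of n] n\<delta>
      by (simp add: e_def sum.distrib sum_distrib_left[symmetric] \<tau>_def V_def algebra_simps)
    also have "\<dots> \<le> w * D + \<eta> / 2"
      using elim(3) C3(1) by (simp add: D_def n_def \<delta>_def field_simps)
    also have "\<dots> = \<eta>" using D by (simp add: w_def)
    finally have tot: "(\<Sum>l<n. e l) \<le> \<eta>" .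
    have "\<bar>ito_remainder \<phi> \<phi>1 \<phi>2 x a (\<tau> k) - (\<Sum>l<k. S l)\<bar> \<le> \<eta>" if "k \<le> n" for k
    proof -
      have "(\<Sum>l<k. e l) \<le> (\<Sum>l<n. e l)"
        using that e0 by (intro sum_mono2) auto
      with acc[OF that] tot show ?thesis by linarith
    qed
    then show ?case unfolding S_def \<tau>_def \<delta>_def n_def by blast
  qed
qed

section \<open>Increments of Brownian motion on a grid\<close>

lemma brownian_increment_distributed:
  assumes "indep_brownian_motions M F N b" and "i \<in> {1..N}" and "0 < \<delta>"
  shows "distributed M lborel (\<lambda>\<omega>. grid_increment (\<lambda>t. b i t \<omega>) \<delta> l)
           (\<lambda>x. ennreal (normal_density 0 (sqrt \<delta>) x))"
proof -
  have "0 \<le> real l * \<delta>" "real l * \<delta> < real (Suc l) * \<delta>" "real (Suc l) * \<delta> - real l * \<delta> = \<delta>"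
    using assms(3) by (auto simp: algebra_simps)
  moreover have "distributed M lborel (\<lambda>\<omega>. b i t \<omega> - b i s \<omega>)
      (\<lambda>x. ennreal (normal_density 0 (sqrt (t - s)) x))" if "0 \<le> s" "s < t" for s t
    using assms(1,2) that unfolding indep_brownian_motions_def by blast
  ultimately show ?thesis
    unfolding grid_increment_def by metis
qed

lemma brownian_increment_moments:
  assumes "indep_brownian_motions M F N b" and "i \<in> {1..N}" and \<delta>: "0 < \<delta>"
  defines "X \<equiv> \<lambda>l \<omega>. grid_increment (\<lambda>t. b i t \<omega>) \<delta> l"
  shows "integrable M (\<lambda>\<omega>. X l \<omega> ^ k)"
    and "integrable M (\<lambda>\<omega>. \<bar>X l \<omega>\<bar> ^ k)"
    and "(\<integral>\<omega>. X l \<omega> \<partial>M) = 0"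
    and "(\<integral>\<omega>. X l \<omega> ^ 2 \<partial>M) = \<delta>"
    and "(\<integral>\<omega>. X l \<omega> ^ 4 \<partial>M) = 3 * \<delta>\<^sup>2"
    and "(\<integral>\<omega>. \<bar>X l \<omega>\<bar> ^ 3 \<partial>M) = 2 * sqrt (2 / pi) * (\<delta> * sqrt \<delta>)"
proof -
  note D = brownian_increment_distributed[OF assms(1-3), of l]
  have \<sigma>: "0 < sqrt \<delta>" using \<delta> by simp
  note integral = distributed_integral[OF D, symmetric]
  note integrable = distributed_integrable[OF D]
  show "integrable M (\<lambda>\<omega>. X l \<omega> ^ k)"
    using integrable[of "\<lambda>x. x ^ k"] integrable_normal_moment[OF \<sigma>, of 0 k] by (simp add: X_def)
  show "integrable M (\<lambda>\<omega>. \<bar>X l \<omega>\<bar> ^ k)"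
    using integrable[of "\<lambda>x. \<bar>x\<bar> ^ k"] integrable_normal_moment_abs[OF \<sigma>, of 0 k] by (simp add: X_def)
  show "(\<integral>\<omega>. X l \<omega> \<partial>M) = 0"
    using integral[of "\<lambda>x. x"] integral_normal_moment_odd[OF \<sigma>, of 0 0] by (simp add: X_def)
  show "(\<integral>\<omega>. X l \<omega> ^ 2 \<partial>M) = \<delta>"
    using integral[of "\<lambda>x. x ^ 2"] integral_normal_moment_even[OF \<sigma>, of 0 1] \<delta> by (simp add: X_def)
  show "(\<integral>\<omega>. X l \<omega> ^ 4 \<partial>M) = 3 * \<delta>\<^sup>2"
    using integral[of "\<lambda>x. x ^ 4"] integral_normal_moment_even[OF \<sigma>, of 0 2] \<delta>
    by (simp add: X_def fact_numeral power2_eq_square field_simps)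
  show "(\<integral>\<omega>. \<bar>X l \<omega>\<bar> ^ 3 \<partial>M) = 2 * sqrt (2 / pi) * (\<delta> * sqrt \<delta>)"
    using integral[of "\<lambda>x. \<bar>x\<bar> ^ 3"] integral_normal_moment_abs_odd[OF \<sigma>, of 0 1] \<delta>
    by (simp add: X_def numeral_3_eq_3 mult_ac)
qed

lemma brownian_martingale_differences:
  assumes B: "indep_brownian_motions M F N b" and \<delta>: "0 < \<delta>"
  shows "martingale_differences M (\<lambda>l. F (real l * \<delta>)) N
           (\<lambda>i l \<omega>. grid_increment (\<lambda>t. b i t \<omega>) \<delta> l) \<delta>"
    and "martingale_differences M (\<lambda>l. F (real l * \<delta>)) N
           (\<lambda>i l \<omega>. (grid_increment (\<lambda>t. b i t \<omega>) \<delta> l)\<^sup>2 - \<delta>) (2 * \<delta>\<^sup>2)"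
proof -
  interpret prob_space M using B by (simp add: indep_brownian_motions_def)
  interpret filtration "space M" F using B by (simp add: indep_brownian_motions_def)
  define X where "X i l \<omega> = grid_increment (\<lambda>t. b i t \<omega>) \<delta> l" for i l \<omega>
  have sub: "subalgebra M (F t)" for t using B by (simp add: indep_brownian_motions_def)
  have t: "0 \<le> real l * \<delta>" "real l * \<delta> \<le> real (Suc l) * \<delta>" "real l * \<delta> < real (Suc l) * \<delta>"
    for l using \<delta> by (auto simp: algebra_simps)
  have mono: "sets (F (real l * \<delta>)) \<subseteq> sets (F (real (Suc l) * \<delta>))" for l
    by (rule sets_F_mono[OF t(2)])
  have X_adapted: "X i l \<in> borel_measurable (F (real (Suc l) * \<delta>))" if "i \<in> {1..N}" for i l
  proof -
    have b: "b i s \<in> borel_measurable (F s)" if "0 \<le> s" for s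
      using B \<open>i \<in> {1..N}\<close> that unfolding indep_brownian_motions_def by blast
    have "subalgebra (F (real (Suc l) * \<delta>)) (F (real l * \<delta>))"
      using mono[of l] by (simp add: subalgebra_def space_F)
    from measurable_from_subalg[OF this b[OF t(1)]] b[OF t(1), of "Suc l"]
    show ?thesis unfolding X_def[abs_def] grid_increment_def by (rule borel_measurable_diff[rotated])
  qed
  have noise: "indep_noise M (F (real l * \<delta>)) N (\<lambda>i. X i l)" for l
  proof -
    have "prob_space.indep_sets M
          (\<lambda>k. if k = 0 then sets (F (real l * \<delta>))
               else {(\<lambda>\<omega>. b k (real (Suc l) * \<delta>) \<omega> - b k (real l * \<delta>) \<omega>) -` A \<inter> space M | A. A \<in> sets borel})
          {0..N}"
      using B t(1,3)[of l] unfolding indep_brownian_motions_def by blast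
    then show ?thesis unfolding indep_noise_def X_def[abs_def] grid_increment_def .
  qed
  note mom = brownian_increment_moments[OF B _ \<delta>, folded X_def]
  have m: "integrable M (X i l)" "integrable M (\<lambda>\<omega>. (X i l \<omega>)\<^sup>2)" "integrable M (\<lambda>\<omega>. (X i l \<omega>) ^ 4)"
    "expectation (X i l) = 0" "expectation (\<lambda>\<omega>. (X i l \<omega>)\<^sup>2) = \<delta>"
    "expectation (\<lambda>\<omega>. (X i l \<omega>) ^ 4) = 3 * \<delta>\<^sup>2"
    if "i \<in> {1..N}" for i l
    using mom(1)[OF that, of l 1] mom(1)[OF that, of l] mom(3-5)[OF that, of l] by simp_all
  have "martingale_differences M (\<lambda>l. F (real l * \<delta>)) N X \<delta>"
    by unfold_locales (use sub mono X_adapted noise m \<delta> in auto)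
  then show "martingale_differences M (\<lambda>l. F (real l * \<delta>)) N
           (\<lambda>i l \<omega>. grid_increment (\<lambda>t. b i t \<omega>) \<delta> l) \<delta>"
    unfolding X_def[abs_def] .
  have "martingale_differences M (\<lambda>l. F (real l * \<delta>)) N (\<lambda>i l \<omega>. (X i l \<omega>)\<^sup>2 - \<delta>) (2 * \<delta>\<^sup>2)"
  proof
    fix i l assume i: "i \<in> {1..N}"
    show "(\<lambda>\<omega>. (X i l \<omega>)\<^sup>2 - \<delta>) \<in> borel_measurable (F (real (Suc l) * \<delta>))"
      using X_adapted[OF i, of l] by measurable
    have eq: "((X i l \<omega>)\<^sup>2 - \<delta>)\<^sup>2 = (X i l \<omega>) ^ 4 - 2 * \<delta> * (X i l \<omega>)\<^sup>2 + \<delta>\<^sup>2" for \<omega>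
      by (simp add: power4_eq_xxxx power2_eq_square algebra_simps)
    show "integrable M (\<lambda>\<omega>. ((X i l \<omega>)\<^sup>2 - \<delta>)\<^sup>2)"
      unfolding eq using m[OF i, of l] by simp
    show "expectation (\<lambda>\<omega>. (X i l \<omega>)\<^sup>2 - \<delta>) = 0"
      using m[OF i, of l] by (simp add: prob_space)
    show "expectation (\<lambda>\<omega>. ((X i l \<omega>)\<^sup>2 - \<delta>)\<^sup>2) = 2 * \<delta>\<^sup>2"
      unfolding eq using m[OF i, of l] by (simp add: prob_space power2_eq_square)
  next
    show "indep_noise M (F (real l * \<delta>)) N (\<lambda>i \<omega>. (X i l \<omega>)\<^sup>2 - \<delta>)" for l
      by (rule indep_noise_compose[OF noise, where g = "\<lambda>y. y\<^sup>2 - \<delta>"]) simp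
  qed (use sub mono in auto)
  then show "martingale_differences M (\<lambda>l. F (real l * \<delta>)) N
           (\<lambda>i l \<omega>. (grid_increment (\<lambda>t. b i t \<omega>) \<delta> l)\<^sup>2 - \<delta>) (2 * \<delta>\<^sup>2)"
    unfolding X_def .
qed

text \<open>The expected cubic variation on a grid of $n$ intervals is of order $n^{-1/2}$, so it tends to zero
  in $L^1$ and, along a subsequence of grids, almost surely.\<close>
lemma brownian_cubic_variation:
  assumes B: "indep_brownian_motions M F N b" and T: "0 < T"
  obtains r :: "nat \<Rightarrow> nat" where "\<And>j. 0 < r j" and "filterlim r at_top sequentially"
    and "AE \<omega> in M. \<forall>i\<in>{1..N}.
           (\<lambda>j. \<Sum>l<r j. \<bar>grid_increment (\<lambda>t. b i t \<omega>) (T / real (r j)) l\<bar> ^ 3) \<longlonglongrightarrow> 0"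
proof -
  interpret prob_space M using B by (simp add: indep_brownian_motions_def)
  define u where "u n \<omega> = (\<Sum>i\<in>{1..N}. \<Sum>l<n. \<bar>grid_increment (\<lambda>t. b i t \<omega>) (T / real n) l\<bar> ^ 3)"
    for n \<omega>
  define c where "c = 2 * sqrt (2 / pi)"
  have u0: "0 \<le> u n \<omega>" for n \<omega> by (simp add: u_def sum_nonneg)
  have "integrable M (u n) \<and> expectation (u n) = real N * c * T * sqrt T / sqrt (real n)" for n
  proof (cases "n = 0")
    case True
    then show ?thesis by (simp add: u_def[abs_def])
  next
    case False
    define \<delta> where "\<delta> = T / real n"
    have \<delta>: "0 < \<delta>" using False T by (simp add: \<delta>_def)
    note mom = brownian_increment_moments[OF B _ \<delta>]
    have int: "integrable M (\<lambda>\<omega>. \<Sum>l<n. \<bar>grid_increment (\<lambda>t. b i t \<omega>) \<delta> l\<bar> ^ 3)"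
      if "i \<in> {1..N}" for i
      by (intro Bochner_Integration.integrable_sum mom(2) that)
    have "expectation (\<lambda>\<omega>. \<Sum>l<n. \<bar>grid_increment (\<lambda>t. b i t \<omega>) \<delta> l\<bar> ^ 3) = real n * (c * (\<delta> * sqrt \<delta>))"
      if "i \<in> {1..N}" for i
      using mom(6)[OF that] by (subst Bochner_Integration.integral_sum[OF mom(2)[OF that]]) (simp add: c_def)
    then have "expectation (u n) = real N * (real n * (c * (\<delta> * sqrt \<delta>)))"
      unfolding u_def[abs_def] \<delta>_def[symmetric]
      by (subst Bochner_Integration.integral_sum[OF int]) auto
    also have "\<dots> = real N * c * T * sqrt T / sqrt (real n)"
      using False by (simp add: \<delta>_def real_sqrt_divide)
    finally have "expectation (u n) = real N * c * T * sqrt T / sqrt (real n)" .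
    moreover have "integrable M (u n)"
      unfolding u_def[abs_def] \<delta>_def[symmetric] by (rule Bochner_Integration.integrable_sum[OF int])
    ultimately show ?thesis by (rule conjI[rotated])
  qed
  then have u_int: "\<And>n. integrable M (u n)"
    and u_exp: "\<And>n. expectation (u n) = real N * c * T * sqrt T / sqrt (real n)" by auto
  have "(\<lambda>n. real N * c * T * sqrt T / sqrt (real n)) \<longlonglongrightarrow> 0"
    by (intro real_tendsto_divide_at_top[OF tendsto_const]
        filterlim_compose[OF sqrt_at_top filterlim_real_sequentially])
  then have "(\<lambda>n. expectation (\<lambda>\<omega>. norm (u n \<omega>))) \<longlonglongrightarrow> 0"
    using u0 by (simp add: u_exp)
  from tendsto_L1_AE_subseq[OF u_int this]
  obtain r where r: "strict_mono r" "AE \<omega> in M. (\<lambda>n. u (r n) \<omega>) \<longlonglongrightarrow> 0" by blast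
  show thesis
  proof (rule that[of "\<lambda>j. r (Suc j)"])
    show "0 < r (Suc j)" for j
      using strict_mono_imp_increasing[OF r(1), of "Suc j"] by simp
    show "filterlim (\<lambda>j. r (Suc j)) at_top sequentially"
      using filterlim_subseq[OF r(1)] by (simp add: filterlim_sequentially_Suc)
    show "AE \<omega> in M. \<forall>i\<in>{1..N}.
        (\<lambda>j. \<Sum>l<r (Suc j). \<bar>grid_increment (\<lambda>t. b i t \<omega>) (T / real (r (Suc j))) l\<bar> ^ 3) \<longlonglongrightarrow> 0"
      using r(2)
    proof eventually_elim
      case (elim \<omega>)
      show ?case
      proof
        fix i assume i: "i \<in> {1..N}"
        have "(\<lambda>j. u (r (Suc j)) \<omega>) \<longlonglongrightarrow> 0"
          using elim by (rule LIMSEQ_Suc)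
        then show "(\<lambda>j. \<Sum>l<r (Suc j). \<bar>grid_increment (\<lambda>t. b i t \<omega>) (T / real (r (Suc j))) l\<bar> ^ 3)
            \<longlonglongrightarrow> 0"
        proof (rule tendsto_sandwich[OF _ _ tendsto_const, rotated 2])
          show "\<forall>\<^sub>F j in sequentially.
              (\<Sum>l<r (Suc j). \<bar>grid_increment (\<lambda>t. b i t \<omega>) (T / real (r (Suc j))) l\<bar> ^ 3) \<le> u (r (Suc j)) \<omega>"
            unfolding u_def
            by (intro always_eventually allI
              member_le_sum[OF i, where f = "\<lambda>i. \<Sum>l<_. \<bar>grid_increment (\<lambda>t. b i t \<omega>) _ l\<bar> ^ 3"])
              (auto intro: sum_nonneg)
        qed (auto intro!: always_eventually sum_nonneg)
      qed
    qed
  qed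
qed

section \<open>A maximal estimate for the Ito remainder\<close>

lemma ito_remainder_continuous:
  fixes \<phi> \<phi>1 \<phi>2 \<phi>3 x a :: "real \<Rightarrow> real"
  assumes d1: "\<And>z. (\<phi> has_real_derivative \<phi>1 z) (at z)"
    and d2: "\<And>z. (\<phi>1 has_real_derivative \<phi>2 z) (at z)"
    and d3: "\<And>z. (\<phi>2 has_real_derivative \<phi>3 z) (at z)"
    and x: "continuous_on {0..T} x" and a: "a absolutely_integrable_on {0..T}"
  shows "continuous_on {0..T} (ito_remainder \<phi> \<phi>1 \<phi>2 x a)"
  unfolding ito_remainder_def[abs_def]
  by (intro continuous_intros continuous_on_compose_differentiable[OF d1 x]
      indefinite_integral_continuous_1 ito_integrand_integrable(3)[OF d2 d3 x a])

text \<open>Passage from grids to all times: the last grid point before $t$ tends to $t$, and a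
  bound that holds for infinitely many grids survives in the limit.\<close>
lemma limit_of_grid_bound:
  fixes f :: "real \<Rightarrow> real" and n :: "nat \<Rightarrow> nat"
  assumes f: "continuous_on {0..T} f" and T: "0 < T" and t: "t \<in> {0..T}"
    and n: "\<And>j. 0 < n j" "filterlim n at_top sequentially"
    and bd: "\<exists>\<^sub>F j in sequentially. \<forall>k\<le>n j. real k * (T / real (n j)) \<le> t \<longrightarrow>
               \<bar>f (real k * (T / real (n j)))\<bar> \<le> \<epsilon>"
  shows "\<bar>f t\<bar> \<le> \<epsilon>"
proof (rule ccontr)
  assume "\<not> \<bar>f t\<bar> \<le> \<epsilon>"
  then have gt: "\<epsilon> < \<bar>f t\<bar>" by simp
  define \<delta> where "\<delta> j = T / real (n j)" for j
  define k where "k j = nat \<lfloor>t / \<delta> j\<rfloor>" for j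
  have \<delta>: "0 < \<delta> j" for j using T n(1) by (simp add: \<delta>_def)
  have k_le: "real (k j) * \<delta> j \<le> t" and k_gt: "t - \<delta> j \<le> real (k j) * \<delta> j" and k_n: "k j \<le> n j" for j
  proof -
    have q: "0 \<le> t / \<delta> j" using t \<delta>[of j] by simp
    then have r: "real (k j) \<le> t / \<delta> j" "t / \<delta> j - 1 \<le> real (k j)"
      unfolding k_def by linarith+
    show "real (k j) * \<delta> j \<le> t" "t - \<delta> j \<le> real (k j) * \<delta> j"
      using r \<delta>[of j] by (simp_all add: field_simps)
    have "t / \<delta> j \<le> real (n j)" using t T n(1)[of j] by (simp add: \<delta>_def field_simps)
    then show "k j \<le> n j" using r(1) by linarith
  qed
  have "\<delta> \<longlonglongrightarrow> 0"
    unfolding \<delta>_def by (intro real_tendsto_divide_at_top[OF tendsto_const]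
        filterlim_compose[OF filterlim_real_sequentially n(2)])
  then have "(\<lambda>j. t - \<delta> j) \<longlonglongrightarrow> t" by (auto intro: tendsto_eq_intros)
  then have lim: "(\<lambda>j. real (k j) * \<delta> j) \<longlonglongrightarrow> t"
    by (rule tendsto_sandwich[OF _ _ _ tendsto_const, rotated 2]) (use k_le k_gt in auto)
  have "(\<lambda>j. f (real (k j) * \<delta> j)) \<longlonglongrightarrow> f t"
  proof (rule continuous_on_tendsto_compose[OF f lim t])
    show "\<forall>\<^sub>F j in sequentially. real (k j) * \<delta> j \<in> {0..T}"
    proof (intro always_eventually allI)
      fix j
      have "0 \<le> real (k j) * \<delta> j" using \<delta>[of j] by simp
      then show "real (k j) * \<delta> j \<in> {0..T}" using k_le[of j] t by simp
    qed
  qed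
  then have "(\<lambda>j. \<bar>f (real (k j) * \<delta> j)\<bar>) \<longlonglongrightarrow> \<bar>f t\<bar>" by (rule tendsto_rabs)
  from order_tendstoD(1)[OF this gt]
  have "\<forall>\<^sub>F j in sequentially. \<epsilon> < \<bar>f (real (k j) * \<delta> j)\<bar>" .
  from frequently_eventually_conj[OF bd this] obtain j
    where j: "\<forall>k\<le>n j. real k * (T / real (n j)) \<le> t \<longrightarrow> \<bar>f (real k * (T / real (n j)))\<bar> \<le> \<epsilon>"
      "\<epsilon> < \<bar>f (real (k j) * \<delta> j)\<bar>"
    by (blast dest: frequently_ex)
  with k_le[of j] k_n[of j] show False by (force simp: \<delta>_def)
qed

text \<open>If exceptional events of asymptotically bounded probability are given for each grid, then
  outside an event satisfying the same bound, infinitely many grids are unexceptional.\<close>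
lemma (in prob_space) liminf_prob_le:
  assumes A: "\<And>j. A j \<in> events" and bd: "\<And>j. prob (A j) \<le> p j" and p: "p \<longlonglongrightarrow> c"
  shows "(\<Union>n. \<Inter>j\<in>{n..}. A j) \<in> events" and "prob (\<Union>n. \<Inter>j\<in>{n..}. A j) \<le> c"
proof -
  have ev: "(\<Inter>j\<in>{n..}. A j) \<in> events" for n
    by (rule sets.countable_INT') (use A in auto)
  then show "(\<Union>n. \<Inter>j\<in>{n..}. A j) \<in> events" by auto
  have "prob (\<Inter>j\<in>{n..}. A j) \<le> c" for n
  proof (rule LIMSEQ_le_const[OF p])
    have "prob (\<Inter>j\<in>{n..}. A j) \<le> p j" if "n \<le> j" for j
      using finite_measure_mono[of "\<Inter>j\<in>{n..}. A j" "A j"] A[of j] bd[of j] that by fastforce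
    then show "\<exists>N. \<forall>j\<ge>N. prob (\<Inter>j\<in>{n..}. A j) \<le> p j" by blast
  qed
  moreover have "(\<lambda>n. prob (\<Inter>j\<in>{n..}. A j)) \<longlonglongrightarrow> prob (\<Union>n. \<Inter>j\<in>{n..}. A j)"
    by (rule finite_Lim_measure_incseq) (use ev in \<open>auto simp: incseq_def\<close>)
  ultimately show "prob (\<Union>n. \<Inter>j\<in>{n..}. A j) \<le> c"
    by (intro LIMSEQ_le_const2) auto
qed

text \<open>The discrete martingale of \<open>pathwise_ito\<close> has a part with the increments
  and a part with their centred squares. The maximal inequality bounds the probability that the
  first is large by a multiple of $C_1 T$ on every grid, and the corresponding probability for the
  second by $C_2 T$ times a multiple of the mesh. Taking the limit inferior of the exceptional
  events over the grids leaves the first bound.\<close>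
theorem ito_maximal_estimate:
  fixes M :: "'a measure" and b x a :: "nat \<Rightarrow> real \<Rightarrow> 'a \<Rightarrow> real" and q :: "real \<Rightarrow> 'a \<Rightarrow> real"
  assumes B: "indep_brownian_motions M F N b"
    and x_adapted: "\<And>i t. i \<in> {1..N} \<Longrightarrow> 0 \<le> t \<Longrightarrow> x i t \<in> borel_measurable (F t)"
    and x_cont: "\<And>i \<omega>. i \<in> {1..N} \<Longrightarrow> \<omega> \<in> space M \<Longrightarrow> continuous_on {0..} (\<lambda>t. x i t \<omega>)"
    and eq: "AE \<omega> in M. \<forall>i\<in>{1..N}. (\<lambda>s. a i s \<omega>) absolutely_integrable_on {0..T} \<and>
               (\<forall>t\<in>{0..T}. x i t \<omega> = b i t \<omega> + integral {0..t} (\<lambda>s. a i s \<omega>))"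
    and d1: "\<And>z. (\<phi> has_real_derivative \<phi>1 z) (at z)"
    and d2: "\<And>z. (\<phi>1 has_real_derivative \<phi>2 z) (at z)"
    and d3: "\<And>z. (\<phi>2 has_real_derivative \<phi>3 z) (at z)"
    and \<phi>3: "continuous_on UNIV \<phi>3"
    and q_adapted: "\<And>t. 0 \<le> t \<Longrightarrow> q t \<in> borel_measurable (F t)"
    and C1: "\<And>t \<omega>. 0 \<le> t \<Longrightarrow> \<omega> \<in> space M \<Longrightarrow> q t \<omega> \<le> K \<Longrightarrow> (\<Sum>i\<in>{1..N}. (\<phi>1 (x i t \<omega>))\<^sup>2) \<le> C1"
    and C2: "\<And>t \<omega>. 0 \<le> t \<Longrightarrow> \<omega> \<in> space M \<Longrightarrow> q t \<omega> \<le> K \<Longrightarrow> (\<Sum>i\<in>{1..N}. (\<phi>2 (x i t \<omega>) / 2)\<^sup>2) \<le> C2"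
    and "0 \<le> C1" "0 \<le> C2" and T: "0 < T" and \<epsilon>: "0 < \<epsilon>"
  shows "\<exists>E\<in>sets M. measure M E \<le> 16 * C1 * T / \<epsilon>\<^sup>2 \<and>
           (\<forall>\<omega>\<in>space M - E. \<forall>t\<in>{0..T}. (\<forall>s\<in>{0..t}. q s \<omega> \<le> K) \<longrightarrow>
             \<bar>\<Sum>i\<in>{1..N}. ito_remainder \<phi> \<phi>1 \<phi>2 (\<lambda>t. x i t \<omega>) (\<lambda>s. a i s \<omega>) t\<bar> \<le> \<epsilon>)"
proof -
  interpret prob_space M using B by (simp add: indep_brownian_motions_def)
  obtain n where n: "\<And>j. 0 < n j" "filterlim n at_top sequentially"
    and cubes: "AE \<omega> in M. \<forall>i\<in>{1..N}.
           (\<lambda>j. \<Sum>l<n j. \<bar>grid_increment (\<lambda>t. b i t \<omega>) (T / real (n j)) l\<bar> ^ 3) \<longlonglongrightarrow> 0"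
    by (rule brownian_cubic_variation[OF B T]) (rule that)
  define \<delta> where "\<delta> j = T / real (n j)" for j
  have \<delta>: "0 < \<delta> j" for j using T n(1) by (simp add: \<delta>_def)
  have n\<delta>: "real (n j) * \<delta> j = T" for j using n(1)[of j] by (simp add: \<delta>_def)
  have \<delta>_lim: "\<delta> \<longlonglongrightarrow> 0"
    unfolding \<delta>_def by (intro real_tendsto_divide_at_top[OF tendsto_const]
        filterlim_compose[OF filterlim_real_sequentially n(2)])
  define X where "X j i l \<omega> = grid_increment (\<lambda>t. b i t \<omega>) (\<delta> j) l" for j i l \<omega>
  define W1 where "W1 j k \<omega> = (\<Sum>l<k. \<Sum>i\<in>{1..N}. \<phi>1 (x i (real l * \<delta> j) \<omega>) * X j i l \<omega>)" for j k \<omega>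
  define W2 where "W2 j k \<omega> = (\<Sum>l<k. \<Sum>i\<in>{1..N}. \<phi>2 (x i (real l * \<delta> j) \<omega>) / 2 * ((X j i l \<omega>)\<^sup>2 - \<delta> j))" for j k \<omega>
  define G where "G j k \<omega> \<longleftrightarrow> (\<forall>l<k. q (real l * \<delta> j) \<omega> \<le> K)" for j k \<omega>
  define A1 where "A1 j = {\<omega> \<in> space M. \<exists>k\<le>n j. G j k \<omega> \<and> \<epsilon> / 4 \<le> \<bar>W1 j k \<omega>\<bar>}" for j
  define A2 where "A2 j = {\<omega> \<in> space M. \<exists>k\<le>n j. G j k \<omega> \<and> \<epsilon> / 4 \<le> \<bar>W2 j k \<omega>\<bar>}" for j
  have grid_nonneg: "0 \<le> real l * \<delta> j" for l j using \<delta>[of j] by simp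
  have meas_comp: "(\<lambda>\<omega>. f (x i (real l * \<delta> j) \<omega>)) \<in> borel_measurable (F (real l * \<delta> j))"
    if "i \<in> {1..N}" "\<And>z. (f has_real_derivative f' z) (at z)" for f f' i l j
  proof -
    have "continuous_on UNIV f"
      using that(2) by (auto intro: DERIV_continuous_on has_field_derivative_at_within)
    then have "f \<in> borel_measurable borel" by (rule borel_measurable_continuous_onI)
    with x_adapted[OF that(1) grid_nonneg] show ?thesis by (rule measurable_compose)
  qed
  have A1: "A1 j \<in> events \<and> prob (A1 j) \<le> 16 * C1 * T / \<epsilon>\<^sup>2" for j
  proof -
    interpret D: martingale_differences M "\<lambda>l. F (real l * \<delta> j)" N "X j" "\<delta> j"
      unfolding X_def[abs_def] by (rule brownian_martingale_differences(1)[OF B \<delta>])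
    have bd: "(\<Sum>i\<in>{1..N}. (\<phi>1 (x i (real l * \<delta> j) \<omega>))\<^sup>2) \<le> C1"
      if "\<omega> \<in> space M" "q (real l * \<delta> j) \<omega> \<le> K" for l \<omega>
      by (rule C1[OF grid_nonneg that])
    have pos: "0 < \<epsilon> / 4" using \<epsilon> by simp
    have eq: "A1 j = {\<omega> \<in> space M. \<exists>k\<le>n j. (\<forall>l<k. q (real l * \<delta> j) \<omega> \<le> K) \<and>
        \<epsilon> / 4 \<le> \<bar>D.transform (\<lambda>i l \<omega>. \<phi>1 (x i (real l * \<delta> j) \<omega>)) k \<omega>\<bar>}"
      by (simp add: A1_def G_def W1_def D.transform_def)
    have "A1 j \<in> events"
      unfolding eq
      by (rule D.maximal_inequality(1)[where q = "\<lambda>l. q (real l * \<delta> j)", OF meas_comp[OF _ d2] q_adapted[OF grid_nonneg] bd \<open>0 \<le> C1\<close> pos])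
    moreover have "prob (A1 j) \<le> real (n j) * \<delta> j * C1 / (\<epsilon> / 4)\<^sup>2"
      unfolding eq
      by (rule D.maximal_inequality(2)[where q = "\<lambda>l. q (real l * \<delta> j)", OF meas_comp[OF _ d2] q_adapted[OF grid_nonneg] bd \<open>0 \<le> C1\<close> pos])
    moreover have "real (n j) * \<delta> j * C1 / (\<epsilon> / 4)\<^sup>2 = 16 * C1 * T / \<epsilon>\<^sup>2"
      unfolding n\<delta>[of j, symmetric] by (simp add: power2_eq_square)
    ultimately show ?thesis by simp
  qed
  have A2: "A2 j \<in> events \<and> prob (A2 j) \<le> 32 * C2 * T / \<epsilon>\<^sup>2 * \<delta> j" for j
  proof -
    interpret D: martingale_differences M "\<lambda>l. F (real l * \<delta> j)" N "\<lambda>i l \<omega>. (X j i l \<omega>)\<^sup>2 - \<delta> j" "2 * (\<delta> j)\<^sup>2"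
      unfolding X_def[abs_def] by (rule brownian_martingale_differences(2)[OF B \<delta>])
    have meas: "(\<lambda>\<omega>. \<phi>2 (x i (real l * \<delta> j) \<omega>) / 2) \<in> borel_measurable (F (real l * \<delta> j))"
      if "i \<in> {1..N}" for i l using meas_comp[OF that d3, of l j] by simp
    have bd: "(\<Sum>i\<in>{1..N}. (\<phi>2 (x i (real l * \<delta> j) \<omega>) / 2)\<^sup>2) \<le> C2"
      if "\<omega> \<in> space M" "q (real l * \<delta> j) \<omega> \<le> K" for l \<omega>
      by (rule C2[OF grid_nonneg that])
    have pos: "0 < \<epsilon> / 4" using \<epsilon> by simp
    have eq: "A2 j = {\<omega> \<in> space M. \<exists>k\<le>n j. (\<forall>l<k. q (real l * \<delta> j) \<omega> \<le> K) \<and>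
        \<epsilon> / 4 \<le> \<bar>D.transform (\<lambda>i l \<omega>. \<phi>2 (x i (real l * \<delta> j) \<omega>) / 2) k \<omega>\<bar>}"
      by (simp add: A2_def G_def W2_def D.transform_def)
    have "A2 j \<in> events"
      unfolding eq
      by (rule D.maximal_inequality(1)[where q = "\<lambda>l. q (real l * \<delta> j)", OF meas q_adapted[OF grid_nonneg] bd \<open>0 \<le> C2\<close> pos])
    moreover have "prob (A2 j) \<le> real (n j) * (2 * (\<delta> j)\<^sup>2) * C2 / (\<epsilon> / 4)\<^sup>2"
      unfolding eq
      by (rule D.maximal_inequality(2)[where q = "\<lambda>l. q (real l * \<delta> j)", OF meas q_adapted[OF grid_nonneg] bd \<open>0 \<le> C2\<close> pos])
    moreover have "real (n j) * (2 * (\<delta> j)\<^sup>2) * C2 / (\<epsilon> / 4)\<^sup>2 = 32 * C2 * T / \<epsilon>\<^sup>2 * \<delta> j"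
      unfolding n\<delta>[of j, symmetric] by (simp add: power2_eq_square)
    ultimately show ?thesis by simp
  qed
  define p where "p j = 16 * C1 * T / \<epsilon>\<^sup>2 + 32 * C2 * T / \<epsilon>\<^sup>2 * \<delta> j" for j
  have p: "p \<longlonglongrightarrow> 16 * C1 * T / \<epsilon>\<^sup>2"
    unfolding p_def using \<delta>_lim \<epsilon> by (auto intro!: tendsto_eq_intros)
  have A_ev: "A1 j \<union> A2 j \<in> events" for j using A1[of j] A2[of j] by auto
  have A_p: "prob (A1 j \<union> A2 j) \<le> p j" for j
    using measure_Un_le[of "A1 j" M "A2 j"] A1[of j] A2[of j] unfolding p_def by linarith
  note E0 = liminf_prob_le[OF A_ev A_p p]
  define E0 where "E0 = (\<Union>n. \<Inter>j\<in>{n..}. A1 j \<union> A2 j)"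
  from eq cubes have "AE \<omega> in M. \<forall>i\<in>{1..N}. (\<lambda>s. a i s \<omega>) absolutely_integrable_on {0..T} \<and>
      (\<forall>t\<in>{0..T}. x i t \<omega> = b i t \<omega> + integral {0..t} (\<lambda>s. a i s \<omega>)) \<and>
      (\<lambda>j. \<Sum>l<n j. \<bar>grid_increment (\<lambda>t. b i t \<omega>) (T / real (n j)) l\<bar> ^ 3) \<longlonglongrightarrow> 0"
    by eventually_elim blast
  then obtain Z where Z: "Z \<in> null_sets M" and good: "\<And>\<omega> i. \<omega> \<in> space M - Z \<Longrightarrow> i \<in> {1..N} \<Longrightarrow>
      (\<lambda>s. a i s \<omega>) absolutely_integrable_on {0..T} \<and>
      (\<forall>t\<in>{0..T}. x i t \<omega> = b i t \<omega> + integral {0..t} (\<lambda>s. a i s \<omega>)) \<and>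
      (\<lambda>j. \<Sum>l<n j. \<bar>grid_increment (\<lambda>t. b i t \<omega>) (T / real (n j)) l\<bar> ^ 3) \<longlonglongrightarrow> 0"
    by (elim AE_E3) blast
  show ?thesis
  proof (intro bexI[of _ "E0 \<union> Z"] conjI ballI impI)
    show "E0 \<union> Z \<in> events" using E0(1) Z by (auto simp: E0_def)
    show "prob (E0 \<union> Z) \<le> 16 * C1 * T / \<epsilon>\<^sup>2"
      using E0 Z by (simp add: E0_def measure_Un_null_set)
  next
    fix \<omega> t
    assume \<omega>: "\<omega> \<in> space M - (E0 \<union> Z)" and t: "t \<in> {0..T}"
      and q_le: "\<forall>s\<in>{0..t}. q s \<omega> \<le> K"
    define rem where "rem i = ito_remainder \<phi> \<phi>1 \<phi>2 (\<lambda>t. x i t \<omega>) (\<lambda>s. a i s \<omega>)" for i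
    have x_c: "continuous_on {0..T} (\<lambda>t. x i t \<omega>)" if "i \<in> {1..N}" for i
      by (rule continuous_on_subset[OF x_cont[OF that]]) (use \<omega> in auto)
    have b_c: "continuous_on {0..T} (\<lambda>t. b i t \<omega>)" if "i \<in> {1..N}" for i
    proof -
      have "continuous_on {0..} (\<lambda>t. b i t \<omega>)"
        using B that \<omega> unfolding indep_brownian_motions_def by blast
      then show ?thesis by (rule continuous_on_subset) auto
    qed
    have good': "(\<lambda>s. a i s \<omega>) absolutely_integrable_on {0..T}"
      "\<And>t. t \<in> {0..T} \<Longrightarrow> x i t \<omega> = b i t \<omega> + integral {0..t} (\<lambda>s. a i s \<omega>)"
      "(\<lambda>j. \<Sum>l<n j. \<bar>grid_increment (\<lambda>t. b i t \<omega>) (T / real (n j)) l\<bar> ^ 3) \<longlonglongrightarrow> 0"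
      if "i \<in> {1..N}" for i using good[of \<omega> i] \<omega> that by auto
    \<comment> \<open>The discretisation errors of the \<open>N\<close> coordinates together stay below \<open>\<epsilon> / 4\<close>; the two
      martingale parts contribute at most \<open>\<epsilon> / 4\<close> each.\<close>
    define \<eta> where "\<eta> = \<epsilon> / (4 * (real N + 1))"
    have \<eta>: "0 < \<eta>" "real N * \<eta> \<le> \<epsilon> / 4" using \<epsilon> by (auto simp: \<eta>_def field_simps)
    define S where "S j i l = \<phi>1 (x i (real l * \<delta> j) \<omega>) * X j i l \<omega>
        + \<phi>2 (x i (real l * \<delta> j) \<omega>) / 2 * ((X j i l \<omega>)\<^sup>2 - \<delta> j)" for j i l
    have "\<forall>\<^sub>F j in sequentially. \<forall>i\<in>{1..N}. \<forall>k\<le>n j. \<bar>rem i (real k * \<delta> j) - (\<Sum>l<k. S j i l)\<bar> \<le> \<eta>"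
      unfolding rem_def S_def X_def \<delta>_def
      by (intro eventually_ball_finite finite_atLeastAtMost ballI
          pathwise_ito[OF d1 d2 d3 \<phi>3 T _ _ _ _ n(2) _ \<eta>(1)])
        (simp_all add: good' x_c b_c)
    moreover have "\<exists>\<^sub>F j in sequentially. \<omega> \<notin> A1 j \<union> A2 j"
      using \<omega> by (fastforce simp: E0_def frequently_sequentially)
    ultimately have "\<exists>\<^sub>F j in sequentially. \<omega> \<notin> A1 j \<union> A2 j \<and>
        (\<forall>i\<in>{1..N}. \<forall>k\<le>n j. \<bar>rem i (real k * \<delta> j) - (\<Sum>l<k. S j i l)\<bar> \<le> \<eta>)"
      by (intro frequently_eventually_frequently)
    then have grid: "\<exists>\<^sub>F j in sequentially. \<forall>k\<le>n j. real k * (T / real (n j)) \<le> t \<longrightarrow>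
        \<bar>\<Sum>i\<in>{1..N}. rem i (real k * (T / real (n j)))\<bar> \<le> \<epsilon>"
    proof (rule frequently_elim1, intro allI impI)
      fix j k
      assume j: "\<omega> \<notin> A1 j \<union> A2 j \<and> (\<forall>i\<in>{1..N}. \<forall>k\<le>n j. \<bar>rem i (real k * \<delta> j) - (\<Sum>l<k. S j i l)\<bar> \<le> \<eta>)"
        and k: "k \<le> n j" and kt: "real k * (T / real (n j)) \<le> t"
      have "G j k \<omega>"
        unfolding G_def
      proof (intro allI impI bspec[OF q_le])
        fix l assume "l < k"
        then have "real l * \<delta> j \<le> real k * \<delta> j" using \<delta>[of j] by simp
        then show "real l * \<delta> j \<in> {0..t}" using kt grid_nonneg[of l j] by (simp add: \<delta>_def)
      qed
      then have "\<bar>W1 j k \<omega>\<bar> < \<epsilon> / 4" "\<bar>W2 j k \<omega>\<bar> < \<epsilon> / 4"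
        using j k \<omega> by (auto simp: A1_def A2_def not_le)
      moreover have "(\<Sum>i\<in>{1..N}. \<Sum>l<k. S j i l) = W1 j k \<omega> + W2 j k \<omega>"
        unfolding W1_def W2_def S_def by (subst sum.swap) (simp add: sum.distrib)
      moreover have "\<bar>(\<Sum>i\<in>{1..N}. rem i (real k * \<delta> j)) - (\<Sum>i\<in>{1..N}. \<Sum>l<k. S j i l)\<bar> \<le> real N * \<eta>"
      proof -
        have "\<bar>\<Sum>i\<in>{1..N}. rem i (real k * \<delta> j) - (\<Sum>l<k. S j i l)\<bar> \<le> (\<Sum>i\<in>{1..N}. \<eta>)"
          by (rule order_trans[OF sum_abs sum_mono]) (use j k in auto)
        then show ?thesis by (simp add: sum_subtractf)
      qed
      ultimately show "\<bar>\<Sum>i\<in>{1..N}. rem i (real k * (T / real (n j)))\<bar> \<le> \<epsilon>"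
        using \<eta>(2) \<epsilon> unfolding \<delta>_def[symmetric] by linarith
    qed
    have "continuous_on {0..T} (\<lambda>t. \<Sum>i\<in>{1..N}. rem i t)"
      unfolding rem_def
      by (intro continuous_on_sum) (rule ito_remainder_continuous[OF d1 d2 d3]; simp add: x_c good')
    from limit_of_grid_bound[OF this T t n grid]
    show "\<bar>\<Sum>i\<in>{1..N}. ito_remainder \<phi> \<phi>1 \<phi>2 (\<lambda>t. x i t \<omega>) (\<lambda>s. a i s \<omega>) t\<bar> \<le> \<epsilon>"
      by (simp add: rem_def)
  qed
qed

section \<open>Power sums and the radial Dunkl drift\<close>

definition power_mean :: "nat \<Rightarrow> (nat \<Rightarrow> real) \<Rightarrow> nat \<Rightarrow> real" where
  "power_mean N y k = (\<Sum>i\<in>{1..N}. y i ^ k) / real N"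

text \<open>The drift of the $(n+1)$-st empirical moment, as a function of the lower moments
  \<open>s\<close>. The parameter \<open>e\<close> is $c(n+1)/N$ for $N$ particles: it corrects
  for the absent interaction of a particle with itself, and it vanishes in the limit.\<close>
definition moment_drift :: "real \<Rightarrow> real \<Rightarrow> real \<Rightarrow> nat \<Rightarrow> (nat \<Rightarrow> real) \<Rightarrow> real" where
  "moment_drift \<alpha> c e n s =
     real (Suc n) * ((\<alpha> + real n) * s n + c * (\<Sum>k\<le>n. s k * s (n - k)) - e * s n)"

text \<open>Exchanging $i$ and $j$ replaces the singular quotient by the divided difference
  $(y_i^{n+1} - y_j^{n+1})/(y_i - y_j) = \sum_k y_i^k y_j^{n-k}$; the subtracted term is the
  diagonal of the full double sum.\<close>
lemma sum_offdiagonal_quotients: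
  fixes y :: "'i \<Rightarrow> real"
  assumes fin: "finite I" and inj: "inj_on y I"
  shows "(\<Sum>i\<in>I. \<Sum>j\<in>I - {i}. 2 * y i ^ Suc n / (y i - y j))
    = (\<Sum>k\<le>n. (\<Sum>i\<in>I. y i ^ k) * (\<Sum>i\<in>I. y i ^ (n - k))) - real (Suc n) * (\<Sum>i\<in>I. y i ^ n)"
proof -
  define s where "s i j = y i ^ Suc n / (y i - y j)" for i j
  define p where "p i j = (\<Sum>k\<le>n. y i ^ k * y j ^ (n - k))" for i j
  have diag: "(\<Sum>j\<in>I - {i}. f j) = (\<Sum>j\<in>I. f j) - f i" if "i \<in> I" for i and f :: "'i \<Rightarrow> real"
    using fin that by (simp add: sum_diff1)
  \<comment> \<open>Division by zero yields zero, so the diagonal may be added for free.\<close>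
  have s_diag: "s i i = 0" for i by (simp add: s_def)
  have p_diag: "p i i = real (Suc n) * y i ^ n" for i
  proof -
    have "p i i = (\<Sum>k\<le>n. y i ^ n)"
      unfolding p_def by (intro sum.cong refl) (simp add: power_add[symmetric])
    then show ?thesis by simp
  qed
  have sp: "s i j + s j i = p i j" if "i \<in> I" "j \<in> I" "i \<noteq> j" for i j
  proof -
    have ne: "y i - y j \<noteq> 0" using inj that by (auto simp: inj_on_def)
    have "y i ^ Suc n - y j ^ Suc n = (y i - y j) * p i j"
      unfolding power_diff_sumr2 p_def by (simp add: lessThan_Suc_atMost mult.commute)
    moreover have "s j i = - (y j ^ Suc n) / (y i - y j)"
      unfolding s_def by (metis minus_diff_eq minus_divide_divide minus_minus)
    moreover have "A / d + - B / d = (A - B) / d" for A B d :: real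
      by (simp add: diff_divide_distrib)
    ultimately have "s i j + s j i = (y i - y j) * p i j / (y i - y j)"
      by (metis s_def)
    then show ?thesis using ne by simp
  qed
  have "(\<Sum>i\<in>I. \<Sum>j\<in>I - {i}. 2 * y i ^ Suc n / (y i - y j)) = 2 * (\<Sum>i\<in>I. \<Sum>j\<in>I. s i j)"
    by (simp add: diag s_def sum_distrib_left del: power_Suc)
  also have "\<dots> = (\<Sum>i\<in>I. \<Sum>j\<in>I. s i j) + (\<Sum>i\<in>I. \<Sum>j\<in>I. s j i)"
    by (subst (3) sum.swap) simp
  also have "\<dots> = (\<Sum>i\<in>I. \<Sum>j\<in>I - {i}. s i j + s j i)"
    by (simp add: sum.distrib[symmetric] diag s_diag)
  also have "\<dots> = (\<Sum>i\<in>I. \<Sum>j\<in>I - {i}. p i j)"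
    using sp by (intro sum.cong refl) auto
  also have "\<dots> = (\<Sum>i\<in>I. \<Sum>j\<in>I. p i j) - (\<Sum>i\<in>I. p i i)"
    by (simp add: diag sum_subtractf)
  also have "(\<Sum>i\<in>I. \<Sum>j\<in>I. p i j) = (\<Sum>k\<le>n. (\<Sum>i\<in>I. y i ^ k) * (\<Sum>j\<in>I. y j ^ (n - k)))"
  proof -
    have "(\<Sum>i\<in>I. \<Sum>j\<in>I. p i j) = (\<Sum>i\<in>I. \<Sum>k\<le>n. \<Sum>j\<in>I. y i ^ k * y j ^ (n - k))"
      unfolding p_def by (intro sum.cong refl sum.swap)
    also have "\<dots> = (\<Sum>k\<le>n. \<Sum>i\<in>I. \<Sum>j\<in>I. y i ^ k * y j ^ (n - k))" by (rule sum.swap)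
    finally show ?thesis by (simp add: sum_product)
  qed
  finally show ?thesis by (simp add: p_diag sum_distrib_left)
qed

lemma dunkl_drift_times_position:
  fixes x :: "nat \<Rightarrow> real"
  assumes inj: "inj_on x {1..N}" and pos: "\<And>i. i \<in> {1..N} \<Longrightarrow> 0 < x i" and i: "i \<in> {1..N}"
  defines "y \<equiv> \<lambda>i. (x i)\<^sup>2 / 2"
  shows "x i * dunkl_drift \<alpha> \<beta> N i x
    = (\<alpha> - 1/2) + \<beta> / 2 * (\<Sum>j\<in>{1..N} - {i}. 2 * y i / (y i - y j))"
proof -
  have "x i * (1 / (x i - x j) + 1 / (x i + x j)) = 2 * y i / (y i - y j)" if "j \<in> {1..N} - {i}" for j
  proof -
    have "x i \<noteq> x j" using inj_onD[OF inj _ i, of j] that by auto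
    moreover have "0 < x i + x j" using pos[OF i] pos[of j] that by simp
    ultimately have "x i - x j \<noteq> 0" "x i + x j \<noteq> 0" by simp_all
    moreover have yD: "y i - y j = (x i - x j) * (x i + x j) / 2"
      by (simp add: y_def power2_eq_square field_simps)
    moreover from calculation(1,2)
    have "1 / (x i - x j) + 1 / (x i + x j) = 2 * x i / ((x i - x j) * (x i + x j))"
      by (subst add_frac_eq) auto
    ultimately have "x i * (1 / (x i - x j) + 1 / (x i + x j)) = x i * (2 * x i / ((x i - x j) * (x i + x j)))"
      and "2 * y i / (y i - y j) = 2 * y i / ((x i - x j) * (x i + x j) / 2)"
      by (simp, simp only: yD)
    moreover have "2 * y i = x i * x i" by (simp add: y_def power2_eq_square)
    ultimately show ?thesis by simp
  qed
  then have "x i * (\<Sum>j\<in>{1..N} - {i}. 1 / (x i - x j) + 1 / (x i + x j))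
      = (\<Sum>j\<in>{1..N} - {i}. 2 * y i / (y i - y j))"
    by (simp add: sum_distrib_left)
  then show ?thesis
    using pos[OF i] by (simp add: dunkl_drift_def distrib_left mult.left_commute[of "x i"])
qed

text \<open>The summand is $\phi'(x_i) a_i + \phi''(x_i)/2$ for $\phi(x) = (x^2/2)^{n+1}$. The
  terms $\alpha - 1/2$ of the drift and $n + 1/2$ of the second derivative combine to the
  coefficient $\alpha + n$.\<close>
lemma dunkl_generator_power:
  fixes x :: "nat \<Rightarrow> real"
  assumes inj: "inj_on x {1..N}" and pos: "\<And>i. i \<in> {1..N} \<Longrightarrow> 0 < x i" and N: "1 \<le> N"
  shows "(\<Sum>i\<in>{1..N}. real (Suc n) * x i ^ (2 * n + 1) / 2 ^ n * dunkl_drift \<alpha> (2 * c / real N) N i x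
            + real (Suc n) * real (2 * n + 1) * x i ^ (2 * n) / 2 ^ n / 2)
    = real N * moment_drift \<alpha> c (c * real (Suc n) / real N) n (power_mean N (\<lambda>i. (x i)\<^sup>2 / 2))"
proof -
  define y where "y i = (x i)\<^sup>2 / 2" for i
  define P where "P k = (\<Sum>i\<in>{1..N}. y i ^ k)" for k
  have injy: "inj_on y {1..N}"
  proof (rule inj_onI)
    fix i j assume i: "i \<in> {1..N}" and j: "j \<in> {1..N}" and "y i = y j"
    then have "(x i)\<^sup>2 = (x j)\<^sup>2" by (simp add: y_def)
    then have "x i = x j" by (rule power2_eq_imp_eq) (use pos[OF i] pos[OF j] in simp_all)
    then show "i = j" by (rule inj_onD[OF inj _ i j])
  qed
  have y_pow: "x i ^ (2 * n) / 2 ^ n = y i ^ n" for i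
    by (simp add: y_def power_divide power_mult)
  have term1: "real (Suc n) * x i ^ (2 * n + 1) / 2 ^ n * dunkl_drift \<alpha> (2 * c / real N) N i x
      = real (Suc n) * ((\<alpha> - 1/2) * y i ^ n
          + c / real N * (\<Sum>j\<in>{1..N} - {i}. 2 * y i ^ Suc n / (y i - y j)))"
    if i: "i \<in> {1..N}" for i
  proof -
    have "real (Suc n) * x i ^ (2 * n + 1) / 2 ^ n * dunkl_drift \<alpha> (2 * c / real N) N i x
        = real (Suc n) * (x i ^ (2 * n) / 2 ^ n) * (x i * dunkl_drift \<alpha> (2 * c / real N) N i x)"
      by simp
    also have "\<dots> = real (Suc n) * y i ^ n * ((\<alpha> - 1/2)
        + c / real N * (\<Sum>j\<in>{1..N} - {i}. 2 * y i / (y i - y j)))"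
      using dunkl_drift_times_position[OF inj pos i, of \<alpha> "2 * c / real N"] y_pow
      by (simp add: y_def)
    also have "\<dots> = real (Suc n) * ((\<alpha> - 1/2) * y i ^ n
          + c / real N * (y i ^ n * (\<Sum>j\<in>{1..N} - {i}. 2 * y i / (y i - y j))))"
      by (simp only: distrib_left mult_ac)
    also have "y i ^ n * (\<Sum>j\<in>{1..N} - {i}. 2 * y i / (y i - y j))
        = (\<Sum>j\<in>{1..N} - {i}. 2 * y i ^ Suc n / (y i - y j))"
      by (simp add: sum_distrib_left mult_ac)
    finally show ?thesis .
  qed
  have "(\<Sum>i\<in>{1..N}. real (Suc n) * x i ^ (2 * n + 1) / 2 ^ n * dunkl_drift \<alpha> (2 * c / real N) N i x
            + real (Suc n) * real (2 * n + 1) * x i ^ (2 * n) / 2 ^ n / 2)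
      = (\<Sum>i\<in>{1..N}. real (Suc n) * ((\<alpha> - 1/2) * y i ^ n
          + c / real N * (\<Sum>j\<in>{1..N} - {i}. 2 * y i ^ Suc n / (y i - y j)))
          + real (Suc n) * (real n + 1/2) * y i ^ n)"
  proof (rule sum.cong[OF refl])
    fix i assume i: "i \<in> {1..N}"
    have "real (Suc n) * real (2 * n + 1) * x i ^ (2 * n) / 2 ^ n / 2
        = real (Suc n) * (real n + 1/2) * (x i ^ (2 * n) / 2 ^ n)"
      by (simp add: field_simps)
    with term1[OF i] y_pow[of i]
    show "real (Suc n) * x i ^ (2 * n + 1) / 2 ^ n * dunkl_drift \<alpha> (2 * c / real N) N i x
            + real (Suc n) * real (2 * n + 1) * x i ^ (2 * n) / 2 ^ n / 2
        = real (Suc n) * ((\<alpha> - 1/2) * y i ^ n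
          + c / real N * (\<Sum>j\<in>{1..N} - {i}. 2 * y i ^ Suc n / (y i - y j)))
          + real (Suc n) * (real n + 1/2) * y i ^ n" by presburger
  qed
  also have "\<dots> = real (Suc n) * ((\<alpha> - 1/2) * P n
          + c / real N * (\<Sum>i\<in>{1..N}. \<Sum>j\<in>{1..N} - {i}. 2 * y i ^ Suc n / (y i - y j)))
          + real (Suc n) * (real n + 1/2) * P n"
    unfolding P_def by (simp only: sum.distrib sum_distrib_left[symmetric])
  also have "(\<Sum>i\<in>{1..N}. \<Sum>j\<in>{1..N} - {i}. 2 * y i ^ Suc n / (y i - y j))
      = (\<Sum>k\<le>n. P k * P (n - k)) - real (Suc n) * P n"
    unfolding P_def by (rule sum_offdiagonal_quotients) (use injy in auto)
  also have "real (Suc n) * ((\<alpha> - 1/2) * P n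
          + c / real N * ((\<Sum>k\<le>n. P k * P (n - k)) - real (Suc n) * P n))
          + real (Suc n) * (real n + 1/2) * P n
      = real (Suc n) * ((\<alpha> + real n) * P n
          + c / real N * (\<Sum>k\<le>n. P k * P (n - k)) - c * real (Suc n) / real N * P n)"
  proof -
    have "s * ((\<alpha> - 1/2) * p + d * (Q - s * p)) + s * (m + 1/2) * p
        = s * ((\<alpha> + m) * p + d * Q - d * s * p)" for s p d Q m :: real
      by (simp add: algebra_simps)
    moreover have "c * real (Suc n) / real N = c / real N * real (Suc n)" by simp
    ultimately show ?thesis by metis
  qed
  also have "\<dots> = real N * moment_drift \<alpha> c (c * real (Suc n) / real N) n (power_mean N y)"
  proof -
    have P: "P k = real N * power_mean N y k" for k
      using N by (simp add: P_def power_mean_def)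
    have "(\<Sum>k\<le>n. P k * P (n - k))
        = real N * (real N * (\<Sum>k\<le>n. power_mean N y k * power_mean N y (n - k)))"
      by (simp add: P sum_distrib_left mult_ac)
    then show ?thesis using N by (simp add: moment_drift_def P field_simps)
  qed
  finally show ?thesis by (simp only: y_def[abs_def])
qed

text \<open>A bound on the moment of order $n+1$ bounds each single particle by \<open>L\<close>,
  and thus moments of higher order. The resulting bound on $\sum_i y_i^{2n+1}$ is of order
  $N^{2-1/(n+1)}$, which is $o(N^2)$.\<close>
lemma power_mean_bounds:
  fixes y :: "nat \<Rightarrow> real"
  assumes N: "1 \<le> N" and y: "\<And>i. i \<in> {1..N} \<Longrightarrow> 0 \<le> y i" and K: "0 < K"
    and le: "power_mean N y (Suc n) \<le> K"
  defines "L \<equiv> root (Suc n) (real N * K)"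
  shows "(\<Sum>i\<in>{1..N}. y i ^ (2 * n + 1)) \<le> L ^ n * (real N * K)"
    and "(\<Sum>i\<in>{1..N}. (y i ^ n)\<^sup>2) \<le> real N * (L ^ n)\<^sup>2"
proof -
  have NK: "0 < real N * K" using N K by simp
  have sum_le: "(\<Sum>i\<in>{1..N}. y i ^ Suc n) \<le> real N * K"
    using le N by (simp add: power_mean_def divide_simps mult.commute)
  have y_le: "y i \<le> L" if i: "i \<in> {1..N}" for i
  proof -
    have "y i ^ Suc n \<le> (\<Sum>i\<in>{1..N}. y i ^ Suc n)"
      by (rule member_le_sum[OF i]) (use y in auto)
    then have "root (Suc n) (y i ^ Suc n) \<le> L"
      unfolding L_def using sum_le by (intro real_root_le_mono) auto
    then show ?thesis using real_root_power_cancel[of "Suc n" "y i"] y[OF i] by simp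
  qed
  have pow_le: "y i ^ n \<le> L ^ n" if "i \<in> {1..N}" for i
    using y_le[OF that] y[OF that] by (rule power_mono)
  have L: "0 \<le> L" using NK by (simp add: L_def)
  have "(\<Sum>i\<in>{1..N}. y i ^ (2 * n + 1)) = (\<Sum>i\<in>{1..N}. y i ^ n * y i ^ Suc n)"
  proof -
    have "2 * n + 1 = n + Suc n" by simp
    then show ?thesis by (simp only: power_add)
  qed
  also have "\<dots> \<le> (\<Sum>i\<in>{1..N}. L ^ n * y i ^ Suc n)"
    using pow_le y by (intro sum_mono mult_right_mono) auto
  also have "\<dots> \<le> L ^ n * (real N * K)"
    using sum_le L by (simp add: sum_distrib_left[symmetric] mult_left_mono del: power_Suc)
  finally show "(\<Sum>i\<in>{1..N}. y i ^ (2 * n + 1)) \<le> L ^ n * (real N * K)" .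
  have "(\<Sum>i\<in>{1..N}. (y i ^ n)\<^sup>2) \<le> (\<Sum>i\<in>{1..N}. (L ^ n)\<^sup>2)"
    by (rule sum_mono, rule power_mono[OF pow_le]) (use y in auto)
  then show "(\<Sum>i\<in>{1..N}. (y i ^ n)\<^sup>2) \<le> real N * (L ^ n)\<^sup>2" by simp
qed

section \<open>The martingale part of an empirical moment\<close>

lemma set_integrable_lborel_absolutely_integrable:
  fixes f :: "real \<Rightarrow> real"
  assumes "set_integrable lborel S f"
  shows "f absolutely_integrable_on S"
  using assms unfolding set_integrable_def
  by (simp add: integrable_completion borel_measurable_integrable)

lemma AE_lborel_integral_cong:
  fixes f g :: "real \<Rightarrow> real"
  assumes "AE s in lborel. s \<in> S \<longrightarrow> f s = g s"
  shows "integral S f = integral S g"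
proof -
  from assms obtain Z where Z: "{s \<in> space lborel. \<not> (s \<in> S \<longrightarrow> f s = g s)} \<subseteq> Z" "emeasure lborel Z = 0" "Z \<in> sets lborel"
    by (rule AE_E)
  then have "Z \<in> null_sets lebesgue" by (auto intro: null_sets_completionI)
  then have "negligible Z" by (simp add: negligible_iff_null_sets)
  then show ?thesis by (rule integral_spike) (use Z(1) in auto)
qed

text \<open>The maximal estimate for the remainder of $\phi(x) = (x^2/2)^{n+1}$, divided by $N$
  and stopped when the moment of order $n+1$ exceeds \<open>K\<close>. Since $L^{n+1} = NK$ for
  the root \<open>L\<close> in the denominator, the bound $C_1 = 2(n+1)^2 L^n N K$ on the
  quadratic variation gives $C_1/N^2 = 2(n+1)^2 K^2/L$, which vanishes as $N \to \infty$.\<close>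
lemma laguerre_moment_estimate:
  assumes proc: "beta_laguerre_process M F \<alpha> (2 * c / real N) N b lam"
    and N: "1 \<le> N" and small: "2 * c / real N < 1"
    and T: "0 < T" and K: "0 < K" and \<epsilon>: "0 < \<epsilon>"
  defines "S \<equiv> \<lambda>k t \<omega>. power_mean N (\<lambda>i. lam i t \<omega>) k"
  shows "\<exists>E\<in>sets M.
    measure M E \<le> 32 * (real (Suc n))\<^sup>2 * T * K\<^sup>2 / (\<epsilon>\<^sup>2 * root (Suc n) (real N * K)) \<and>
    (\<forall>\<omega>\<in>space M - E. \<forall>t\<in>{0..T}. (\<forall>s\<in>{0..t}. S (Suc n) s \<omega> \<le> K) \<longrightarrow>
       \<bar>S (Suc n) t \<omega> - integral {0..t} (\<lambda>s.
          moment_drift \<alpha> c (c * real (Suc n) / real N) n (\<lambda>k. S k s \<omega>))\<bar> \<le> \<epsilon>)"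
proof -
  have B: "indep_brownian_motions M F N b"
    using proc by (simp add: beta_laguerre_process_def)
  interpret prob_space M using B by (simp add: indep_brownian_motions_def)
  obtain x where dunkl: "radial_dunkl M F \<alpha> (2 * c / real N) N b x"
    and lam_x: "\<And>i t \<omega>. i \<in> {1..N} \<Longrightarrow> 0 \<le> t \<Longrightarrow> \<omega> \<in> space M \<Longrightarrow> lam i t \<omega> = (x i t \<omega>)\<^sup>2 / 2"
    using proc small unfolding beta_laguerre_process_def by blast
  define a where "a i s \<omega> = dunkl_drift \<alpha> (2 * c / real N) N i (\<lambda>j. x j s \<omega>)" for i s \<omega>
  have ordered: "ordered_process M F N x"
    and distinct: "AE \<omega> in M. AE t in lborel. 0 \<le> t \<longrightarrow>
        inj_on (\<lambda>i. x i t \<omega>) {1..N} \<and> (\<forall>i\<in>{1..N}. x i t \<omega> \<noteq> 0)"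
    and sde: "AE \<omega> in M. \<forall>i\<in>{1..N}. \<forall>t\<ge>0.
        set_integrable lborel {0..t} (\<lambda>s. a i s \<omega>) \<and>
        x i t \<omega> = b i t \<omega> + (LINT s:{0..t}|lborel. a i s \<omega>)"
    using dunkl unfolding radial_dunkl_def a_def by blast+
  have x_adapted: "x i t \<in> borel_measurable (F t)" if "i \<in> {1..N}" "0 \<le> t" for i t
    using ordered that unfolding ordered_process_def by blast
  have x_cont: "continuous_on {0..} (\<lambda>t. x i t \<omega>)" and x_0: "x i 0 \<omega> = 0"
    if "i \<in> {1..N}" "\<omega> \<in> space M" for i \<omega>
    using ordered that unfolding ordered_process_def by blast+
  have x_nonneg: "0 \<le> x i t \<omega>" if "i \<in> {1..N}" "\<omega> \<in> space M" "0 \<le> t" for i t \<omega>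
    using ordered that unfolding ordered_process_def by blast
  have eq: "AE \<omega> in M. \<forall>i\<in>{1..N}. (\<lambda>s. a i s \<omega>) absolutely_integrable_on {0..T} \<and>
               (\<forall>t\<in>{0..T}. x i t \<omega> = b i t \<omega> + integral {0..t} (\<lambda>s. a i s \<omega>))"
    using sde
  proof eventually_elim
    case (elim \<omega>)
    show ?case
    proof (intro ballI conjI)
      fix i assume i: "i \<in> {1..N}"
      show "(\<lambda>s. a i s \<omega>) absolutely_integrable_on {0..T}"
        using elim i T by (intro set_integrable_lborel_absolutely_integrable) auto
      fix t assume "t \<in> {0..T}"
      with elim i show "x i t \<omega> = b i t \<omega> + integral {0..t} (\<lambda>s. a i s \<omega>)"
        by (simp add: set_borel_integral_eq_integral(2))
    qed
  qed
  define \<phi> where "\<phi> z = z ^ (2 * n + 2) / 2 ^ Suc n" for z :: real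
  define \<phi>1 where "\<phi>1 z = real (Suc n) * z ^ (2 * n + 1) / 2 ^ n" for z :: real
  define \<phi>2 where "\<phi>2 z = real (Suc n) * real (2 * n + 1) * z ^ (2 * n) / 2 ^ n" for z :: real
  define \<phi>3 where "\<phi>3 z = real (Suc n) * real (2 * n + 1) * (real (2 * n) * z ^ (2 * n - 1)) / 2 ^ n"
    for z :: real
  have d1: "(\<phi> has_real_derivative \<phi>1 z) (at z)" for z
  proof -
    have "real (2 * n + 2) * z ^ (2 * n + 2 - Suc 0) / 2 ^ Suc n = \<phi>1 z"
      by (simp add: \<phi>1_def field_simps)
    then show ?thesis
      using DERIV_cdivide[OF DERIV_pow[of "2 * n + 2" z], of "2 ^ Suc n"]
      unfolding \<phi>_def[abs_def] by (simp only:)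
  qed
  have d2: "(\<phi>1 has_real_derivative \<phi>2 z) (at z)" for z
    unfolding \<phi>1_def[abs_def] \<phi>2_def
    by (rule derivative_eq_intros refl | simp)+
  have d3: "(\<phi>2 has_real_derivative \<phi>3 z) (at z)" for z
    unfolding \<phi>2_def[abs_def] \<phi>3_def
    by (auto intro!: derivative_eq_intros simp: field_simps)
  have \<phi>3_cont: "continuous_on UNIV \<phi>3"
    unfolding \<phi>3_def[abs_def] by (intro continuous_intros) auto
  define y where "y t \<omega> i = (x i t \<omega>)\<^sup>2 / 2" for t \<omega> and i :: nat
  define q where "q t \<omega> = power_mean N (y t \<omega>) (Suc n)" for t \<omega>
  have q_adapted: "q t \<in> borel_measurable (F t)" if "0 \<le> t" for t
    unfolding q_def[abs_def] power_mean_def y_def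
    by (intro borel_measurable_sum borel_measurable_divide borel_measurable_power
        borel_measurable_const x_adapted that)
  have \<phi>_y: "\<phi> (x i t \<omega>) = y t \<omega> i ^ Suc n"
    and \<phi>1_y: "(\<phi>1 (x i t \<omega>))\<^sup>2 = 2 * (real (Suc n))\<^sup>2 * y t \<omega> i ^ (2 * n + 1)"
    and \<phi>2_y: "(\<phi>2 (x i t \<omega>) / 2)\<^sup>2 = (real (Suc n) * (real n + 1/2))\<^sup>2 * (y t \<omega> i ^ n)\<^sup>2" for i t \<omega>
  proof -
    have p: "x i t \<omega> ^ (2 * k) = 2 ^ k * y t \<omega> i ^ k" for k
      by (simp add: y_def power_divide power_mult)
    show "\<phi> (x i t \<omega>) = y t \<omega> i ^ Suc n"
      using p[of "Suc n"] by (simp add: \<phi>_def)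
    have "(x i t \<omega> ^ (2 * n + 1))\<^sup>2 = x i t \<omega> ^ (2 * (2 * n + 1))"
      by (metis power_mult mult.commute)
    also have "\<dots> = 2 * (2 ^ n)\<^sup>2 * y t \<omega> i ^ (2 * n + 1)"
    proof -
      have "(2 :: real) ^ (2 * n + 1) = 2 * (2 ^ n)\<^sup>2" by (simp add: power_mult[symmetric] mult.commute)
      then show ?thesis unfolding p by simp
    qed
    finally show "(\<phi>1 (x i t \<omega>))\<^sup>2 = 2 * (real (Suc n))\<^sup>2 * y t \<omega> i ^ (2 * n + 1)"
      unfolding \<phi>1_def power_divide power_mult_distrib by simp
    have "\<phi>2 (x i t \<omega>) / 2 = real (Suc n) * (real n + 1/2) * y t \<omega> i ^ n"
      unfolding \<phi>2_def p by (simp add: field_simps)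
    then show "(\<phi>2 (x i t \<omega>) / 2)\<^sup>2 = (real (Suc n) * (real n + 1/2))\<^sup>2 * (y t \<omega> i ^ n)\<^sup>2"
      by (simp only: power_mult_distrib)
  qed
  define L where "L = root (Suc n) (real N * K)"
  have NK: "0 < real N * K" using N K by simp
  have L: "0 < L" "L ^ Suc n = real N * K"
    using NK by (simp_all add: L_def del: power_Suc)
  define C1 where "C1 = 2 * (real (Suc n))\<^sup>2 * (L ^ n * (real N * K))"
  define C2 where "C2 = (real (Suc n) * (real n + 1/2))\<^sup>2 * (real N * (L ^ n)\<^sup>2)"
  have C1: "(\<Sum>i\<in>{1..N}. (\<phi>1 (x i t \<omega>))\<^sup>2) \<le> C1"
    and C2: "(\<Sum>i\<in>{1..N}. (\<phi>2 (x i t \<omega>) / 2)\<^sup>2) \<le> C2"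
    if "q t \<omega> \<le> K" for t \<omega>
  proof -
    have "0 \<le> y t \<omega> i" for i by (simp add: y_def)
    note bounds = power_mean_bounds[OF N this K that[unfolded q_def], folded L_def]
    show "(\<Sum>i\<in>{1..N}. (\<phi>1 (x i t \<omega>))\<^sup>2) \<le> C1"
      unfolding \<phi>1_y C1_def sum_distrib_left[symmetric] using bounds(1) by (rule mult_left_mono) simp
    show "(\<Sum>i\<in>{1..N}. (\<phi>2 (x i t \<omega>) / 2)\<^sup>2) \<le> C2"
      unfolding \<phi>2_y C2_def sum_distrib_left[symmetric] using bounds(2) by (rule mult_left_mono) simp
  qed
  have "0 \<le> C1" "0 \<le> C2" using L NK by (auto simp: C1_def C2_def)
  have N\<epsilon>: "0 < real N * \<epsilon>" using N \<epsilon> by simp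
  have "\<exists>E\<in>events. prob E \<le> 16 * C1 * T / (real N * \<epsilon>)\<^sup>2 \<and>
      (\<forall>\<omega>\<in>space M - E. \<forall>t\<in>{0..T}. (\<forall>s\<in>{0..t}. q s \<omega> \<le> K) \<longrightarrow>
        \<bar>\<Sum>i\<in>{1..N}. ito_remainder \<phi> \<phi>1 \<phi>2 (\<lambda>t. x i t \<omega>) (\<lambda>s. a i s \<omega>) t\<bar> \<le> real N * \<epsilon>)"
    by (rule ito_maximal_estimate[OF B x_adapted x_cont eq d1 d2 d3 \<phi>3_cont q_adapted C1 C2
          \<open>0 \<le> C1\<close> \<open>0 \<le> C2\<close> T N\<epsilon>])
  then obtain E where E: "E \<in> events" "prob E \<le> 16 * C1 * T / (real N * \<epsilon>)\<^sup>2"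
    and E_bd: "\<forall>\<omega>\<in>space M - E. \<forall>t\<in>{0..T}. (\<forall>s\<in>{0..t}. q s \<omega> \<le> K) \<longrightarrow>
        \<bar>\<Sum>i\<in>{1..N}. ito_remainder \<phi> \<phi>1 \<phi>2 (\<lambda>t. x i t \<omega>) (\<lambda>s. a i s \<omega>) t\<bar> \<le> real N * \<epsilon>"
    by (elim bexE conjE)
  have "AE \<omega> in M. (\<forall>i\<in>{1..N}. (\<lambda>s. a i s \<omega>) absolutely_integrable_on {0..T}) \<and>
      (AE t in lborel. 0 \<le> t \<longrightarrow> inj_on (\<lambda>i. x i t \<omega>) {1..N} \<and> (\<forall>i\<in>{1..N}. x i t \<omega> \<noteq> 0))"
    using eq distinct by eventually_elim blast
  then obtain Z where Z: "Z \<in> null_sets M" and good: "\<And>\<omega>. \<omega> \<in> space M - Z \<Longrightarrow>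
      (\<forall>i\<in>{1..N}. (\<lambda>s. a i s \<omega>) absolutely_integrable_on {0..T}) \<and>
      (AE t in lborel. 0 \<le> t \<longrightarrow> inj_on (\<lambda>i. x i t \<omega>) {1..N} \<and> (\<forall>i\<in>{1..N}. x i t \<omega> \<noteq> 0))"
    by (elim AE_E3) blast
  show ?thesis
  proof (intro bexI[of _ "E \<union> Z"] conjI ballI impI)
    show "E \<union> Z \<in> events" using E Z by auto
    have "16 * C1 * T / (real N * \<epsilon>)\<^sup>2 = 32 * (real (Suc n))\<^sup>2 * T * K\<^sup>2 / (\<epsilon>\<^sup>2 * L)"
    proof -
      have "C1 * L = 2 * (real (Suc n))\<^sup>2 * (L ^ Suc n * (real N * K))" by (simp add: C1_def)
      also have "\<dots> = 2 * (real (Suc n))\<^sup>2 * K\<^sup>2 * (real N)\<^sup>2"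
        unfolding L(2) by (simp add: power2_eq_square)
      finally show ?thesis
        using N \<epsilon> L(1) by (simp add: divide_simps power_mult_distrib)
    qed
    then show "prob (E \<union> Z) \<le> 32 * (real (Suc n))\<^sup>2 * T * K\<^sup>2 / (\<epsilon>\<^sup>2 * root (Suc n) (real N * K))"
      using E Z by (simp add: measure_Un_null_set L_def)
  next
    fix \<omega> t
    assume \<omega>: "\<omega> \<in> space M - (E \<union> Z)" and t: "t \<in> {0..T}"
      and S_le: "\<forall>s\<in>{0..t}. S (Suc n) s \<omega> \<le> K"
    have S_y: "S k s \<omega> = power_mean N (y s \<omega>) k" if "0 \<le> s" for k s
    proof -
      have "\<omega> \<in> space M" using \<omega> by blast
      then have "lam i s \<omega> = y s \<omega> i" if "i \<in> {1..N}" for i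
        unfolding y_def by (rule lam_x[OF that \<open>0 \<le> s\<close>])
      then show ?thesis
        unfolding S_def power_mean_def by simp
    qed
    define g where "g s = moment_drift \<alpha> c (c * real (Suc n) / real N) n (power_mean N (y s \<omega>))" for s
    have x_c: "continuous_on {0..t} (\<lambda>t. x i t \<omega>)" if "i \<in> {1..N}" for i
      by (rule continuous_on_subset[OF x_cont[OF that]]) (use \<omega> in auto)
    have a_t: "(\<lambda>s. a i s \<omega>) absolutely_integrable_on {0..t}" if "i \<in> {1..N}" for i
    proof -
      have "(\<lambda>s. a i s \<omega>) absolutely_integrable_on {0..T}" using good[of \<omega>] \<omega> that by auto
      then show ?thesis by (rule set_integrable_subset) (use t in auto)
    qed
    have "(\<Sum>i\<in>{1..N}. integral {0..t} (\<lambda>s. \<phi>1 (x i s \<omega>) * a i s \<omega> + \<phi>2 (x i s \<omega>) / 2))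
        = integral {0..t} (\<lambda>s. \<Sum>i\<in>{1..N}. \<phi>1 (x i s \<omega>) * a i s \<omega> + \<phi>2 (x i s \<omega>) / 2)"
      by (rule Henstock_Kurzweil_Integration.integral_sum[symmetric])
        (auto intro!: ito_integrand_integrable(3)[OF d2 d3] x_c a_t)
    also have "\<dots> = integral {0..t} (\<lambda>s. real N * g s)"
    proof (rule AE_lborel_integral_cong)
      have "AE s in lborel. 0 \<le> s \<longrightarrow> inj_on (\<lambda>i. x i s \<omega>) {1..N} \<and> (\<forall>i\<in>{1..N}. x i s \<omega> \<noteq> 0)"
        using good[of \<omega>] \<omega> by auto
      then show "AE s in lborel. s \<in> {0..t} \<longrightarrow>
          (\<Sum>i\<in>{1..N}. \<phi>1 (x i s \<omega>) * a i s \<omega> + \<phi>2 (x i s \<omega>) / 2) = real N * g s"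
      proof eventually_elim
        case (elim s)
        show ?case
        proof
          assume "s \<in> {0..t}"
          then have s: "0 \<le> s" by simp
          have pos: "0 < x i s \<omega>" if "i \<in> {1..N}" for i
            using x_nonneg[OF that _ s, of \<omega>] elim s that \<omega> by force
          from dunkl_generator_power[of "\<lambda>i. x i s \<omega>" N n \<alpha> c, OF _ pos N] elim s
          show "(\<Sum>i\<in>{1..N}. \<phi>1 (x i s \<omega>) * a i s \<omega> + \<phi>2 (x i s \<omega>) / 2) = real N * g s"
            unfolding \<phi>1_def \<phi>2_def a_def g_def y_def[abs_def] by blast
          qed
      qed
    qed
    also have "\<dots> = real N * integral {0..t} g" by simp
    finally have int: "(\<Sum>i\<in>{1..N}. integral {0..t} (\<lambda>s. \<phi>1 (x i s \<omega>) * a i s \<omega> + \<phi>2 (x i s \<omega>) / 2))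
        = real N * integral {0..t} g" .
    have "(\<Sum>i\<in>{1..N}. \<phi> (x i t \<omega>)) = real N * S (Suc n) t \<omega>"
      using N t S_y[of t "Suc n"] by (simp add: \<phi>_y power_mean_def)
    moreover have "\<phi> (x i 0 \<omega>) = 0" if "i \<in> {1..N}" for i
      using x_0[OF that] \<omega> by (simp add: \<phi>_def)
    ultimately have "(\<Sum>i\<in>{1..N}. ito_remainder \<phi> \<phi>1 \<phi>2 (\<lambda>t. x i t \<omega>) (\<lambda>s. a i s \<omega>) t)
        = real N * (S (Suc n) t \<omega> - integral {0..t} g)"
      unfolding ito_remainder_def sum_subtractf int by (simp add: right_diff_distrib)
    moreover have "\<bar>\<Sum>i\<in>{1..N}. ito_remainder \<phi> \<phi>1 \<phi>2 (\<lambda>t. x i t \<omega>) (\<lambda>s. a i s \<omega>) t\<bar> \<le> real N * \<epsilon>"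
      using E_bd \<omega> t S_le S_y by (auto simp: q_def)
    ultimately have "real N * \<bar>S (Suc n) t \<omega> - integral {0..t} g\<bar> \<le> real N * \<epsilon>"
      by (simp add: abs_mult)
    then have "\<bar>S (Suc n) t \<omega> - integral {0..t} g\<bar> \<le> \<epsilon>" using N by simp
    also have "integral {0..t} g = integral {0..t}
        (\<lambda>s. moment_drift \<alpha> c (c * real (Suc n) / real N) n (\<lambda>k. S k s \<omega>))"
      by (rule Henstock_Kurzweil_Integration.integral_cong) (simp add: g_def S_y)
    finally show "\<bar>S (Suc n) t \<omega> - integral {0..t}
        (\<lambda>s. moment_drift \<alpha> c (c * real (Suc n) / real N) n (\<lambda>k. S k s \<omega>))\<bar> \<le> \<epsilon>" .
  qed
qed

section \<open>Uniform convergence in probability\<close>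

text \<open>Phrased with exceptional events in place of the event that the supremum exceeds
  $\varepsilon$, because finitely many exceptional events can be united when processes are added
  or multiplied.\<close>
definition unif_conv_prob ::
  "(nat \<Rightarrow> 'a measure) \<Rightarrow> real \<Rightarrow> (nat \<Rightarrow> real \<Rightarrow> 'a \<Rightarrow> real) \<Rightarrow> (real \<Rightarrow> real) \<Rightarrow> bool" where
  "unif_conv_prob M T X x \<longleftrightarrow>
     (\<forall>\<epsilon>>0. \<exists>A. (\<forall>\<^sub>F N in sequentially. A N \<in> sets (M N) \<and>
                 (\<forall>\<omega>\<in>space (M N) - A N. \<forall>t\<in>{0..T}. \<bar>X N t \<omega> - x t\<bar> \<le> \<epsilon>)) \<and>
               (\<lambda>N. measure (M N) (A N)) \<longlonglongrightarrow> 0)"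

lemma unif_conv_prob_deterministic:
  assumes "\<And>\<epsilon>. 0 < \<epsilon> \<Longrightarrow> \<forall>\<^sub>F N in sequentially. \<forall>\<omega>\<in>space (M N). \<forall>t\<in>{0..T}. \<bar>X N t \<omega> - x t\<bar> \<le> \<epsilon>"
  shows "unif_conv_prob M T X x"
  unfolding unif_conv_prob_def
  by (intro allI impI exI[of _ "\<lambda>_. {}"]) (use assms in auto)

text \<open>All closure properties come from this continuity principle: the exceptional events of the two
  ingredients are united.\<close>
lemma unif_conv_prob_combine:
  assumes X: "unif_conv_prob M T X x" and Y: "unif_conv_prob M T Y y"
    and comb: "\<And>\<epsilon>. 0 < \<epsilon> \<Longrightarrow> \<exists>\<delta>>0. \<forall>N \<omega>. \<forall>t\<in>{0..T}.
        \<bar>X N t \<omega> - x t\<bar> \<le> \<delta> \<longrightarrow> \<bar>Y N t \<omega> - y t\<bar> \<le> \<delta> \<longrightarrow> \<bar>Z N t \<omega> - z t\<bar> \<le> \<epsilon>"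
  shows "unif_conv_prob M T Z z"
  unfolding unif_conv_prob_def
proof (intro allI impI)
  fix \<epsilon> :: real assume "0 < \<epsilon>"
  from comb[OF this] obtain \<delta> where "0 < \<delta>" and \<delta>: "\<forall>N \<omega>. \<forall>t\<in>{0..T}.
        \<bar>X N t \<omega> - x t\<bar> \<le> \<delta> \<longrightarrow> \<bar>Y N t \<omega> - y t\<bar> \<le> \<delta> \<longrightarrow> \<bar>Z N t \<omega> - z t\<bar> \<le> \<epsilon>" by blast
  obtain A where A: "\<forall>\<^sub>F N in sequentially. A N \<in> sets (M N) \<and>
        (\<forall>\<omega>\<in>space (M N) - A N. \<forall>t\<in>{0..T}. \<bar>X N t \<omega> - x t\<bar> \<le> \<delta>)"
      "(\<lambda>N. measure (M N) (A N)) \<longlonglongrightarrow> 0"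
    using X \<open>0 < \<delta>\<close> unfolding unif_conv_prob_def by meson
  obtain B where B: "\<forall>\<^sub>F N in sequentially. B N \<in> sets (M N) \<and>
        (\<forall>\<omega>\<in>space (M N) - B N. \<forall>t\<in>{0..T}. \<bar>Y N t \<omega> - y t\<bar> \<le> \<delta>)"
      "(\<lambda>N. measure (M N) (B N)) \<longlonglongrightarrow> 0"
    using Y \<open>0 < \<delta>\<close> unfolding unif_conv_prob_def by meson
  show "\<exists>A. (\<forall>\<^sub>F N in sequentially. A N \<in> sets (M N) \<and>
          (\<forall>\<omega>\<in>space (M N) - A N. \<forall>t\<in>{0..T}. \<bar>Z N t \<omega> - z t\<bar> \<le> \<epsilon>)) \<and>
        (\<lambda>N. measure (M N) (A N)) \<longlonglongrightarrow> 0"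
  proof (intro exI[of _ "\<lambda>N. A N \<union> B N"] conjI)
    show "\<forall>\<^sub>F N in sequentially. A N \<union> B N \<in> sets (M N) \<and>
        (\<forall>\<omega>\<in>space (M N) - (A N \<union> B N). \<forall>t\<in>{0..T}. \<bar>Z N t \<omega> - z t\<bar> \<le> \<epsilon>)"
      using A(1) B(1) by eventually_elim (use \<delta> in auto)
    have "(\<lambda>N. measure (M N) (A N) + measure (M N) (B N)) \<longlonglongrightarrow> 0"
      using tendsto_add[OF A(2) B(2)] by simp
    note lim = this
    have le: "\<forall>\<^sub>F N in sequentially. measure (M N) (A N \<union> B N)
        \<le> measure (M N) (A N) + measure (M N) (B N)"
      using A(1) B(1) by eventually_elim (rule measure_Un_le; blast)
    show "(\<lambda>N. measure (M N) (A N \<union> B N)) \<longlonglongrightarrow> 0"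
      by (rule tendsto_sandwich[OF _ le tendsto_const lim]) simp
  qed
qed

lemma unif_conv_prob_const: "unif_conv_prob M T (\<lambda>N t \<omega>. x t) x"
  by (rule unif_conv_prob_deterministic) auto

lemma unif_conv_prob_add:
  assumes "unif_conv_prob M T X x" and "unif_conv_prob M T Y y"
  shows "unif_conv_prob M T (\<lambda>N t \<omega>. X N t \<omega> + Y N t \<omega>) (\<lambda>t. x t + y t)"
proof (rule unif_conv_prob_combine[OF assms])
  fix \<epsilon> :: real assume "0 < \<epsilon>"
  then show "\<exists>\<delta>>0. \<forall>N \<omega>. \<forall>t\<in>{0..T}. \<bar>X N t \<omega> - x t\<bar> \<le> \<delta> \<longrightarrow> \<bar>Y N t \<omega> - y t\<bar> \<le> \<delta> \<longrightarrow>
      \<bar>(X N t \<omega> + Y N t \<omega>) - (x t + y t)\<bar> \<le> \<epsilon>"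
    by (intro exI[of _ "\<epsilon> / 2"] conjI allI ballI impI; linarith)
qed

lemma unif_conv_prob_mult:
  assumes "unif_conv_prob M T X x" and "unif_conv_prob M T Y y"
    and x: "continuous_on {0..T} x" and y: "continuous_on {0..T} y"
  shows "unif_conv_prob M T (\<lambda>N t \<omega>. X N t \<omega> * Y N t \<omega>) (\<lambda>t. x t * y t)"
proof (rule unif_conv_prob_combine[OF assms(1,2)])
  fix \<epsilon> :: real assume \<epsilon>: "0 < \<epsilon>"
  have "bounded (x ` {0..T} \<union> y ` {0..T})"
    using x y by (simp add: compact_imp_bounded compact_continuous_image)
  then obtain R where R: "0 < R" "\<And>t. t \<in> {0..T} \<Longrightarrow> \<bar>x t\<bar> \<le> R \<and> \<bar>y t\<bar> \<le> R"
    unfolding bounded_pos real_norm_def by (metis UnI1 UnI2 imageI)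
  define \<delta> where "\<delta> = min 1 (\<epsilon> / (2 * R + 1))"
  have \<delta>: "0 < \<delta>" "\<delta> \<le> 1" "\<delta> * (2 * R + 1) \<le> \<epsilon>"
  proof -
    show "0 < \<delta>" "\<delta> \<le> 1" using \<epsilon> R by (auto simp: \<delta>_def)
    have "\<delta> * (2 * R + 1) \<le> \<epsilon> / (2 * R + 1) * (2 * R + 1)"
      using R by (intro mult_right_mono) (auto simp: \<delta>_def)
    then show "\<delta> * (2 * R + 1) \<le> \<epsilon>" using R by simp
  qed
  show "\<exists>\<delta>>0. \<forall>N \<omega>. \<forall>t\<in>{0..T}. \<bar>X N t \<omega> - x t\<bar> \<le> \<delta> \<longrightarrow> \<bar>Y N t \<omega> - y t\<bar> \<le> \<delta> \<longrightarrow>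
      \<bar>X N t \<omega> * Y N t \<omega> - x t * y t\<bar> \<le> \<epsilon>"
  proof (intro exI[of _ \<delta>] conjI allI ballI impI \<open>0 < \<delta>\<close>)
    fix N \<omega> t
    assume t: "t \<in> {0..T}" and X: "\<bar>X N t \<omega> - x t\<bar> \<le> \<delta>" and Y: "\<bar>Y N t \<omega> - y t\<bar> \<le> \<delta>"
    have "X N t \<omega> * Y N t \<omega> - x t * y t
        = (X N t \<omega> - x t) * (Y N t \<omega> - y t) + (X N t \<omega> - x t) * y t + x t * (Y N t \<omega> - y t)"
      by (simp add: algebra_simps)
    also have "\<bar>\<dots>\<bar> \<le> \<delta> * 1 + \<delta> * R + R * \<delta>"
    proof -
      have "\<bar>X N t \<omega> - x t\<bar> * \<bar>Y N t \<omega> - y t\<bar> \<le> \<delta> * 1"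
        by (rule mult_mono) (use X Y \<delta> in linarith)+
      moreover have "\<bar>X N t \<omega> - x t\<bar> * \<bar>y t\<bar> \<le> \<delta> * R" "\<bar>x t\<bar> * \<bar>Y N t \<omega> - y t\<bar> \<le> R * \<delta>"
        by (rule mult_mono; use X Y \<delta> R(2)[OF t] R(1) in linarith)+
      ultimately show ?thesis
        unfolding abs_mult[symmetric] by linarith
    qed
    also have "\<dots> \<le> \<epsilon>" using \<delta>(3) by (simp add: algebra_simps)
    finally show "\<bar>X N t \<omega> * Y N t \<omega> - x t * y t\<bar> \<le> \<epsilon>" .
  qed
qed

lemma unif_conv_prob_cmult:
  assumes "unif_conv_prob M T X x" and x: "continuous_on {0..T} x" "continuous_on {0..T} p"
  shows "unif_conv_prob M T (\<lambda>N t \<omega>. p t * X N t \<omega>) (\<lambda>t. p t * x t)"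
  by (rule unif_conv_prob_mult[OF unif_conv_prob_const assms(1) x(2,1)])

lemma unif_conv_prob_sum:
  assumes "finite I" and "\<And>i. i \<in> I \<Longrightarrow> unif_conv_prob M T (X i) (x i)"
  shows "unif_conv_prob M T (\<lambda>N t \<omega>. \<Sum>i\<in>I. X i N t \<omega>) (\<lambda>t. \<Sum>i\<in>I. x i t)"
  using assms
proof (induction I)
  case empty
  show ?case using unif_conv_prob_const[where x = "\<lambda>_. 0"] by simp
next
  case (insert i I)
  have "unif_conv_prob M T (\<lambda>N t \<omega>. X i N t \<omega> + (\<Sum>i\<in>I. X i N t \<omega>)) (\<lambda>t. x i t + (\<Sum>i\<in>I. x i t))"
    by (rule unif_conv_prob_add) (use insert in auto)
  then show ?case using insert.hyps by simp
qed

text \<open>At the first time when \<open>h\<close> reaches $\varepsilon$ the hypothesis of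
  \<open>step\<close> is still satisfied, and \<open>step\<close> then contradicts the choice of
  that time.\<close>
lemma bootstrap_bound:
  fixes h :: "real \<Rightarrow> real"
  assumes h: "continuous_on {0..T} h" and h0: "h 0 < \<epsilon>"
    and step: "\<And>t. t \<in> {0..T} \<Longrightarrow> (\<And>s. s \<in> {0..t} \<Longrightarrow> h s \<le> \<epsilon>) \<Longrightarrow> h t < \<epsilon>"
    and t: "t \<in> {0..T}"
  shows "h t \<le> \<epsilon>"
proof (rule ccontr)
  assume "\<not> h t \<le> \<epsilon>"
  define C where "C = {s \<in> {0..T}. \<epsilon> \<le> h s}"
  have "closed C"
    unfolding C_def by (rule continuous_on_closed_Collect_le[OF continuous_on_const h]) simp
  then have "compact C" by (rule compact_eq_bounded_closed[THEN iffD2, OF conjI, rotated])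
    (rule bounded_subset[of "{0..T}"], auto simp: C_def)
  moreover have "C \<noteq> {}" using t \<open>\<not> h t \<le> \<epsilon>\<close> by (auto simp: C_def)
  ultimately obtain t0 where t0: "t0 \<in> C" "\<And>s. s \<in> C \<Longrightarrow> t0 \<le> s"
    using continuous_attains_inf[of C "\<lambda>s. s"] by auto
  have t0_T: "t0 \<in> {0..T}" "\<epsilon> \<le> h t0" using t0(1) by (auto simp: C_def)
  have "\<exists>s. 0 \<le> s \<and> s \<le> t0 \<and> h s = \<epsilon>"
    by (rule IVT') (use h0 t0_T in \<open>auto intro: continuous_on_subset[OF h]\<close>)
  then obtain s where s: "0 \<le> s" "s \<le> t0" "h s = \<epsilon>" by blast
  then have "s \<in> C" using t0_T by (auto simp: C_def)
  with t0(2) s have "h t0 = \<epsilon>" by force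
  have "h r \<le> \<epsilon>" if "r \<in> {0..t0}" for r
  proof (cases "r = t0")
    case False
    then have "r \<notin> C" using t0(2)[of r] that by auto
    then show ?thesis using that t0_T by (auto simp: C_def)
  qed (use \<open>h t0 = \<epsilon>\<close> in simp)
  then have "h t0 < \<epsilon>" by (rule step[OF t0_T(1)])
  with t0_T show False by simp
qed

section \<open>Convergence of the empirical moments\<close>

text \<open>The recursion that defines $u_{n+1}$, multiplied by $(n+1) t^n$.\<close>
lemma moment_drift_limit:
  "moment_drift \<alpha> c 0 n (\<lambda>k. nu_moment \<alpha> c k * t ^ k) = real (Suc n) * nu_moment \<alpha> c (Suc n) * t ^ n"
proof -
  have "(\<Sum>k\<le>n. nu_moment \<alpha> c k * t ^ k * (nu_moment \<alpha> c (n - k) * t ^ (n - k)))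
      = (\<Sum>k\<le>n. nu_moment \<alpha> c k * nu_moment \<alpha> c (n - k)) * t ^ n"
    unfolding sum_distrib_right
  proof (rule sum.cong[OF refl])
    fix k assume "k \<in> {..n}"
    then have "t ^ n = t ^ k * t ^ (n - k)" by (simp add: power_add[symmetric])
    then show "nu_moment \<alpha> c k * t ^ k * (nu_moment \<alpha> c (n - k) * t ^ (n - k))
        = nu_moment \<alpha> c k * nu_moment \<alpha> c (n - k) * t ^ n" by simp
  qed
  then show ?thesis by (simp add: moment_drift_def algebra_simps)
qed

lemma integral_moment_drift_limit:
  assumes "0 \<le> t"
  shows "((\<lambda>s. moment_drift \<alpha> c 0 n (\<lambda>k. nu_moment \<alpha> c k * s ^ k)) has_integral
           nu_moment \<alpha> c (Suc n) * t ^ Suc n) {0..t}"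
proof -
  have "((\<lambda>s. moment_drift \<alpha> c 0 n (\<lambda>k. nu_moment \<alpha> c k * s ^ k)) has_integral
           nu_moment \<alpha> c (Suc n) * t ^ Suc n - nu_moment \<alpha> c (Suc n) * 0 ^ Suc n) {0..t}"
    by (rule fundamental_theorem_of_calculus[OF assms])
      (auto simp: moment_drift_limit has_real_derivative_iff_has_vector_derivative[symmetric]
        simp del: nu_moment.simps power_Suc intro!: derivative_eq_intros)
  then show ?thesis by simp
qed

lemma moment_drift_continuous:
  assumes "\<And>k. k \<le> n \<Longrightarrow> continuous_on A (\<lambda>t. s t k)"
  shows "continuous_on A (\<lambda>t. moment_drift \<alpha> c e n (s t))"
  unfolding moment_drift_def by (intro continuous_intros assms) auto

lemma moment_drift_conv:
  assumes conv: "\<And>k. k \<le> n \<Longrightarrow> unif_conv_prob M T (S k) (s k)"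
    and cont: "\<And>k. k \<le> n \<Longrightarrow> continuous_on {0..T} (s k)" and e: "e \<longlonglongrightarrow> 0"
  shows "unif_conv_prob M T (\<lambda>N t \<omega>. moment_drift \<alpha> c (e N) n (\<lambda>k. S k N t \<omega>))
           (\<lambda>t. moment_drift \<alpha> c 0 n (\<lambda>k. s k t))"
proof -
  have e': "unif_conv_prob M T (\<lambda>N t \<omega>. - e N) (\<lambda>t. 0)"
  proof (rule unif_conv_prob_deterministic)
    fix \<epsilon> :: real assume "0 < \<epsilon>"
    with e have "\<forall>\<^sub>F N in sequentially. \<bar>e N\<bar> < \<epsilon>"
      by (simp add: tendsto_iff dist_real_def)
    then show "\<forall>\<^sub>F N in sequentially. \<forall>\<omega>\<in>space (M N). \<forall>t\<in>{0..T}. \<bar>- e N - 0\<bar> \<le> \<epsilon>"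
      by eventually_elim auto
  qed
  have "unif_conv_prob M T
     (\<lambda>N t \<omega>. real (Suc n) * ((\<alpha> + real n) * S n N t \<omega> + (c * (\<Sum>k\<le>n. S k N t \<omega> * S (n - k) N t \<omega>)
        + (- e N) * S n N t \<omega>)))
     (\<lambda>t. real (Suc n) * ((\<alpha> + real n) * s n t + (c * (\<Sum>k\<le>n. s k t * s (n - k) t) + 0 * s n t)))"
    by (intro unif_conv_prob_cmult unif_conv_prob_add unif_conv_prob_sum unif_conv_prob_mult e' conv
        continuous_intros cont) auto
  then show ?thesis by (simp add: moment_drift_def add_diff_eq)
qed

lemma laguerre_process_paths:
  assumes proc: "beta_laguerre_process M F \<alpha> \<beta> N b lam"
  shows "\<And>i t. i \<in> {1..N} \<Longrightarrow> 0 \<le> t \<Longrightarrow> lam i t \<in> borel_measurable M"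
    and "\<And>i \<omega>. i \<in> {1..N} \<Longrightarrow> \<omega> \<in> space M \<Longrightarrow> continuous_on {0..} (\<lambda>t. lam i t \<omega>)"
    and "\<And>i \<omega>. i \<in> {1..N} \<Longrightarrow> \<omega> \<in> space M \<Longrightarrow> lam i 0 \<omega> = 0"
    and "prob_space M"
proof -
  have ord: "ordered_process M F N lam" and B: "indep_brownian_motions M F N b"
    using proc by (simp_all add: beta_laguerre_process_def laguerre_sde_def)
  show "prob_space M" using B by (simp add: indep_brownian_motions_def)
  have sub: "subalgebra M (F t)" for t using B by (simp add: indep_brownian_motions_def)
  show "lam i t \<in> borel_measurable M" if "i \<in> {1..N}" "0 \<le> t" for i t
    using ord that unfolding ordered_process_def by (blast intro: measurable_from_subalg[OF sub])
  show "continuous_on {0..} (\<lambda>t. lam i t \<omega>)" "lam i 0 \<omega> = 0"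
    if "i \<in> {1..N}" "\<omega> \<in> space M" for i \<omega>
    using ord that unfolding ordered_process_def by blast+
qed

lemma power_mean_continuous:
  assumes "\<And>i. i \<in> {1..N} \<Longrightarrow> continuous_on A (\<lambda>t. y i t)"
  shows "continuous_on A (\<lambda>t. power_mean N (\<lambda>i. y i t) k)"
  unfolding power_mean_def
proof (cases "N = 0")
  case False
  then show "continuous_on A (\<lambda>t. (\<Sum>i\<in>{1..N}. y i t ^ k) / real N)"
    by (intro continuous_intros assms) auto
qed simp

lemma root_bound_tendsto_0:
  assumes "0 < K"
  shows "(\<lambda>N. C / (D * root (Suc n) (real N * K))) \<longlonglongrightarrow> 0"
proof -
  have "(\<lambda>N. root (Suc n) (inverse K * inverse (real N))) \<longlonglongrightarrow> root (Suc n) (inverse K * 0)"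
    by (intro tendsto_intros lim_inverse_n)
  then have "(\<lambda>N. C / D * root (Suc n) (inverse (real N * K))) \<longlonglongrightarrow> C / D * 0"
    by (intro tendsto_intros) (simp add: mult.commute)
  moreover have "C / D * root (Suc n) (inverse x) = C / (D * root (Suc n) x)" for x
    unfolding real_root_inverse by (simp add: divide_inverse)
  ultimately show ?thesis by (simp only: mult_zero_right)
qed

text \<open>Outside the exceptional events of the drift and of the martingale part, as long as the
  moment is within $\varepsilon$ of its limit it is at most \<open>K\<close>, and then it is in
  fact within $\varepsilon/2$. The moment starts at $0$, so \<open>bootstrap_bound\<close>
  applies.\<close>
lemma laguerre_moment_step:
  assumes process: "\<And>N. N \<ge> 1 \<Longrightarrow>
      beta_laguerre_process (M N) (F N) \<alpha> (2 * c / real N) N (b N) (lam N)"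
    and T: "0 < T"
    and IH: "\<And>k. k \<le> n \<Longrightarrow> unif_conv_prob M T
      (\<lambda>N t \<omega>. power_mean N (\<lambda>i. lam N i t \<omega>) k) (\<lambda>t. nu_moment \<alpha> c k * t ^ k)"
  shows "unif_conv_prob M T
      (\<lambda>N t \<omega>. power_mean N (\<lambda>i. lam N i t \<omega>) (Suc n)) (\<lambda>t. nu_moment \<alpha> c (Suc n) * t ^ Suc n)"
  unfolding unif_conv_prob_def
proof (intro allI impI)
  fix \<epsilon> :: real assume \<epsilon>: "0 < \<epsilon>"
  define S where "S k N t \<omega> = power_mean N (\<lambda>i. lam N i t \<omega>) k" for k N t \<omega>
  define u where "u k t = nu_moment \<alpha> c k * t ^ k" for k and t :: real
  define e where "e N = c * real (Suc n) / real N" for N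
  define g where "g N t \<omega> = moment_drift \<alpha> c (e N) n (\<lambda>k. S k N t \<omega>)" for N t \<omega>
  define h where "h t = moment_drift \<alpha> c 0 n (\<lambda>k. u k t)" for t
  have "e \<longlonglongrightarrow> 0"
    unfolding e_def by (rule lim_const_over_n)
  then have "unif_conv_prob M T g h"
    unfolding g_def[abs_def] h_def[abs_def]
    by (intro moment_drift_conv) (use IH in \<open>auto simp: S_def[abs_def] u_def[abs_def] intro!: continuous_intros\<close>)
  then obtain A where A: "\<forall>\<^sub>F N in sequentially. A N \<in> sets (M N) \<and>
        (\<forall>\<omega>\<in>space (M N) - A N. \<forall>t\<in>{0..T}. \<bar>g N t \<omega> - h t\<bar> \<le> \<epsilon> / (4 * T))"
      and A0: "(\<lambda>N. measure (M N) (A N)) \<longlonglongrightarrow> 0"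
    unfolding unif_conv_prob_def using \<epsilon> T by (meson divide_pos_pos mult_pos_pos zero_less_numeral)
  \<comment> \<open>A moment that differs from its limit by at most \<open>\<epsilon>\<close> does not exceed this level.\<close>
  define K where "K = \<bar>nu_moment \<alpha> c (Suc n)\<bar> * T ^ Suc n + \<epsilon>"
  have K: "0 < K" using \<epsilon> T unfolding K_def by (intro add_nonneg_pos) auto
  have u_K: "u (Suc n) t \<le> K - \<epsilon>" if "t \<in> {0..T}" for t
  proof -
    have "\<bar>u (Suc n) t\<bar> \<le> \<bar>nu_moment \<alpha> c (Suc n)\<bar> * T ^ Suc n"
      unfolding u_def abs_mult
      by (intro mult_left_mono) (use that in \<open>auto simp: power_abs simp del: power_Suc intro!: power_mono\<close>)
    then show ?thesis by (simp add: K_def)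
  qed
  define p where "p N = 32 * (real (Suc n))\<^sup>2 * T * K\<^sup>2 / ((\<epsilon> / 4)\<^sup>2 * root (Suc n) (real N * K))" for N
  have p0: "p \<longlonglongrightarrow> 0" unfolding p_def by (rule root_bound_tendsto_0[OF K])
  define good where "good N E \<longleftrightarrow> E \<in> sets (M N) \<and> measure (M N) E \<le> p N \<and>
      (\<forall>\<omega>\<in>space (M N) - E. \<forall>t\<in>{0..T}. (\<forall>s\<in>{0..t}. S (Suc n) N s \<omega> \<le> K) \<longrightarrow>
        \<bar>S (Suc n) N t \<omega> - integral {0..t} (\<lambda>s. g N s \<omega>)\<bar> \<le> \<epsilon> / 4)" for N E
  define E where "E N = (SOME E. good N E)" for N
  have "(\<lambda>N. 2 * c / real N) \<longlonglongrightarrow> 0" by (rule lim_const_over_n)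
  then have small: "\<forall>\<^sub>F N in sequentially. 2 * c / real N < 1"
    by (rule order_tendstoD(2)) simp
  have E: "\<forall>\<^sub>F N in sequentially. good N (E N)"
    using small eventually_ge_at_top[of 1]
  proof eventually_elim
    case (elim N)
    have "\<epsilon> / 4 > 0" using \<epsilon> by simp
    from laguerre_moment_estimate[OF process[OF elim(2)] elim(2,1) T K this, of n]
    have "\<exists>E. good N E"
      unfolding good_def p_def S_def g_def e_def by blast
    then show ?case unfolding E_def by (rule someI_ex)
  qed
  show "\<exists>A. (\<forall>\<^sub>F N in sequentially. A N \<in> sets (M N) \<and>
        (\<forall>\<omega>\<in>space (M N) - A N. \<forall>t\<in>{0..T}.
          \<bar>power_mean N (\<lambda>i. lam N i t \<omega>) (Suc n) - nu_moment \<alpha> c (Suc n) * t ^ Suc n\<bar> \<le> \<epsilon>)) \<and>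
      (\<lambda>N. measure (M N) (A N)) \<longlonglongrightarrow> 0"
    unfolding S_def[symmetric] u_def[symmetric]
  proof (intro exI[of _ "\<lambda>N. A N \<union> E N"] conjI)
    have "\<forall>\<^sub>F N in sequentially. measure (M N) (A N \<union> E N) \<le> measure (M N) (A N) + p N"
      using A E
    proof eventually_elim
      case (elim N)
      then have "measure (M N) (A N \<union> E N) \<le> measure (M N) (A N) + measure (M N) (E N)"
        by (intro measure_Un_le) (auto simp: good_def)
      with elim(2) show ?case by (simp add: good_def)
    qed
    moreover have "(\<lambda>N. measure (M N) (A N) + p N) \<longlonglongrightarrow> 0"
      using tendsto_add[OF A0 p0] by simp
    ultimately show "(\<lambda>N. measure (M N) (A N \<union> E N)) \<longlonglongrightarrow> 0"
      by (rule tendsto_sandwich[OF _ _ tendsto_const, rotated]) simp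
  next
    show "\<forall>\<^sub>F N in sequentially. A N \<union> E N \<in> sets (M N) \<and>
        (\<forall>\<omega>\<in>space (M N) - (A N \<union> E N). \<forall>t\<in>{0..T}. \<bar>S (Suc n) N t \<omega> - u (Suc n) t\<bar> \<le> \<epsilon>)"
      using A E eventually_ge_at_top[of 1]
    proof eventually_elim
      case (elim N)
      note paths = laguerre_process_paths[OF process[OF elim(3)]]
      have "\<bar>S (Suc n) N t \<omega> - u (Suc n) t\<bar> \<le> \<epsilon>"
        if \<omega>: "\<omega> \<in> space (M N) - (A N \<union> E N)" and t: "t \<in> {0..T}" for \<omega> t
      proof -
        have S_cont: "continuous_on {0..T} (\<lambda>t. S k N t \<omega>)" for k
          unfolding S_def
          by (intro power_mean_continuous continuous_on_subset[OF paths(2)]) (use \<omega> in auto)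
        show ?thesis
        proof (rule bootstrap_bound[where T = T and h = "\<lambda>t. \<bar>S (Suc n) N t \<omega> - u (Suc n) t\<bar>", OF _ _ _ t])
          from S_cont show "continuous_on {0..T} (\<lambda>t. \<bar>S (Suc n) N t \<omega> - u (Suc n) t\<bar>)"
            unfolding u_def by (intro continuous_intros)
          have "S (Suc n) N 0 \<omega> = 0" using paths(3) \<omega> by (simp add: S_def power_mean_def)
          then show "\<bar>S (Suc n) N 0 \<omega> - u (Suc n) 0\<bar> < \<epsilon>" using \<epsilon> by (simp add: u_def)
        next
          fix t assume t: "t \<in> {0..T}"
            and le: "\<And>s. s \<in> {0..t} \<Longrightarrow> \<bar>S (Suc n) N s \<omega> - u (Suc n) s\<bar> \<le> \<epsilon>"
          have "S (Suc n) N s \<omega> \<le> K" if "s \<in> {0..t}" for s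
            using le[OF that] u_K[of s] that t by auto
          then have 1: "\<bar>S (Suc n) N t \<omega> - integral {0..t} (\<lambda>s. g N s \<omega>)\<bar> \<le> \<epsilon> / 4"
            using elim(2) \<omega> t unfolding good_def by blast
          have h_int: "(h has_integral u (Suc n) t) {0..t}"
            unfolding h_def[abs_def] u_def using integral_moment_drift_limit[of t] t by auto
          have g_int: "(\<lambda>s. g N s \<omega>) integrable_on {0..t}"
          proof (rule integrable_continuous_real)
            have "continuous_on {0..t} (\<lambda>s. S k N s \<omega>)" for k
              by (rule continuous_on_subset[OF S_cont]) (use t in auto)
            then show "continuous_on {0..t} (\<lambda>s. g N s \<omega>)"
              unfolding g_def by (intro moment_drift_continuous)
          qed
          have "\<bar>integral {0..t} (\<lambda>s. g N s \<omega>) - u (Suc n) t\<bar> = \<bar>integral {0..t} (\<lambda>s. g N s \<omega> - h s)\<bar>"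
            using h_int g_int
            by (subst Henstock_Kurzweil_Integration.integral_diff) (auto simp: has_integral_iff)
          also have "\<dots> \<le> integral {0..t} (\<lambda>s. \<epsilon> / (4 * T))"
          proof (rule integral_norm_bound_integral[where 'a = real, unfolded real_norm_def])
            show "(\<lambda>s. g N s \<omega> - h s) integrable_on {0..t}"
              using h_int g_int by (intro integrable_diff) (auto simp: has_integral_iff)
            show "\<bar>g N s \<omega> - h s\<bar> \<le> \<epsilon> / (4 * T)" if "s \<in> {0..t}" for s
              using elim(1) \<omega> that t by auto
          qed auto
          also have "\<dots> = t * \<epsilon> / (4 * T)" using t by simp
          also have "\<dots> \<le> \<epsilon> / 4" using t T \<epsilon> by (simp add: divide_simps)
          finally show "\<bar>S (Suc n) N t \<omega> - u (Suc n) t\<bar> < \<epsilon>"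
            using 1 \<epsilon> by linarith
        qed
      qed
      moreover have "A N \<union> E N \<in> sets (M N)" using elim by (auto simp: good_def)
      ultimately show ?case by blast
    qed
  qed
qed

theorem laguerre_moments_converge:
  assumes process: "\<And>N. N \<ge> 1 \<Longrightarrow>
      beta_laguerre_process (M N) (F N) \<alpha> (2 * c / real N) N (b N) (lam N)"
    and T: "0 < T"
  shows "unif_conv_prob M T
      (\<lambda>N t \<omega>. power_mean N (\<lambda>i. lam N i t \<omega>) n) (\<lambda>t. nu_moment \<alpha> c n * t ^ n)"
proof (induction n rule: less_induct)
  case (less n)
  show ?case
  proof (cases n)
    case 0
    show ?thesis
      unfolding 0
    proof (rule unif_conv_prob_deterministic)
      fix \<epsilon> :: real assume "0 < \<epsilon>"
      then show "\<forall>\<^sub>F N in sequentially. \<forall>\<omega>\<in>space (M N). \<forall>t\<in>{0..T}.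
          \<bar>power_mean N (\<lambda>i. lam N i t \<omega>) 0 - nu_moment \<alpha> c 0 * t ^ 0\<bar> \<le> \<epsilon>"
        by (intro eventually_mono[OF eventually_ge_at_top[of 1]]) (auto simp: power_mean_def)
    qed
  next
    case (Suc m)
    then show ?thesis
      using laguerre_moment_step[OF process T, of m] less by (simp del: nu_moment.simps power_Suc)
  qed
qed

section \<open>Polynomial test functions\<close>

text \<open>Polynomials in $x$ whose coefficients are polynomials in $t$ form the ring of
  univariate polynomials over a polynomial ring, where closure under sums and products is
  available.\<close>
lemma real_polynomial_function_pairE:
  fixes f :: "real \<Rightarrow> real \<Rightarrow> real"
  assumes "real_polynomial_function (\<lambda>(t, x). f t x)"
  obtains d :: nat and p :: "nat \<Rightarrow> real poly" where "\<And>t x. f t x = (\<Sum>k\<le>d. poly (p k) t * x ^ k)"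
proof -
  have "\<exists>q :: real poly poly. \<forall>z. h z = poly (poly q [:snd z:]) (fst z)"
    if "real_polynomial_function h" for h :: "real \<times> real \<Rightarrow> real"
    using that
  proof induction
    case (linear h)
    have "h z = poly (poly [:[:0, h (1, 0):], [:h (0, 1):]:] [:snd z:]) (fst z)" for z
    proof -
      have "z = fst z *\<^sub>R (1, 0) + snd z *\<^sub>R (0, 1)" by (simp add: prod_eq_iff)
      then have "h z = h (fst z *\<^sub>R (1, 0) + snd z *\<^sub>R (0, 1))" by (rule arg_cong)
      also have "\<dots> = fst z * h (1, 0) + snd z * h (0, 1)"
        by (simp only: linear_simps[OF linear] real_scaleR_def)
      finally have "h z = fst z * h (1, 0) + snd z * h (0, 1)" .
      then show ?thesis by simp
    qed
    then show ?case by blast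
  next
    case (const c)
    have "c = poly (poly [:[:c:]:] [:snd z:]) (fst z)" for z :: "real \<times> real" by simp
    then show ?case by blast
  next
    case (add f g)
    then obtain q r :: "real poly poly" where
      "\<forall>z. f z = poly (poly q [:snd z:]) (fst z)" "\<forall>z. g z = poly (poly r [:snd z:]) (fst z)" by blast
    then show ?case by (intro exI[of _ "q + r"]) simp
  next
    case (mult f g)
    then obtain q r :: "real poly poly" where
      "\<forall>z. f z = poly (poly q [:snd z:]) (fst z)" "\<forall>z. g z = poly (poly r [:snd z:]) (fst z)" by blast
    then show ?case by (intro exI[of _ "q * r"]) simp
  qed
  from this[OF assms] obtain q :: "real poly poly"
    where q: "\<forall>z. (case z of (t, x) \<Rightarrow> f t x) = poly (poly q [:snd z:]) (fst z)" by blast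
  have "f t x = (\<Sum>k\<le>degree q. poly (coeff q k) t * x ^ k)" for t x
  proof -
    have "f t x = poly (poly q [:x:]) t" using q[rule_format, of "(t, x)"] by simp
    also have "\<dots> = (\<Sum>k\<le>degree q. poly (coeff q k) t * x ^ k)"
      by (subst poly_altdef) (simp add: poly_sum)
    finally show ?thesis .
  qed
  then show thesis by (rule that)
qed

lemma integral_empirical_measure:
  assumes "h \<in> borel_measurable borel"
  shows "(\<integral>x. h x \<partial>empirical_measure N y) = (\<Sum>i\<in>{1..N}. h (y i)) / real N"
proof -
  have "y \<in> uniform_count_measure {1..N} \<rightarrow>\<^sub>M (borel :: real measure)"
    by (auto simp: measurable_def space_uniform_count_measure sets_uniform_count_measure)
  then show ?thesis
    unfolding empirical_measure_def
    by (subst integral_distr[OF _ assms]) (simp_all add: integral_uniform_count_measure)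
qed

lemma integral_empirical_polynomial:
  "(\<integral>x. (\<Sum>k\<le>d. a k * x ^ k) \<partial>empirical_measure N y) = (\<Sum>k\<le>d. a k * power_mean N y k)"
proof -
  have "(\<integral>x. (\<Sum>k\<le>d. a k * x ^ k) \<partial>empirical_measure N y)
      = (\<Sum>i\<in>{1..N}. \<Sum>k\<le>d. a k * y i ^ k) / real N"
    by (rule integral_empirical_measure) measurable
  also have "\<dots> = (\<Sum>k\<le>d. a k * power_mean N y k)"
    by (subst sum.swap) (simp add: power_mean_def sum_distrib_left sum_divide_distrib)
  finally show ?thesis .
qed

text \<open>By continuity the supremum may be taken over a countable dense set.\<close>
lemma borel_measurable_SUP_continuous:
  fixes X :: "real \<Rightarrow> 'a \<Rightarrow> real"
  assumes T: "0 \<le> T" and meas: "\<And>t. t \<in> {0..T} \<Longrightarrow> X t \<in> borel_measurable M"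
    and cont: "\<And>\<omega>. \<omega> \<in> space M \<Longrightarrow> continuous_on {0..T} (\<lambda>t. X t \<omega>)"
  shows "(\<lambda>\<omega>. SUP t\<in>{0..T}. X t \<omega>) \<in> borel_measurable M"
proof -
  obtain D where D: "countable D" "D \<subseteq> {0..T}" "{0..T} \<subseteq> closure D"
    by (rule separable)
  have cl: "closure D = {0..T}"
    using D(3) closure_minimal[OF D(2)] by auto
  have "D \<noteq> {}" using cl T by auto
  have bdd: "bdd_above ((\<lambda>t. X t \<omega>) ` {0..T})" if "\<omega> \<in> space M" for \<omega>
    by (intro bounded_imp_bdd_above compact_imp_bounded compact_continuous_image cont[OF that]) auto
  have bdd_D: "bdd_above ((\<lambda>t. X t \<omega>) ` D)" if "\<omega> \<in> space M" for \<omega>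
    by (rule bdd_above_mono[OF bdd[OF that]]) (use D(2) in auto)
  have "(\<lambda>\<omega>. SUP t\<in>D. X t \<omega>) \<in> borel_measurable M"
    by (rule borel_measurable_cSUP) (use D(1,2) meas bdd_D in auto)
  moreover have "(SUP t\<in>{0..T}. X t \<omega>) = (SUP t\<in>D. X t \<omega>)" if \<omega>: "\<omega> \<in> space M" for \<omega>
  proof (rule antisym)
    show "(SUP t\<in>{0..T}. X t \<omega>) \<le> (SUP t\<in>D. X t \<omega>)"
    proof (rule cSUP_least)
      fix t assume t: "t \<in> {0..T}"
      show "X t \<omega> \<le> (SUP t\<in>D. X t \<omega>)"
      proof (rule continuous_le_on_closure[of D "\<lambda>t. X t \<omega>"])
        show "continuous_on (closure D) (\<lambda>t. X t \<omega>)" unfolding cl by (rule cont[OF \<omega>])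
        show "t \<in> closure D" using t cl by simp
        show "X s \<omega> \<le> (SUP t\<in>D. X t \<omega>)" if "s \<in> D" for s
          by (rule cSUP_upper[OF that bdd_D[OF \<omega>]])
      qed
    qed (use T in auto)
    show "(SUP t\<in>D. X t \<omega>) \<le> (SUP t\<in>{0..T}. X t \<omega>)"
      by (rule cSUP_subset_mono[OF \<open>D \<noteq> {}\<close> bdd[OF \<omega>] D(2)]) simp
  qed
  ultimately show ?thesis by (simp cong: measurable_cong)
qed

lemma tendsto_prob_C_of_unif_conv_prob:
  assumes conv: "unif_conv_prob M T X x" and T: "0 < T" and x: "continuous_on {0..T} x"
    and proc: "\<forall>\<^sub>F N in sequentially. prob_space (M N) \<and>
        (\<forall>\<omega>\<in>space (M N). continuous_on {0..T} (\<lambda>t. X N t \<omega>)) \<and>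
        (\<forall>t\<in>{0..T}. X N t \<in> borel_measurable (M N))"
  shows "tendsto_prob_C M T X x"
  unfolding tendsto_prob_C_def null_in_prob_def
proof (intro conjI allI impI x)
  show "\<forall>\<^sub>F N in sequentially. \<forall>\<omega>\<in>space (M N). continuous_on {0..T} (\<lambda>t. X N t \<omega>)"
    using proc by eventually_elim blast
  show "\<forall>\<^sub>F N in sequentially. (\<lambda>\<omega>. SUP t\<in>{0..T}. \<bar>X N t \<omega> - x t\<bar>) \<in> borel_measurable (M N)"
    using proc
  proof eventually_elim
    case (elim N)
    show ?case
    proof (rule borel_measurable_SUP_continuous)
      show "0 \<le> T" using T by simp
      show "(\<lambda>\<omega>. \<bar>X N t \<omega> - x t\<bar>) \<in> borel_measurable (M N)" if "t \<in> {0..T}" for t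
        using elim that by (intro borel_measurable_abs borel_measurable_diff) auto
      show "continuous_on {0..T} (\<lambda>t. \<bar>X N t \<omega> - x t\<bar>)" if "\<omega> \<in> space (M N)" for \<omega>
        using elim that x by (intro continuous_intros) auto
    qed
  qed
next
  fix \<epsilon> :: real assume \<epsilon>: "0 < \<epsilon>"
  then obtain A where A: "\<forall>\<^sub>F N in sequentially. A N \<in> sets (M N) \<and>
        (\<forall>\<omega>\<in>space (M N) - A N. \<forall>t\<in>{0..T}. \<bar>X N t \<omega> - x t\<bar> \<le> \<epsilon> / 2)"
      and A0: "(\<lambda>N. measure (M N) (A N)) \<longlonglongrightarrow> 0"
    using conv unfolding unif_conv_prob_def by (meson half_gt_zero)
  have "\<forall>\<^sub>F N in sequentially.
      measure (M N) {\<omega> \<in> space (M N). \<epsilon> \<le> \<bar>SUP t\<in>{0..T}. \<bar>X N t \<omega> - x t\<bar>\<bar>} \<le> measure (M N) (A N)"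
    using A proc
  proof eventually_elim
    case (elim N)
    interpret prob_space "M N" using elim by blast
    show ?case
    proof (rule finite_measure_mono)
      show "A N \<in> events" using elim by blast
      show "{\<omega> \<in> space (M N). \<epsilon> \<le> \<bar>SUP t\<in>{0..T}. \<bar>X N t \<omega> - x t\<bar>\<bar>} \<subseteq> A N"
      proof (rule subsetI, rule ccontr)
        fix \<omega> assume \<omega>: "\<omega> \<in> {\<omega> \<in> space (M N). \<epsilon> \<le> \<bar>SUP t\<in>{0..T}. \<bar>X N t \<omega> - x t\<bar>\<bar>}" "\<omega> \<notin> A N"
        then have le: "\<bar>X N t \<omega> - x t\<bar> \<le> \<epsilon> / 2" if "t \<in> {0..T}" for t using elim that by blast
        have "(SUP t\<in>{0..T}. \<bar>X N t \<omega> - x t\<bar>) \<le> \<epsilon> / 2"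
          by (rule cSUP_least) (use T le in auto)
        moreover have "0 \<le> (SUP t\<in>{0..T}. \<bar>X N t \<omega> - x t\<bar>)"
          by (rule cSUP_upper2[where x = 0]) (use T le in \<open>auto intro!: bdd_aboveI2[where M = "\<epsilon> / 2"]\<close>)
        ultimately show False using \<omega>(1) \<epsilon> by auto
      qed
    qed
  qed
  then show "(\<lambda>N. measure (M N) {\<omega> \<in> space (M N). \<epsilon> \<le> \<bar>SUP t\<in>{0..T}. \<bar>X N t \<omega> - x t\<bar>\<bar>}) \<longlonglongrightarrow> 0"
    by (rule tendsto_sandwich[OF _ _ tendsto_const A0, rotated]) simp
qed

section \<open>The limiting measures\<close>

text \<open>For $t > 0$ by the substitution $x = ty$. At $t = 0$ the measure is $\delta_0$, and $u_0 = 1$.\<close>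
lemma mu_moments:
  assumes nu: "is_nu_density \<alpha> c g" and t: "0 \<le> t"
  shows "integrable (mu g t) (\<lambda>x. x ^ k)"
    and "(\<integral>x. x ^ k \<partial>mu g t) = nu_moment \<alpha> c k * t ^ k"
proof -
  have "integrable (mu g t) (\<lambda>x. x ^ k) \<and> (\<integral>x. x ^ k \<partial>mu g t) = nu_moment \<alpha> c k * t ^ k"
  proof (cases "t = 0")
    case True
    interpret prob_space "return borel (0 :: real)" by (rule prob_space_return) simp
    have "integrable (return borel 0) (\<lambda>x :: real. x ^ k)"
      by (rule integrable_const_bound[of _ "0 ^ k"]) (auto simp: AE_return)
    moreover have "(\<integral>x. x ^ k \<partial>return borel (0 :: real)) = 0 ^ k"
      by (rule integral_return) auto
    ultimately show ?thesis using True by (cases k) (auto simp: mu_def)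
  next
    case False
    with t have t: "0 < t" by simp
    have [measurable]: "g \<in> borel_measurable borel" and g0: "\<And>x. 0 \<le> g x"
      and mom: "integrable (density lborel (\<lambda>x. ennreal (g x))) (\<lambda>x. x ^ k)"
         "(\<integral>x. x ^ k \<partial>(density lborel (\<lambda>x. ennreal (g x)))) = nu_moment \<alpha> c k"
      using nu by (auto simp: is_nu_density_def)
    have lb: "integrable lborel (\<lambda>x. g x * x ^ k)" "(\<integral>x. g x * x ^ k \<partial>lborel) = nu_moment \<alpha> c k"
      using mom g0 by (simp_all add: integrable_density integral_density)
    define G where "G x = 1 / t * g (x / t) * x ^ k" for x
    have G_scale: "G (0 + t * x) = t ^ k / t * (g x * x ^ k)" for x
      using t by (simp add: G_def power_mult_distrib)
    have "integrable lborel (\<lambda>x. G (0 + t * x))"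
      unfolding G_scale using lb(1) by simp
    then have "integrable lborel G"
      using lborel_integrable_real_affine_iff[of t G 0] t by simp
    moreover have "(\<integral>x. G x \<partial>lborel) = nu_moment \<alpha> c k * t ^ k"
      using lborel_integral_real_affine[of t G 0] t lb(2) unfolding G_scale by simp
    moreover have "mu g t = density lborel (\<lambda>x. ennreal (1 / t * g (x / t)))"
      using t by (simp add: mu_def)
    ultimately show ?thesis
      using g0 t by (simp add: integrable_density integral_density G_def[abs_def])
  qed
  then show "integrable (mu g t) (\<lambda>x. x ^ k)" "(\<integral>x. x ^ k \<partial>mu g t) = nu_moment \<alpha> c k * t ^ k"
    by auto
qed

lemma mu_integral_polynomial:
  assumes nu: "is_nu_density \<alpha> c g" and t: "0 \<le> t"
  shows "(\<integral>x. (\<Sum>k\<in>I. a k * x ^ e k) \<partial>mu g t) = (\<Sum>k\<in>I. a k * (nu_moment \<alpha> c (e k) * t ^ e k))"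
  using mu_moments[OF nu t] by (subst Bochner_Integration.integral_sum) auto

lemma deriv_power_sum:
  fixes a :: "'i \<Rightarrow> real" and e :: "'i \<Rightarrow> nat"
  shows "deriv (\<lambda>z. \<Sum>k\<in>I. a k * z ^ e k) = (\<lambda>z. \<Sum>k\<in>I. a k * real (e k) * z ^ (e k - 1))"
proof
  fix z :: real
  have "((\<lambda>z. \<Sum>k\<in>I. a k * z ^ e k) has_real_derivative (\<Sum>k\<in>I. a k * (real (e k) * z ^ (e k - Suc 0)))) (at z)"
    by (intro DERIV_sum DERIV_cmult DERIV_pow)
  then show "deriv (\<lambda>z. \<Sum>k\<in>I. a k * z ^ e k) z = (\<Sum>k\<in>I. a k * real (e k) * z ^ (e k - 1))"
    by (simp add: DERIV_imp_deriv mult.assoc)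
qed

lemma diff_quot_power_sum:
  fixes a :: "nat \<Rightarrow> real"
  shows "diff_quot (\<lambda>z. \<Sum>k\<le>d. a k * z ^ k) x y = (\<Sum>k\<le>d. a k * (\<Sum>i<k. y ^ (k - Suc i) * x ^ i))"
proof (cases "x = y")
  case True
  have "(\<Sum>i<k. y ^ (k - Suc i) * y ^ i) = real k * y ^ (k - 1)" for k
  proof -
    have "(\<Sum>i<k. y ^ (k - Suc i) * y ^ i) = (\<Sum>i<k. y ^ (k - 1))"
      by (intro sum.cong refl) (auto simp: power_add[symmetric])
    then show ?thesis by simp
  qed
  then show ?thesis
    using True by (simp add: diff_quot_def deriv_power_sum[where e = "\<lambda>k. k"] mult.assoc)
next
  case False
  have "(\<Sum>k\<le>d. a k * x ^ k) - (\<Sum>k\<le>d. a k * y ^ k) = (\<Sum>k\<le>d. a k * (x ^ k - y ^ k))"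
    by (simp add: sum_subtractf right_diff_distrib)
  also have "\<dots> = (x - y) * (\<Sum>k\<le>d. a k * (\<Sum>i<k. y ^ (k - Suc i) * x ^ i))"
    unfolding power_diff_sumr2 by (simp add: sum_distrib_left mult.left_commute)
  finally show ?thesis using False by (simp add: diff_quot_def)
qed

text \<open>The divided difference is a combination of the monomials $x^i y^{k-1-i}$, so the double integral
  factorises into moments; the double sum is flattened in order to integrate it in one step.\<close>
lemma mu_interaction_integral:
  fixes a :: "nat \<Rightarrow> real"
  assumes nu: "is_nu_density \<alpha> c g" and t: "0 \<le> t"
  defines "m \<equiv> \<lambda>k. nu_moment \<alpha> c k * t ^ k"
  shows "(\<integral>y. (\<integral>x. diff_quot (\<lambda>z. \<Sum>k\<le>d. a k * z ^ k) x y \<partial>mu g t) \<partial>mu g t)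
    = (\<Sum>k\<le>d. a k * (\<Sum>i<k. m i * m (k - Suc i)))"
proof -
  have flat: "(\<Sum>k\<le>d. a k * (\<Sum>i<k. w k i)) = (\<Sum>(k, i)\<in>(SIGMA k:{..d}. {..<k}). a k * w k i)"
    for w :: "nat \<Rightarrow> nat \<Rightarrow> real"
    by (simp add: sum.Sigma[symmetric] sum_distrib_left)
  have "(\<integral>x. diff_quot (\<lambda>z. \<Sum>k\<le>d. a k * z ^ k) x y \<partial>mu g t)
      = (\<Sum>(k, i)\<in>(SIGMA k:{..d}. {..<k}). a k * m i * y ^ (k - Suc i))" for y
    unfolding diff_quot_power_sum flat
    using mu_integral_polynomial[OF nu t, where I = "SIGMA k:{..d}. {..<k}"
        and a = "\<lambda>(k, i). a k * y ^ (k - Suc i)" and e = snd]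
    by (simp add: case_prod_beta m_def mult_ac)
  then have "(\<integral>y. (\<integral>x. diff_quot (\<lambda>z. \<Sum>k\<le>d. a k * z ^ k) x y \<partial>mu g t) \<partial>mu g t)
      = (\<Sum>(k, i)\<in>(SIGMA k:{..d}. {..<k}). a k * m i * m (k - Suc i))"
    using mu_integral_polynomial[OF nu t, where I = "SIGMA k:{..d}. {..<k}"
        and a = "\<lambda>(k, i). a k * m i" and e = "\<lambda>(k, i). k - Suc i"]
    by (simp add: case_prod_beta m_def)
  then show ?thesis by (simp add: flat mult.assoc)
qed

text \<open>The coefficients \<open>a\<close> are those of $f(t,\cdot)$, and \<open>a'\<close>
  those of $\partial_t f(t,\cdot)$. For a single power $x^k$ the interaction contributes
  $ck\sum_{i<k} m_i m_{k-1-i}$ and the diffusion $k(\alpha+k-1) m_{k-1}$, with $m_i = u_i t^i$; by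
  the recursion their sum is $k u_k t^{k-1}$, the derivative of $u_k t^k$.\<close>
lemma mu_generator_polynomial:
  fixes a a' :: "nat \<Rightarrow> real" and d :: nat
  assumes nu: "is_nu_density \<alpha> c g" and t: "0 \<le> t"
  defines "h \<equiv> \<lambda>z. \<Sum>k\<le>d. a k * z ^ k"
  shows "c * (\<integral>y. (\<integral>x. diff_quot (\<lambda>z. z * deriv h z) x y \<partial>mu g t) \<partial>mu g t)
      + (\<integral>x. \<alpha> * deriv h x + x * deriv (deriv h) x + (\<Sum>k\<le>d. a' k * x ^ k) \<partial>mu g t)
    = (\<Sum>k\<le>d. a k * (real k * nu_moment \<alpha> c k * t ^ (k - 1)) + a' k * (nu_moment \<alpha> c k * t ^ k))"
proof -
  define m where "m k = nu_moment \<alpha> c k * t ^ k" for k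
  have dh: "deriv h = (\<lambda>z. \<Sum>k\<le>d. a k * real k * z ^ (k - 1))"
    unfolding h_def by (rule deriv_power_sum[where e = "\<lambda>k. k"])
  have ddh: "deriv (deriv h) = (\<lambda>z. \<Sum>k\<le>d. a k * real k * real (k - 1) * z ^ (k - 1 - 1))"
    unfolding dh by (rule deriv_power_sum)
  \<comment> \<open>Multiplication by the variable undoes the truncated subtraction in the exponent.\<close>
  have zdh: "(\<lambda>z. z * deriv h z) = (\<lambda>z. \<Sum>k\<le>d. (a k * real k) * z ^ k)"
  proof
    fix z
    have "z * (a k * real k * z ^ (k - 1)) = a k * real k * z ^ k" for k by (cases k) simp_all
    then show "z * deriv h z = (\<Sum>k\<le>d. (a k * real k) * z ^ k)"
      unfolding dh by (simp only: sum_distrib_left)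
  qed
  have inter: "(\<integral>y. (\<integral>x. diff_quot (\<lambda>z. z * deriv h z) x y \<partial>mu g t) \<partial>mu g t)
      = (\<Sum>k\<le>d. a k * real k * (\<Sum>i<k. m i * m (k - Suc i)))"
    unfolding zdh m_def by (rule mu_interaction_integral[OF nu t])
  have "\<alpha> * deriv h x + x * deriv (deriv h) x
      = (\<Sum>k\<le>d. (a k * real k * (\<alpha> + real (k - 1))) * x ^ (k - 1))" for x
  proof -
    have "\<alpha> * (a k * real k * x ^ (k - 1)) + x * (a k * real k * real (k - 1) * x ^ (k - 1 - 1))
        = (a k * real k * (\<alpha> + real (k - 1))) * x ^ (k - 1)" for k
      by (cases "k - 1") (simp_all add: algebra_simps)
    then show ?thesis unfolding ddh unfolding dh
      by (simp only: sum_distrib_left sum.distrib[symmetric])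
  qed
  then have "(\<integral>x. \<alpha> * deriv h x + x * deriv (deriv h) x + (\<Sum>k\<le>d. a' k * x ^ k) \<partial>mu g t)
      = (\<integral>x. (\<Sum>k\<le>d. (a k * real k * (\<alpha> + real (k - 1))) * x ^ (k - 1)) + (\<Sum>k\<le>d. a' k * x ^ k) \<partial>mu g t)"
    by (simp only:)
  also have "\<dots> = (\<Sum>k\<le>d. (a k * real k * (\<alpha> + real (k - 1))) * m (k - 1)) + (\<Sum>k\<le>d. a' k * m k)"
    unfolding m_def mu_integral_polynomial[OF nu t, symmetric]
    by (rule Bochner_Integration.integral_add)
      (intro Bochner_Integration.integrable_sum integrable_mult_right mu_moments(1)[OF nu t])+
  finally have gen: "(\<integral>x. \<alpha> * deriv h x + x * deriv (deriv h) x + (\<Sum>k\<le>d. a' k * x ^ k) \<partial>mu g t)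
      = (\<Sum>k\<le>d. (a k * real k * (\<alpha> + real (k - 1))) * m (k - 1)) + (\<Sum>k\<le>d. a' k * m k)" .
  have rec: "c * (a k * real k * (\<Sum>i<k. m i * m (k - Suc i))) + a k * real k * (\<alpha> + real (k - 1)) * m (k - 1)
      = a k * (real k * nu_moment \<alpha> c k * t ^ (k - 1))" for k
  proof (cases k)
    case (Suc n)
    have "moment_drift \<alpha> c 0 n m = real (Suc n) * nu_moment \<alpha> c (Suc n) * t ^ n"
      unfolding m_def by (rule moment_drift_limit)
    then have "a (Suc n) * (real (Suc n) * ((\<alpha> + real n) * m n + c * (\<Sum>i\<le>n. m i * m (n - i))))
        = a (Suc n) * (real (Suc n) * nu_moment \<alpha> c (Suc n) * t ^ n)"
      by (simp add: moment_drift_def del: nu_moment.simps)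
    moreover have "c * (a (Suc n) * real (Suc n) * s) + a (Suc n) * real (Suc n) * (\<alpha> + real n) * m n
        = a (Suc n) * (real (Suc n) * ((\<alpha> + real n) * m n + c * s))" for s
      by (simp add: algebra_simps)
    ultimately show ?thesis
      unfolding Suc by (simp add: lessThan_Suc_atMost del: nu_moment.simps)
  qed simp
  show ?thesis
    unfolding inter gen m_def[symmetric]
    by (simp only: sum_distrib_left rec[symmetric] sum.distrib add.assoc)
qed

theorem theorem3p1:
  fixes \<alpha> c T :: real
    and M :: "nat \<Rightarrow> 'a measure"
    and F :: "nat \<Rightarrow> real \<Rightarrow> 'a measure"
    and b lam :: "nat \<Rightarrow> nat \<Rightarrow> real \<Rightarrow> 'a \<Rightarrow> real"
    and \<nu> :: "real \<Rightarrow> real"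
    and f :: "real \<Rightarrow> real \<Rightarrow> real"
  assumes "\<alpha> > 1/2" and "c > 0" and "T > 0"
    and process: "\<And>N. N \<ge> 1 \<Longrightarrow>
      beta_laguerre_process (M N) (F N) \<alpha> (2 * c / real N) N (b N) (lam N)"
    and nu: "is_nu_density \<alpha> c \<nu>"
    and polynomial: "real_polynomial_function (\<lambda>(t, x). f t x)"
  shows "tendsto_prob_C M T
           (\<lambda>N t \<omega>. \<integral>x. f t x \<partial>empirical_measure N (\<lambda>i. lam N i t \<omega>))
           (\<lambda>t. \<integral>x. f t x \<partial>mu \<nu> t)
         \<and>
         (\<forall>t\<ge>0.
           ((\<lambda>s. \<integral>x. f s x \<partial>mu \<nu> s) has_real_derivative
              c * (\<integral>y. (\<integral>x. diff_quot (\<lambda>z. z * deriv (f t) z) x y \<partial>mu \<nu> t) \<partial>mu \<nu> t)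
              + (\<integral>x. \<alpha> * deriv (f t) x + x * deriv (deriv (f t)) x + deriv (\<lambda>s. f s x) t \<partial>mu \<nu> t))
           (at t within {0..}))"
proof -
  obtain d p where f: "\<And>t x. f t x = (\<Sum>k\<le>d. poly (p k) t * x ^ k)"
    using real_polynomial_function_pairE[OF polynomial] by metis
  define L where "L t = (\<Sum>k\<le>d. poly (p k) t * (nu_moment \<alpha> c k * t ^ k))" for t
  have mu_f: "(\<integral>x. f t x \<partial>mu \<nu> t) = L t" if "0 \<le> t" for t
    unfolding f L_def by (rule mu_integral_polynomial[OF nu that, where e = "\<lambda>k. k"])
  have emp_f: "(\<integral>x. f t x \<partial>empirical_measure N y) = (\<Sum>k\<le>d. poly (p k) t * power_mean N y k)" for N y t
    unfolding f by (rule integral_empirical_polynomial)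
  have L_cont: "continuous_on A L" for A
    unfolding L_def by (intro continuous_intros)
  show ?thesis
  proof (intro conjI allI impI)
    have "unif_conv_prob M T (\<lambda>N t \<omega>. \<integral>x. f t x \<partial>empirical_measure N (\<lambda>i. lam N i t \<omega>)) L"
      unfolding emp_f L_def
      by (intro unif_conv_prob_sum unif_conv_prob_cmult laguerre_moments_converge[OF process \<open>T > 0\<close>]
          continuous_intros) auto
    then have "unif_conv_prob M T (\<lambda>N t \<omega>. \<integral>x. f t x \<partial>empirical_measure N (\<lambda>i. lam N i t \<omega>))
        (\<lambda>t. \<integral>x. f t x \<partial>mu \<nu> t)"
      by (simp add: unif_conv_prob_def mu_f)
    then show "tendsto_prob_C M T
           (\<lambda>N t \<omega>. \<integral>x. f t x \<partial>empirical_measure N (\<lambda>i. lam N i t \<omega>)) (\<lambda>t. \<integral>x. f t x \<partial>mu \<nu> t)"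
    proof (rule tendsto_prob_C_of_unif_conv_prob[OF _ \<open>T > 0\<close>])
      show "continuous_on {0..T} (\<lambda>t. \<integral>x. f t x \<partial>mu \<nu> t)"
        using L_cont[of "{0..T}"] by (rule continuous_on_eq) (simp add: mu_f)
      show "\<forall>\<^sub>F N in sequentially. prob_space (M N) \<and>
        (\<forall>\<omega>\<in>space (M N). continuous_on {0..T} (\<lambda>t. \<integral>x. f t x \<partial>empirical_measure N (\<lambda>i. lam N i t \<omega>))) \<and>
        (\<forall>t\<in>{0..T}. (\<lambda>\<omega>. \<integral>x. f t x \<partial>empirical_measure N (\<lambda>i. lam N i t \<omega>)) \<in> borel_measurable (M N))"
        using eventually_ge_at_top[of 1]
      proof eventually_elim
        case (elim N)
        note paths = laguerre_process_paths[OF process[OF elim]]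
        show ?case
          unfolding emp_f
        proof (intro conjI ballI paths(4))
          fix \<omega> assume "\<omega> \<in> space (M N)"
          then show "continuous_on {0..T} (\<lambda>t. \<Sum>k\<le>d. poly (p k) t * power_mean N (\<lambda>i. lam N i t \<omega>) k)"
            by (intro continuous_intros power_mean_continuous continuous_on_subset[OF paths(2)]) auto
        next
          fix t assume "t \<in> {0..T}"
          then have "lam N i t \<in> borel_measurable (M N)" if "i \<in> {1..N}" for i
            using paths(1)[OF that] by simp
          then show "(\<lambda>\<omega>. \<Sum>k\<le>d. poly (p k) t * power_mean N (\<lambda>i. lam N i t \<omega>) k) \<in> borel_measurable (M N)"
            unfolding power_mean_def
            by (intro borel_measurable_sum borel_measurable_times borel_measurable_divide
                borel_measurable_power borel_measurable_const)
          qed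
      qed
    qed
  next
    fix t :: real assume t: "0 \<le> t"
    have f_t: "f t = (\<lambda>z. \<Sum>k\<le>d. poly (p k) t * z ^ k)" by (simp add: f fun_eq_iff)
    have d_t: "deriv (\<lambda>s. f s x) t = (\<Sum>k\<le>d. poly (pderiv (p k)) t * x ^ k)" for x
      unfolding f by (intro DERIV_imp_deriv DERIV_sum DERIV_cmult_right poly_DERIV)
    have "(L has_real_derivative
        (\<Sum>k\<le>d. poly (p k) t * (real k * nu_moment \<alpha> c k * t ^ (k - 1))
              + poly (pderiv (p k)) t * (nu_moment \<alpha> c k * t ^ k))) (at t)"
      unfolding L_def
    proof (rule DERIV_sum)
      fix k
      have "((\<lambda>s. poly (p k) s * (nu_moment \<alpha> c k * s ^ k)) has_real_derivative
          poly (pderiv (p k)) t * (nu_moment \<alpha> c k * t ^ k)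
          + (nu_moment \<alpha> c k * (real k * t ^ (k - Suc 0))) * poly (p k) t) (at t)"
        by (intro DERIV_mult poly_DERIV DERIV_cmult DERIV_pow)
      then show "((\<lambda>s. poly (p k) s * (nu_moment \<alpha> c k * s ^ k)) has_real_derivative
          poly (p k) t * (real k * nu_moment \<alpha> c k * t ^ (k - 1))
          + poly (pderiv (p k)) t * (nu_moment \<alpha> c k * t ^ k)) (at t)"
        by (simp add: mult_ac add.commute)
    qed
    then have "(L has_real_derivative
        c * (\<integral>y. (\<integral>x. diff_quot (\<lambda>z. z * deriv (f t) z) x y \<partial>mu \<nu> t) \<partial>mu \<nu> t)
        + (\<integral>x. \<alpha> * deriv (f t) x + x * deriv (deriv (f t)) x + deriv (\<lambda>s. f s x) t \<partial>mu \<nu> t))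
        (at t within {0..})"
      unfolding d_t f_t mu_generator_polynomial[OF nu t] by (rule has_field_derivative_at_within)
    then show "((\<lambda>s. \<integral>x. f s x \<partial>mu \<nu> s) has_real_derivative
        c * (\<integral>y. (\<integral>x. diff_quot (\<lambda>z. z * deriv (f t) z) x y \<partial>mu \<nu> t) \<partial>mu \<nu> t)
        + (\<integral>x. \<alpha> * deriv (f t) x + x * deriv (deriv (f t)) x + deriv (\<lambda>s. f s x) t \<partial>mu \<nu> t))
        (at t within {0..})"
      by (rule has_field_derivative_transform_within[OF _ zero_less_one]) (use t mu_f in auto)
  qed
qed

end
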